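(* Let $G$ be a finitely generated parafree group and let $N<G$ be a non-trivial normal subgroup. If $N$ is finitely generated, then $G/N$ is finite.
   Context: The lower central series of a group $G$ is defined by $G_1=G$ and $G_{n+1}=\langle [x,y] : x\in G_n,\ y\in G\rangle$. A group $G$ is residually nilpotent if $\bigcap_n G_n=1$. Two residually nilpotent groups $G$ and $\Lambda$ have the same nilpotent genus if $G/G_c\cong\Lambda/\Lambda_c$ for all $c\ge 1$. A group is parafree if it is residually nilpotent and has the same nilpotent genus as a free group. *)

theory Defs
  imports "HOL-Algebra.Generated_Groups"
begin

section \<open>Free groups\<close>

text \<open>
  The letter \<open>(x, True)\<close> stands for \<open>x\<close> and \<open>(x, False)\<close> for its formal inverse. The free group
  on \<open>B\<close> consists of the reduced words over \<open>B\<close>, multiplied by concatenation and reduction.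
\<close>

fun flip :: "'x \<times> bool \<Rightarrow> 'x \<times> bool" where
  "flip (x, b) = (x, \<not> b)"

definition reduced :: "('x \<times> bool) list \<Rightarrow> bool" where
  "reduced = successively (\<lambda>p q. q \<noteq> flip p)"

fun push :: "'x \<times> bool \<Rightarrow> ('x \<times> bool) list \<Rightarrow> ('x \<times> bool) list" where
  "push p [] = [p]"
| "push p (q # ws) = (if q = flip p then ws else p # q # ws)"

definition free_group :: "'x set \<Rightarrow> ('x \<times> bool) list monoid" where
  "free_group B =
     \<lparr>carrier = {ws. fst ` set ws \<subseteq> B \<and> reduced ws}, monoid.mult = foldr push, one = []\<rparr>"

lemma flip_flip [simp]: "flip (flip p) = p"
  by (cases p) auto

lemma fst_flip [simp]: "fst (flip p) = fst p"
  by (cases p) auto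

lemma reduced_Nil [simp]: "reduced []"
  by (simp add: reduced_def)

lemma reduced_Cons: "reduced (p # ws) \<longleftrightarrow> (ws = [] \<or> hd ws \<noteq> flip p) \<and> reduced ws"
  by (auto simp: reduced_def successively_Cons)

lemma reduced_push: "reduced ws \<Longrightarrow> reduced (push p ws)"
  by (cases ws) (auto simp: reduced_Cons)

lemma set_push: "set (push p ws) \<subseteq> insert p (set ws)"
  by (cases ws) auto

lemma push_flip: "reduced ws \<Longrightarrow> push p (push (flip p) ws) = ws"
proof (cases ws)
  case (Cons q qs)
  assume "reduced ws"
  then show ?thesis
    using Cons by (cases qs) (auto simp: reduced_Cons)
qed simp

lemma reduced_foldr_push: "reduced ys \<Longrightarrow> reduced (foldr push xs ys)"
  by (induction xs) (auto simp: reduced_push)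

lemma set_foldr_push: "set (foldr push xs ys) \<subseteq> set xs \<union> set ys"
proof (induction xs)
  case (Cons p xs)
  then show ?case using set_push[of p "foldr push xs ys"] by auto
qed simp

lemma foldr_push_push:
  "reduced zs \<Longrightarrow> foldr push (push p ys) zs = push p (foldr push ys zs)"
  by (cases ys) (auto simp: push_flip reduced_foldr_push)

lemma foldr_push_assoc:
  "reduced zs \<Longrightarrow> foldr push (foldr push xs ys) zs = foldr push xs (foldr push ys zs)"
  by (induction xs) (auto simp: foldr_push_push)

lemma foldr_push_Nil: "reduced xs \<Longrightarrow> foldr push xs [] = xs"
proof (induction xs)
  case (Cons p xs)
  then show ?case by (cases xs) (auto simp: reduced_Cons)
qed simp

lemma foldr_push_inverse: "foldr push (rev (map flip xs)) xs = []"
  by (induction xs) auto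

lemma reduced_rev_flip: "reduced xs \<Longrightarrow> reduced (rev (map flip xs))"
proof -
  have "(\<lambda>p q. flip p \<noteq> flip (flip q)) = (\<lambda>p q :: 'a \<times> bool. q \<noteq> flip p)"
    by (auto simp: fun_eq_iff)
  moreover assume "reduced xs"
  ultimately show ?thesis
    unfolding reduced_def by (simp only: successively_rev successively_map)
qed

lemma group_free_group: "group (free_group B)"
proof (rule groupI)
  fix xs ys assume "xs \<in> carrier (free_group B)" "ys \<in> carrier (free_group B)"
  then show "xs \<otimes>\<^bsub>free_group B\<^esub> ys \<in> carrier (free_group B)"
    using set_foldr_push[of xs ys] by (fastforce simp: free_group_def reduced_foldr_push)
next
  fix xs assume xs: "xs \<in> carrier (free_group B)"
  then have "rev (map flip xs) \<in> carrier (free_group B)"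
    by (auto simp: free_group_def reduced_rev_flip)
  moreover have "rev (map flip xs) \<otimes>\<^bsub>free_group B\<^esub> xs = \<one>\<^bsub>free_group B\<^esub>"
    by (simp add: free_group_def foldr_push_inverse)
  ultimately show "\<exists>ys\<in>carrier (free_group B). ys \<otimes>\<^bsub>free_group B\<^esub> xs = \<one>\<^bsub>free_group B\<^esub>"
    by blast
qed (auto simp: free_group_def foldr_push_assoc)

lemma free_group_universal:
  assumes "group H" "f \<in> B \<rightarrow> carrier H"
  obtains h where "h \<in> hom (free_group B) H" "\<And>x. x \<in> B \<Longrightarrow> h [(x, True)] = f x"
proof -
  interpret H: group H by fact
  define l where "l = (\<lambda>(x, b). if b then f x else inv\<^bsub>H\<^esub> f x)"
  define h where "h = (\<lambda>ws. foldr (\<lambda>p a. l p \<otimes>\<^bsub>H\<^esub> a) ws \<one>\<^bsub>H\<^esub>)"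
  have l: "l p \<in> carrier H" if "fst p \<in> B" for p
    using that assms(2) by (auto simp: l_def split: prod.split)
  have l_flip: "l p \<otimes>\<^bsub>H\<^esub> l (flip p) = \<one>\<^bsub>H\<^esub>" if "fst p \<in> B" for p
  proof -
    have "f (fst p) \<in> carrier H" using that assms(2) by auto
    then show ?thesis by (cases p) (auto simp: l_def)
  qed
  have h: "h ws \<in> carrier H" if "fst ` set ws \<subseteq> B" for ws
    using that by (induction ws) (auto simp: h_def l)
  have h_push: "h (push p ws) = l p \<otimes>\<^bsub>H\<^esub> h ws" if "fst p \<in> B" "fst ` set ws \<subseteq> B" for p ws
  proof (cases ws)
    case (Cons q qs)
    then have "h qs \<in> carrier H" using that h by auto
    then have "l p \<otimes>\<^bsub>H\<^esub> (l (flip p) \<otimes>\<^bsub>H\<^esub> h qs) = h qs"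
      using that l l_flip by (simp flip: H.m_assoc)
    then show ?thesis using Cons by (auto simp: h_def)
  qed (simp add: h_def)
  have "h (foldr push xs ys) = h xs \<otimes>\<^bsub>H\<^esub> h ys"
    if "fst ` set xs \<subseteq> B" "fst ` set ys \<subseteq> B" for xs ys
    using that(1)
  proof (induction xs)
    case Nil
    then show ?case using h[OF that(2)] by (simp add: h_def)
  next
    case (Cons p xs)
    have "fst ` set (foldr push xs ys) \<subseteq> B"
      using image_mono[OF set_foldr_push[of xs ys], of fst] Cons.prems that(2)
      by (simp add: image_Un) (meson Un_least order_trans)
    moreover have "h (p # xs) = l p \<otimes>\<^bsub>H\<^esub> h xs" by (simp add: h_def)
    ultimately show ?case
      using Cons h[OF that(2)] h[of xs] h_push[of p "foldr push xs ys"] l[of p]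
      by (simp add: H.m_assoc)
  qed
  then have "h \<in> hom (free_group B) H"
    using h by (auto simp: hom_def free_group_def)
  moreover have "h [(x, True)] = f x" if "x \<in> B" for x
    using funcset_mem[OF assms(2) that] by (simp add: h_def l_def)
  ultimately show thesis by (rule that)
qed

section \<open>Parafree groups\<close>

text \<open>The index starts at 1; the value at 0 is never used.\<close>

primrec lower_central :: "('a, 'm) monoid_scheme \<Rightarrow> nat \<Rightarrow> 'a set" where
  "lower_central G 0 = carrier G"
| "lower_central G (Suc n) =
     (if n = 0 then carrier G
      else generate G {x \<otimes>\<^bsub>G\<^esub> y \<otimes>\<^bsub>G\<^esub> inv\<^bsub>G\<^esub> x \<otimes>\<^bsub>G\<^esub> inv\<^bsub>G\<^esub> y | x y.
                         x \<in> lower_central G n \<and> y \<in> carrier G})"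

definition residually_nilpotent :: "('a, 'm) monoid_scheme \<Rightarrow> bool" where
  "residually_nilpotent G \<longleftrightarrow> (\<Inter>n\<in>{1..}. lower_central G n) = {\<one>\<^bsub>G\<^esub>}"

definition same_nilpotent_genus ::
    "('a, 'm) monoid_scheme \<Rightarrow> ('b, 'k) monoid_scheme \<Rightarrow> bool" where
  "same_nilpotent_genus G H \<longleftrightarrow>
     (\<forall>c\<ge>1. (G Mod lower_central G c) \<cong> (H Mod lower_central H c))"

text \<open>
  HOL cannot quantify existentially over types, so the type from which the basis of the free group
  is taken is a parameter. A theorem that assumes \<open>parafree TYPE('x) G\<close> for a type variable \<open>'x\<close>
  covers all free groups. Residual nilpotence of the free group is not demanded
  separately, since it always holds (Magnus).
\<close>

definition parafree :: "'x itself \<Rightarrow> ('a, 'm) monoid_scheme \<Rightarrow> bool" where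
  "parafree (_ :: 'x itself) G \<longleftrightarrow>
     group G \<and> residually_nilpotent G \<and> (\<exists>B :: 'x set. same_nilpotent_genus G (free_group B))"

definition finitely_generated_group :: "('a, 'm) monoid_scheme \<Rightarrow> bool" where
  "finitely_generated_group G \<longleftrightarrow>
     group G \<and> (\<exists>S. finite S \<and> S \<subseteq> carrier G \<and> generate G S = carrier G)"

lemma (in group) lower_central_normal: "lower_central G n \<lhd> G"
proof (induction n)
  case (Suc n)
  interpret L: normal "lower_central G n" G by fact
  let ?C = "{x \<otimes> y \<otimes> inv x \<otimes> inv y | x y. x \<in> lower_central G n \<and> y \<in> carrier G}"
  have "generate G ?C \<lhd> G"
  proof (rule normal_generateI)
    show "?C \<subseteq> carrier G" using L.subset by auto
  next
    fix h g assume "h \<in> ?C" and g: "g \<in> carrier G"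
    then obtain x y where h: "h = x \<otimes> y \<otimes> inv x \<otimes> inv y"
      and x: "x \<in> lower_central G n" and y: "y \<in> carrier G" by blast
    have xc: "x \<in> carrier G" using x L.subset by blast
    let ?x = "g \<otimes> x \<otimes> inv g" and ?y = "g \<otimes> y \<otimes> inv g"
    have "inv g \<otimes> (g \<otimes> z) = z" if "z \<in> carrier G" for z
      using that g by (simp flip: m_assoc)
    then have "g \<otimes> h \<otimes> inv g = ?x \<otimes> ?y \<otimes> inv ?x \<otimes> inv ?y"
      using g xc y by (simp add: h inv_mult_group m_assoc)
    moreover have "?x \<in> lower_central G n" using L.inv_op_closed2 g x by blast
    moreover have "?y \<in> carrier G" using g y by simp
    ultimately show "g \<otimes> h \<otimes> inv g \<in> ?C" by blast
  qed
  then show ?case by (simp add: normal_self)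
qed (simp add: normal_self)

end

theory Submission
  imports Defs "HOL-Analysis.Analysis" "HOL-Library.List_Lexorder" "HOL-Algebra.Group_Action"
begin

text \<open>
  Let \<open>F\<close> be the free group with the same nilpotent genus. Its basis is finite; if it has at most one
  element, then \<open>G\<close> is cyclic. Otherwise suppose that \<open>N\<close> has infinite index.

  By Magnus and Witt, \<open>F\<close> and hence \<open>G\<close> is torsion-free and residually a finite 2-group. For a finite
  2-group quotient \<open>Q\<close> of \<open>G\<close>, there are as many derivations \<open>G \<rightarrow> (\<int>/2\<^sup>j)\<^sup>Q\<close> as for \<open>F\<close>, since they are
  homomorphisms to a finite 2-group. Letting \<open>j\<close> tend to infinity, the pigeonhole principle yields at
  least \<open>card Q\<close> linearly independent real solutions of any finite part of the cocycle equations,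
  even if the cocycle has to vanish at a given \<open>n\<^sub>0 \<in> N\<close> other than 1. A column of the projection onto the
  solution space, and compactness, give a non-zero cocycle of \<open>G\<close> in \<open>\<ell>\<^sup>2(G)\<close> that vanishes at \<open>n\<^sub>0\<close>;
  right convolution by it is bounded.

  Evaluating at the generators of \<open>N\<close> and restricting to \<open>N\<close>, one gets an \<open>N\<close>-equivariant
  contraction \<open>X\<close> from \<open>\<ell>\<^sup>2(G)\<close> to finitely many copies of \<open>\<ell>\<^sup>2(N)\<close>. The cocycle attached to an element of the
  kernel of \<open>X\<close> vanishes, because \<open>n\<^sub>0\<close> has infinite order. So for \<open>t \<in> G\<close> the sum over \<open>k\<close> of
  \<open>\<parallel>X (1 - X\<^sup>* X)\<^sup>k t\<parallel>\<^sup>2\<close> is bounded below by a positive constant, whereas its sum over representatives of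
  the cosets of \<open>N\<close> is at most the number of generators of \<open>N\<close>. Hence there are only finitely many cosets.
\<close>

section \<open>Lower central series\<close>

text \<open>In the background are two facts on the first L2-Betti number: it is at least
  \<open>card B - 1\<close> for such a \<open>G\<close>, and it vanishes for groups with an infinite
  finitely generated normal subgroup of infinite index. No dimension theory over von Neumann
  algebras is used; finite counts and bounds for traces of contractions take its place. The obstacle
  is that \<open>G\<close> need not be finitely presented, so a finite level can impose only
  finitely many relations. The lower bound \<open>(card B - 1) * card Q\<close> depends neither on
  the relations nor on their number, and this uniformity lets compactness impose all of them.

  Vanishing at one element costs at most \<open>card Q\<close> dimensions, so \<open>card B\<close>
  has to be at least 2. The condition removes the inner derivations: a square-summable cocycle that
  vanishes at an element of infinite order in \<open>N\<close> is determined by its restriction to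
  \<open>N\<close>. A single prime is used throughout, because only homomorphisms to nilpotent
  groups transfer from the free group to \<open>G\<close>, and the semidirect product of
  \<open>Q\<close> with its module has to be nilpotent as well.\<close>

definition commutator :: "('a, 'm) monoid_scheme \<Rightarrow> 'a \<Rightarrow> 'a \<Rightarrow> 'a" where
  "commutator G x y = x \<otimes>\<^bsub>G\<^esub> y \<otimes>\<^bsub>G\<^esub> inv\<^bsub>G\<^esub> x \<otimes>\<^bsub>G\<^esub> inv\<^bsub>G\<^esub> y"

declare lower_central.simps(2) [simp del]

context group
begin

lemma inv_cancel1: "x \<in> carrier G \<Longrightarrow> y \<in> carrier G \<Longrightarrow> inv x \<otimes> (x \<otimes> y) = y"
  by (simp flip: m_assoc)

lemma inv_cancel2: "x \<in> carrier G \<Longrightarrow> y \<in> carrier G \<Longrightarrow> x \<otimes> (inv x \<otimes> y) = y"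
  by (simp flip: m_assoc)

text \<open>Made for the Hall-Witt identity, whose middle factor is thereby expressed through the
  outer two.\<close>

lemma solve_middle:
  assumes "x \<in> carrier G" "y \<in> carrier G" "z \<in> carrier G" "x \<otimes> y \<otimes> z = \<one>"
  shows "y = inv x \<otimes> inv z"
proof -
  have "inv x \<otimes> (x \<otimes> y \<otimes> z) \<otimes> inv z = inv x \<otimes> inv z" using assms by simp
  then show ?thesis using assms(1-3) by (simp add: m_assoc inv_cancel1)
qed

lemmas group_word_simps = m_assoc inv_mult_group inv_cancel1 inv_cancel2

lemma commutator_closed [simp]:
  "x \<in> carrier G \<Longrightarrow> y \<in> carrier G \<Longrightarrow> commutator G x y \<in> carrier G"
  by (simp add: commutator_def)

lemma commutator_eq_one_iff:
  assumes "x \<in> carrier G" "y \<in> carrier G"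
  shows "commutator G x y = \<one> \<longleftrightarrow> x \<otimes> y = y \<otimes> x"
proof -
  have "commutator G x y = (x \<otimes> y) \<otimes> inv (y \<otimes> x)"
    using assms by (simp add: commutator_def group_word_simps)
  then show ?thesis
    using assms by (metis inv_closed m_closed inv_solve_right l_one one_closed)
qed

lemma commutator_self [simp]: "x \<in> carrier G \<Longrightarrow> commutator G x x = \<one>"
  by (simp add: commutator_eq_one_iff)

lemma inv_commutator:
  "x \<in> carrier G \<Longrightarrow> y \<in> carrier G \<Longrightarrow> inv (commutator G x y) = commutator G y x"
  by (simp add: commutator_def group_word_simps)

lemma lower_central_subset: "lower_central G n \<subseteq> carrier G"
  using lower_central_normal[of n] by (meson normal_imp_subgroup subgroup.subset)

lemma lower_central_closed: "x \<in> lower_central G n \<Longrightarrow> x \<in> carrier G"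
  using lower_central_subset by blast

lemma subgroup_lower_central: "subgroup (lower_central G n) G"
  using lower_central_normal by (rule normal_imp_subgroup)

lemma lower_central_1 [simp]: "lower_central G (Suc 0) = carrier G"
  by (simp add: lower_central.simps)

lemma lower_central_Suc_Suc:
  "lower_central G (Suc (Suc n)) =
     generate G {commutator G x y | x y. x \<in> lower_central G (Suc n) \<and> y \<in> carrier G}"
  by (simp add: commutator_def lower_central.simps)

lemma lower_central_conj:
  "x \<in> lower_central G n \<Longrightarrow> y \<in> carrier G \<Longrightarrow> y \<otimes> x \<otimes> inv y \<in> lower_central G n"
  using lower_central_normal[of n] by (simp add: normal.inv_op_closed2)

lemma commutator_lower_central_Suc:
  assumes "x \<in> lower_central G n" "y \<in> carrier G"
  shows "commutator G x y \<in> lower_central G (Suc n)"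
proof (cases n)
  case 0
  then show ?thesis using assms by simp
next
  case (Suc k)
  then show ?thesis using assms unfolding Suc lower_central_Suc_Suc
    by (intro generate.incl) auto
qed

lemma commutator_lower_central_left:
  assumes "x \<in> lower_central G n" "y \<in> carrier G"
  shows "commutator G x y \<in> lower_central G n"
proof -
  interpret L: subgroup "lower_central G n" G by (rule subgroup_lower_central)
  have "x \<in> carrier G" using assms lower_central_closed by blast
  then have "commutator G x y = x \<otimes> (y \<otimes> inv x \<otimes> inv y)"
    using assms by (simp add: commutator_def group_word_simps)
  then show ?thesis
    using assms lower_central_conj[of "inv x" n y] by simp
qed

lemma lower_central_Suc_subset: "lower_central G (Suc n) \<subseteq> lower_central G n"
proof (cases n)
  case 0
  then show ?thesis by simp
next
  case (Suc k)
  show ?thesis unfolding Suc lower_central_Suc_Suc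
    by (rule generate_subgroup_incl)
       (use commutator_lower_central_left subgroup_lower_central in auto)
qed

lemma lower_central_antimono: "m \<le> n \<Longrightarrow> lower_central G n \<subseteq> lower_central G m"
  by (rule lift_Suc_antimono_le[of "lower_central G"]) (use lower_central_Suc_subset in auto)

lemma commutator_mult_left:
  assumes "x \<in> carrier G" "x' \<in> carrier G" "y \<in> carrier G"
  shows "commutator G (x \<otimes> x') y = (x \<otimes> commutator G x' y \<otimes> inv x) \<otimes> commutator G x y"
  using assms by (simp add: commutator_def group_word_simps)

lemma commutator_mult_right:
  assumes "x \<in> carrier G" "y \<in> carrier G" "y' \<in> carrier G"
  shows "commutator G x (y \<otimes> y') = commutator G x y \<otimes> (y \<otimes> commutator G x y' \<otimes> inv y)"
  using assms by (simp add: commutator_def group_word_simps)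

lemma commutator_inv_left:
  assumes "x \<in> carrier G" "y \<in> carrier G"
  shows "commutator G (inv x) y = inv x \<otimes> inv (commutator G x y) \<otimes> x"
  using assms by (simp add: commutator_def group_word_simps)

lemma commutator_inv_right:
  assumes "x \<in> carrier G" "y \<in> carrier G"
  shows "commutator G x (inv y) = inv y \<otimes> inv (commutator G x y) \<otimes> y"
  using assms by (simp add: commutator_def group_word_simps)

text \<open>The group form of the Jacobi identity: all letters cancel once the commutators are
  expanded.\<close>

lemma Hall_Witt:
  assumes "x \<in> carrier G" "y \<in> carrier G" "z \<in> carrier G"
  shows "(x \<otimes> commutator G y (commutator G (inv x) z) \<otimes> inv x) \<otimes>
         (z \<otimes> commutator G x (commutator G (inv z) y) \<otimes> inv z) \<otimes>
         (y \<otimes> commutator G z (commutator G (inv y) x) \<otimes> inv y) = \<one>"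
  using assms by (simp add: commutator_def group_word_simps)

text \<open>The three subgroups argument, by induction on \<open>n\<close>: on a generator
  \<open>[a, b]\<close> of the next term, two factors of the Hall-Witt identity lie in the target by
  the induction hypothesis, hence so does the third. One of them uses the hypothesis for
  \<open>Suc m\<close>, so \<open>m\<close> is arbitrary.\<close>

lemma commutator_lower_central:
  assumes "x \<in> lower_central G m" "y \<in> lower_central G n" "1 \<le> m" "1 \<le> n"
  shows "commutator G x y \<in> lower_central G (m + n)"
  using \<open>1 \<le> n\<close> assms(1-3)
proof (induction n arbitrary: m x y rule: nat_induct_at_least)
  case base
  then show ?case using commutator_lower_central_Suc[of x m y] lower_central_closed[of y] by simp
next
  case (Suc n)
  interpret L: subgroup "lower_central G (m + Suc n)" G by (rule subgroup_lower_central)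
  have x: "x \<in> carrier G" using Suc lower_central_closed by blast
  have conj: "g \<otimes> h \<otimes> inv g \<in> lower_central G (m + Suc n)"
    if "h \<in> lower_central G (m + Suc n)" "g \<in> carrier G" for g h
    using that lower_central_conj by blast
  have conj': "inv g \<otimes> h \<otimes> g \<in> lower_central G (m + Suc n)"
    if "h \<in> lower_central G (m + Suc n)" "g \<in> carrier G" for g h
    using conj[OF that(1), of "inv g"] that by simp
  have gen: "commutator G x (commutator G a b) \<in> lower_central G (m + Suc n)"
    if a: "a \<in> lower_central G n" and b: "b \<in> carrier G" for a b
  proof -
    interpret M: subgroup "lower_central G m" G by (rule subgroup_lower_central)
    interpret N: subgroup "lower_central G n" G by (rule subgroup_lower_central)
    have ac: "a \<in> carrier G" using a lower_central_closed by blast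
    let ?a = "inv a"
    let ?p = "x \<otimes> commutator G b (commutator G (inv x) ?a) \<otimes> inv x"
    let ?q = "b \<otimes> commutator G ?a (commutator G (inv b) x) \<otimes> inv b"
    let ?r = "commutator G x (commutator G a b)"
    have "commutator G (inv x) ?a \<in> lower_central G (m + n)"
      using Suc.IH[of "inv x" m ?a] Suc.prems a by simp
    then have "commutator G (commutator G (inv x) ?a) b \<in> lower_central G (Suc (m + n))"
      using b commutator_lower_central_Suc by blast
    then have "inv (commutator G (commutator G (inv x) ?a) b) \<in> lower_central G (m + Suc n)"
      using L.m_inv_closed by simp
    then have p: "?p \<in> lower_central G (m + Suc n)"
      using inv_commutator ac x b by (intro conj) auto
    have "commutator G x (inv b) \<in> lower_central G (Suc m)"
      using Suc.prems b commutator_lower_central_Suc by simp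
    then have "commutator G (inv b) x \<in> lower_central G (Suc m)"
      using inv_commutator[of x "inv b"] x b subgroup.m_inv_closed[OF subgroup_lower_central] by fastforce
    then have "commutator G (commutator G (inv b) x) ?a \<in> lower_central G (Suc m + n)"
      using Suc.IH[of "commutator G (inv b) x" "Suc m" ?a] a by simp
    then have "inv (commutator G (commutator G (inv b) x) ?a) \<in> lower_central G (m + Suc n)"
      using L.m_inv_closed by simp
    then have q: "?q \<in> lower_central G (m + Suc n)"
      using inv_commutator ac x b by (intro conj) auto
    \<comment> \<open>The last argument of the identity is \<open>inv a\<close>, so that the inner
      commutator of the middle factor is \<open>[a, b]\<close> itself.\<close>
    have "?p \<otimes> (?a \<otimes> ?r \<otimes> inv ?a) \<otimes> ?q = \<one>"
      using Hall_Witt[of x b ?a] x b ac by simp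
    then have "?a \<otimes> ?r \<otimes> inv ?a = inv ?p \<otimes> inv ?q"
      using x b ac
      by (intro solve_middle) auto
    then have "?a \<otimes> ?r \<otimes> inv ?a \<in> lower_central G (m + Suc n)"
      using L.m_closed[OF L.m_inv_closed[OF p] L.m_inv_closed[OF q]] by simp
    from conj[OF this ac] show ?thesis
      using x b ac by (simp add: group_word_simps)
  qed
  let ?C = "{commutator G a b | a b. a \<in> lower_central G n \<and> b \<in> carrier G}"
  have C: "?C \<subseteq> carrier G" using lower_central_closed by auto
  obtain k where k: "n = Suc k" using Suc.hyps by (cases n) auto
  have "y \<in> generate G ?C"
    using Suc.prems(2) unfolding k by (simp only: lower_central_Suc_Suc)
  then show ?case
  proof (induction y rule: generate.induct)
    case one
    then show ?case using x L.one_closed by (simp add: commutator_def)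
  next
    case (incl h)
    then show ?case using gen by blast
  next
    case (inv h)
    then have "h \<in> carrier G" using C by blast
    then show ?case using conj'[OF L.m_inv_closed] inv gen x by (auto simp: commutator_inv_right)
  next
    case (eng h1 h2)
    then have "h1 \<in> carrier G" "h2 \<in> carrier G" using generate_in_carrier[OF C] by auto
    with L.m_closed[OF eng.IH(1) conj[OF eng.IH(2)]] show ?case
      using x by (simp add: commutator_mult_right)
  qed
qed

lemma commutator_mem_commute:
  assumes "subgroup R G" "x \<in> carrier G" "y \<in> carrier G"
  shows "commutator G x y \<in> R \<longleftrightarrow> commutator G y x \<in> R"
  using assms inv_commutator subgroup.m_inv_closed by metis

text \<open>Elements of \<open>lower_central G n\<close> are central modulo the next term.\<close>

lemma conj_mem_mod_lower_central:
  assumes R: "subgroup R G" and "lower_central G (Suc n) \<subseteq> R" and "u \<in> lower_central G n" "g \<in> carrier G"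
  shows "g \<otimes> u \<otimes> inv g \<in> R \<longleftrightarrow> u \<in> R"
proof -
  interpret R: subgroup R G by fact
  have u: "u \<in> carrier G" using assms lower_central_closed by blast
  have "commutator G u g \<in> R" using commutator_lower_central_Suc assms by blast
  then have c: "commutator G g u \<in> R" using commutator_mem_commute[OF R] u assms(4) by blast
  have e: "g \<otimes> u \<otimes> inv g = commutator G g u \<otimes> u"
    using u assms by (simp add: commutator_def group_word_simps)
  show ?thesis
  proof
    assume "g \<otimes> u \<otimes> inv g \<in> R"
    then have "inv (commutator G g u) \<otimes> (g \<otimes> u \<otimes> inv g) \<in> R" using c by simp
    then show "u \<in> R" unfolding e using u assms by (simp add: inv_cancel1)
  next
    assume "u \<in> R"
    then show "g \<otimes> u \<otimes> inv g \<in> R" unfolding e using c by simp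
  qed
qed

text \<open>The commutator is bilinear modulo the term of weight \<open>m + n + 1\<close>, so it is
  enough to check generators of the left entry modulo \<open>lower_central G (Suc m)\<close>. This
  replaces a passage to the graded Lie ring.\<close>

lemma commutator_mem_generate:
  assumes R: "subgroup R G" "lower_central G (Suc (m + n)) \<subseteq> R" and mn: "1 \<le> m" "1 \<le> n"
    and U: "U \<subseteq> lower_central G m" "\<And>u. u \<in> U \<Longrightarrow> commutator G u y \<in> R"
    and x: "x \<in> generate G (U \<union> lower_central G (Suc m))" and y: "y \<in> lower_central G n"
  shows "commutator G x y \<in> R"
proof -
  interpret R: subgroup R G by fact
  have yc: "y \<in> carrier G" using y lower_central_closed by blast
  let ?V = "U \<union> lower_central G (Suc m)"
  have V: "?V \<subseteq> lower_central G m" using U lower_central_Suc_subset by blast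
  have Vc: "?V \<subseteq> carrier G" using V lower_central_subset by blast
  have gm: "generate G ?V \<subseteq> lower_central G m"
    using V subgroup_lower_central by (rule generate_subgroup_incl)
  have gen: "commutator G v y \<in> R" if "v \<in> ?V" for v
    using that U(2) commutator_lower_central[of v "Suc m" y n] y mn R by auto
  have comm: "commutator G v y \<in> lower_central G (m + n)" if "v \<in> lower_central G m" for v
    using that y mn commutator_lower_central by blast
  note conj = conj_mem_mod_lower_central[OF R]
  show ?thesis using x
  proof (induction x rule: generate.induct)
    case one
    then show ?case using yc by (simp add: commutator_def)
  next
    case (incl h)
    then show ?case by (rule gen)
  next
    case (inv h)
    then have h: "h \<in> carrier G" "h \<in> lower_central G m" using V Vc by auto
    then have "inv (commutator G h y) \<in> lower_central G (m + n)"
      using comm subgroup.m_inv_closed[OF subgroup_lower_central] by blast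
    from conj[OF this, of "inv h"] show ?case
      using gen[OF inv] h yc by (simp add: commutator_inv_left)
  next
    case (eng h1 h2)
    then have "h1 \<in> lower_central G m" "h2 \<in> lower_central G m" using gm by auto
    moreover from this have "h1 \<in> carrier G" "h2 \<in> carrier G" using lower_central_closed by auto
    ultimately show ?case using eng.IH conj[OF comm, of h2 h1] yc by (simp add: commutator_mult_left)
  qed
qed

text \<open>
  Membership in \<open>R\<close> modulo the next term of the lower central series is insensitive to replacing an
  entry by its inverse, so the inverses in the Hall-Witt identity disappear.
\<close>

lemma Jacobi_mem:
  assumes R: "subgroup R G" "lower_central G (Suc (i + j + k)) \<subseteq> R" and ijk: "1 \<le> i" "1 \<le> j" "1 \<le> k"
    and xyz: "x \<in> lower_central G i" "y \<in> lower_central G j" "z \<in> lower_central G k"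
    and yxz: "commutator G y (commutator G x z) \<in> R" and zyx: "commutator G z (commutator G y x) \<in> R"
  shows "commutator G x (commutator G z y) \<in> R"
proof -
  interpret R: subgroup R G by fact
  have c: "x \<in> carrier G" "y \<in> carrier G" "z \<in> carrier G" using xyz lower_central_closed by auto
  have inv_mem: "commutator G b (commutator G (inv a) d) \<in> R"
    if a: "a \<in> lower_central G l" and b: "b \<in> lower_central G m" and d: "d \<in> lower_central G n"
      and lmn: "l + m + n = i + j + k" "1 \<le> l" "1 \<le> m" "1 \<le> n"
      and mem: "commutator G b (commutator G a d) \<in> R" for a b d l m n
  proof -
    have cc: "a \<in> carrier G" "b \<in> carrier G" "d \<in> carrier G" using a b d lower_central_closed by auto
    let ?c = "commutator G a d"
    have c: "?c \<in> lower_central G (l + n)" using commutator_lower_central a d lmn by blast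
    \<comment> \<open>\<open>?S\<close> contains \<open>[inv a, d]\<close>, which agrees with the
      inverse of \<open>?c\<close> modulo the next term; by bilinearity only the commutator with
      \<open>?c\<close> itself has to be known.\<close>
    let ?S = "generate G ({?c} \<union> lower_central G (Suc (l + n)))"
    have S: "subgroup ?S G"
      using cc lower_central_subset by (intro generate_is_subgroup) auto
    have "commutator G a d \<in> ?S" by (intro generate.incl) auto
    then have "inv ?c \<in> ?S" by (rule subgroup.m_inv_closed[OF S])
    then have "commutator G (inv a) d \<in> ?S"
      using conj_mem_mod_lower_central[OF S, of "l + n" "inv ?c" "inv a"] cc
        subgroup.m_inv_closed[OF subgroup_lower_central c]
      by (auto simp: commutator_inv_left intro: generate.incl)
    have mem': "commutator G ?c b \<in> R" using mem commutator_mem_commute[OF R(1)] cc by simp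
    have "commutator G (commutator G (inv a) d) b \<in> R"
    proof (rule commutator_mem_generate[OF R(1)])
      have "l + n + m = i + j + k" using lmn by simp
      with R(2) show "lower_central G (Suc (l + n + m)) \<subseteq> R" by metis
      show "1 \<le> l + n" "1 \<le> m" using lmn by auto
      show "{?c} \<subseteq> lower_central G (l + n)" using c by simp
      show "commutator G u b \<in> R" if "u \<in> {?c}" for u using that mem' by simp
      show "commutator G (inv a) d \<in> ?S" by fact
      show "b \<in> lower_central G m" by fact
    qed
    then show ?thesis using commutator_mem_commute[OF R(1)] cc by simp
  qed
  have lc: "commutator G b (commutator G (inv a) d) \<in> lower_central G (i + j + k)"
    if a: "a \<in> lower_central G l" and b: "b \<in> lower_central G m" and d: "d \<in> lower_central G n"
      and lmn: "l + m + n = i + j + k" "1 \<le> l" "1 \<le> m" "1 \<le> n" for a b d l m n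
  proof -
    have "inv a \<in> lower_central G l" using a subgroup.m_inv_closed[OF subgroup_lower_central] by blast
    then have "commutator G (inv a) d \<in> lower_central G (l + n)"
      using d lmn commutator_lower_central by blast
    then have "commutator G b (commutator G (inv a) d) \<in> lower_central G (m + (l + n))"
      using b lmn commutator_lower_central by auto
    then show ?thesis using lmn by (simp add: algebra_simps)
  qed
  note conj = conj_mem_mod_lower_central[OF R]
  let ?p = "x \<otimes> commutator G y (commutator G (inv x) z) \<otimes> inv x"
  let ?q = "y \<otimes> commutator G z (commutator G (inv y) x) \<otimes> inv y"
  let ?r = "commutator G x (commutator G (inv z) y)"
  have p: "?p \<in> R" using inv_mem[OF xyz(1,2,3)] conj[OF lc[OF xyz(1,2,3)]] yxz c ijk by simp
  have q: "?q \<in> R" using inv_mem[OF xyz(2,3,1)] conj[OF lc[OF xyz(2,3,1)]] zyx c ijk by simp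
  have "?p \<otimes> (z \<otimes> ?r \<otimes> inv z) \<otimes> ?q = \<one>"
    using Hall_Witt c by simp
  then have "z \<otimes> ?r \<otimes> inv z = inv ?p \<otimes> inv ?q"
    using c
    by (intro solve_middle) auto
  then have "z \<otimes> ?r \<otimes> inv z \<in> R"
    using R.m_closed[OF R.m_inv_closed[OF p] R.m_inv_closed[OF q]] by simp
  then have r: "?r \<in> R" using conj[OF lc[OF xyz(3,1,2)]] c ijk by simp
  have "inv z \<in> lower_central G k" using xyz(3) subgroup.m_inv_closed[OF subgroup_lower_central] by blast
  from inv_mem[OF this xyz(1,2)] r show ?thesis using c ijk by simp
qed

lemma lower_central_trivial_mono: "lower_central G n = {\<one>} \<Longrightarrow> n \<le> m \<Longrightarrow> lower_central G m = {\<one>}"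
  using lower_central_antimono[of n m] subgroup.one_closed[OF subgroup_lower_central] by blast

end

lemma hom_commutator:
  assumes "group G" "group H" "h \<in> hom G H" "x \<in> carrier G" "y \<in> carrier G"
  shows "h (commutator G x y) = commutator H (h x) (h y)"
proof -
  interpret group_hom G H h using assms by (simp add: group_hom_def group_hom_axioms_def)
  show ?thesis using assms by (simp add: commutator_def)
qed

lemma hom_lower_central:
  assumes "group G" "group H" "h \<in> hom G H"
  shows "h ` lower_central G n \<subseteq> lower_central H n"
proof -
  interpret group_hom G H h using assms by (simp add: group_hom_def group_hom_axioms_def)
  show ?thesis
  proof (induction n rule: induct_nat_012)
    case (ge2 n)
    let ?C = "{commutator G x y | x y. x \<in> lower_central G (Suc n) \<and> y \<in> carrier G}"
    have C: "?C \<subseteq> carrier G" using G.lower_central_closed by auto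
    have "h ` generate G ?C = generate H (h ` ?C)" using C by (rule generate_img[symmetric])
    also have "\<dots> \<subseteq> lower_central H (Suc (Suc n))"
    proof (rule H.generate_subgroup_incl)
      show "h ` ?C \<subseteq> lower_central H (Suc (Suc n))"
        using ge2(2) G.lower_central_closed[of _ "Suc n"] hom_commutator[OF assms]
          H.commutator_lower_central_Suc[of _ "Suc n"] by fastforce
    qed (rule H.subgroup_lower_central)
    finally show ?case by (simp only: G.lower_central_Suc_Suc)
  qed auto
qed

section \<open>Lyndon words and their bracketings\<close>

lemma list_less_append: "v \<noteq> [] \<Longrightarrow> u < u @ v"
  for u v :: "'a::linorder list"
  by (simp add: list_less_def lexord_append_rightI neq_Nil_conv)

lemma list_append_less_iff [simp]: "u @ v < u @ w \<longleftrightarrow> v < w"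
  for u v w :: "'a::linorder list"
  by (induction u) auto

lemma list_append_le_iff [simp]: "u @ v \<le> u @ w \<longleftrightarrow> v \<le> w"
  for u v w :: "'a::linorder list"
  by (induction u) auto

lemma list_less_append_append:
  fixes u u' :: "'a::linorder list"
  assumes "u < u'" "\<And>z. u' \<noteq> u @ z"
  shows "u @ x < u' @ y"
  using assms
proof (induction u arbitrary: u')
  case Nil
  then show ?case by auto
next
  case (Cons a u)
  then show ?case by (cases u') auto
qed

lemma list_less_append_append_length:
  fixes u u' :: "'a::linorder list"
  assumes "u < u'" "length u' \<le> length u"
  shows "u @ x < u' @ y"
proof (rule list_less_append_append[OF assms(1)])
  fix z show "u' \<noteq> u @ z" using assms by auto
qed

definition lyndon :: "nat list \<Rightarrow> bool" where
  "lyndon w \<longleftrightarrow> w \<noteq> [] \<and> (\<forall>u v. w = u @ v \<longrightarrow> u \<noteq> [] \<longrightarrow> v \<noteq> [] \<longrightarrow> w < v)"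

lemma lyndon_le_suffix: "lyndon (u @ v) \<Longrightarrow> v \<noteq> [] \<Longrightarrow> u @ v \<le> v"
  by (cases "u = []") (auto simp: lyndon_def intro: less_imp_le)

lemma lyndon_append_less:
  assumes "lyndon u" "lyndon v" "u < v"
  shows "u @ v < v"
proof (cases "\<exists>z. v = u @ z")
  case True
  then obtain z where z: "v = u @ z" by blast
  then have "z \<noteq> []" "u \<noteq> []" using assms by (auto simp: lyndon_def)
  then have "v < z" using assms(2) z unfolding lyndon_def by blast
  then show ?thesis using z by (metis list_append_less_iff)
next
  case False
  then show ?thesis using list_less_append_append[OF assms(3), of v "[]"] by auto
qed

text \<open>A proper suffix that begins inside \<open>u\<close> starts with a proper suffix
  \<open>z\<close> of \<open>u\<close>; as \<open>u < z\<close> and \<open>z\<close> is shorter, the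
  comparison is decided before \<open>v\<close> is reached. Any other one is a suffix of
  \<open>v\<close>, thus at least \<open>v\<close>, and \<open>v\<close> exceeds
  \<open>u @ v\<close>.\<close>

lemma lyndon_append:
  assumes "lyndon u" "lyndon v" "u < v"
  shows "lyndon (u @ v)"
  unfolding lyndon_def
proof (intro conjI allI impI)
  show "u @ v \<noteq> []" using assms by (auto simp: lyndon_def)
next
  fix p s assume ps: "u @ v = p @ s" "p \<noteq> []" "s \<noteq> []"
  have uv: "u @ v < v" using assms by (rule lyndon_append_less)
  from ps(1) consider z where "u = p @ z" "z @ v = s" | z where "u @ z = p" "v = z @ s"
    by (auto simp: append_eq_append_conv2)
  then show "u @ v < s"
  proof cases
    case 1
    show ?thesis
    proof (cases "z = []")
      case True
      then show ?thesis using 1 uv by simp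
    next
      case False
      then have "u < z" using 1 ps assms unfolding lyndon_def by blast
      then show ?thesis using list_less_append_append_length[of u z v v] 1 by auto
    qed
  next
    case 2
    show ?thesis
    proof (cases "z = []")
      case True
      then show ?thesis using 2 uv by simp
    next
      case False
      then have "v < s" using 2 ps assms unfolding lyndon_def by blast
      then show ?thesis using uv by (rule less_trans[rotated])
    qed
  qed
qed

datatype bracket = Leaf nat | Node bracket bracket

primrec foliage :: "bracket \<Rightarrow> nat list" where
  "foliage (Leaf i) = [i]"
| "foliage (Node a b) = foliage a @ foliage b"

text \<open>Bracketings of Lyndon words: the leading word of the Lie polynomial of such a tree is its foliage.\<close>

primrec hall :: "bracket \<Rightarrow> bool" where
  "hall (Leaf i) \<longleftrightarrow> True"
| "hall (Node a b) \<longleftrightarrow> hall a \<and> hall b \<and> foliage a < foliage b \<and>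
     (case a of Leaf _ \<Rightarrow> True | Node _ c \<Rightarrow> foliage b \<le> foliage c)"

lemma foliage_nonempty [simp]: "foliage t \<noteq> []"
  by (induction t) auto

lemma length_foliage_pos: "0 < length (foliage t)"
  by simp

lemma lyndon_foliage: "hall t \<Longrightarrow> lyndon (foliage t)"
proof (induction t)
  case (Leaf i)
  then show ?case by (auto simp: lyndon_def Cons_eq_append_conv)
qed (auto intro: lyndon_append)

text \<open>If the suffix begins inside \<open>a = Node a1 a2\<close>, then by induction its part in
  \<open>a\<close> is at least \<open>foliage a2\<close>, which is at least \<open>foliage b\<close>
  by the last clause of \<open>hall\<close>. A suffix of \<open>foliage b\<close> is handled by the
  Lyndon property.\<close>

lemma hall_min_suffix:
  assumes "hall (Node a b)" "foliage a @ foliage b = u @ v" "u \<noteq> []" "v \<noteq> []"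
  shows "foliage b \<le> v"
  using assms
proof (induction a arbitrary: b u v)
  case (Leaf i)
  then obtain u' where u': "foliage b = u' @ v" by (cases u) auto
  then show ?case
    using Leaf lyndon_foliage[of b] lyndon_le_suffix[of u' v] by simp
next
  case (Node a1 a2)
  from Node.prems(2) consider z where "foliage (Node a1 a2) = u @ z" "z @ foliage b = v"
    | z where "foliage (Node a1 a2) @ z = u" "foliage b = z @ v"
    unfolding append_eq_append_conv2 by blast
  then show ?case
  proof cases
    case 1
    show ?thesis
    proof (cases "z = []")
      case False
      then have "foliage a2 \<le> z" using Node.IH(1)[of a2 u z] Node.prems 1 by auto
      also have "z < v" using 1 list_less_append[of "foliage b" z] by auto
      finally show ?thesis using Node.prems by (auto intro: order.trans less_imp_le)
    qed (use 1 in simp)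
  next
    case 2
    then show ?thesis
      using Node.prems lyndon_foliage[of b] lyndon_le_suffix[of z v] by simp
  qed
qed

text \<open>The right factor is recovered from the word as its least proper suffix.\<close>

lemma hall_inj: "hall s \<Longrightarrow> hall t \<Longrightarrow> foliage s = foliage t \<Longrightarrow> s = t"
proof (induction s arbitrary: t)
  case (Leaf i)
  then show ?case
  proof (cases t)
    case (Node a b)
    then have "length (foliage a) + length (foliage b) = 1"
      using Leaf by (metis foliage.simps length_append One_nat_def length_Cons list.size(3))
    then show ?thesis using length_foliage_pos[of a] length_foliage_pos[of b] by linarith
  qed auto
next
  case (Node a b)
  then show ?case
  proof (cases t)
    case (Leaf i)
    then have "length (foliage a) + length (foliage b) = 1"
      using Node by (metis foliage.simps length_append One_nat_def length_Cons list.size(3))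
    then show ?thesis using length_foliage_pos[of a] length_foliage_pos[of b] by linarith
  next
    case t: (Node a' b')
    have eq: "foliage a @ foliage b = foliage a' @ foliage b'" using Node.prems t by simp
    have "foliage b = foliage b'"
      using hall_min_suffix[of a b "foliage a'" "foliage b'"] hall_min_suffix[of a' b' "foliage a" "foliage b"]
        eq Node.prems t by (simp add: order.antisym)
    then show ?thesis using eq Node t by auto
  qed
qed

definition hall_trees :: "nat \<Rightarrow> nat \<Rightarrow> bracket set" where
  "hall_trees r n = {t. hall t \<and> length (foliage t) = n \<and> set (foliage t) \<subseteq> {..<r}}"

lemma finite_hall_trees: "finite (hall_trees r n)"
proof (rule inj_on_finite)
  show "inj_on foliage (hall_trees r n)" by (auto simp: inj_on_def hall_trees_def hall_inj)
  show "foliage ` hall_trees r n \<subseteq> {w. set w \<subseteq> {..<r} \<and> length w = n}" by (auto simp: hall_trees_def)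
  show "finite {w. set w \<subseteq> {..<r} \<and> length w = n}" by (rule finite_lists_length_eq) simp
qed

section \<open>Noncommutative power series\<close>

typedef ncps = "UNIV :: (nat list \<Rightarrow> int) set"
  morphisms coeff Abs_ncps ..

setup_lifting type_definition_ncps

lemma ncps_eqI: "(\<And>w. coeff a w = coeff b w) \<Longrightarrow> a = b"
  by (simp add: coeff_inject[symmetric] fun_eq_iff)

text \<open>The Cauchy product, computed by stripping letters from the left factor instead of
  summing over all splittings. In this form associativity is an induction on the word;
  \<open>convolve_sum\<close> gives back the usual sum.\<close>

primrec convolve :: "(nat list \<Rightarrow> int) \<Rightarrow> (nat list \<Rightarrow> int) \<Rightarrow> nat list \<Rightarrow> int" where
  "convolve a b [] = a [] * b []"
| "convolve a b (x # w) = a [] * b (x # w) + convolve (\<lambda>v. a (x # v)) b w"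

lemma convolve_add_left: "convolve (\<lambda>v. a v + b v) c w = convolve a c w + convolve b c w"
  by (induction w arbitrary: a b) (auto simp: algebra_simps)

lemma convolve_add_right: "convolve a (\<lambda>v. b v + c v) w = convolve a b w + convolve a c w"
  by (induction w arbitrary: a) (auto simp: algebra_simps)

lemma convolve_scale_left: "convolve (\<lambda>v. k * a v) c w = k * convolve a c w"
  by (induction w arbitrary: a) (auto simp: algebra_simps)

lemma convolve_0_left [simp]: "convolve (\<lambda>v. 0) c w = 0"
  by (induction w) auto

lemma convolve_assoc: "convolve (convolve a b) c w = convolve a (convolve b c) w"
  by (induction w arbitrary: a b) (auto simp: algebra_simps convolve_add_left convolve_scale_left)

lemma convolve_one_left: "convolve (\<lambda>v. if v = [] then 1 else 0) c w = c w"
  by (cases w) auto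

lemma convolve_one_right: "convolve a (\<lambda>v. if v = [] then 1 else 0) w = a w"
  by (induction w arbitrary: a) auto

lemma convolve_sum: "convolve a b w = (\<Sum>i\<le>length w. a (take i w) * b (drop i w))"
  by (induction w arbitrary: a) (auto simp: sum.atMost_Suc_shift simp del: sum.atMost_Suc)

instantiation ncps :: ring_1
begin

lift_definition zero_ncps :: ncps is "\<lambda>_. 0" .
lift_definition one_ncps :: ncps is "\<lambda>v. if v = [] then 1 else 0" .
lift_definition plus_ncps :: "ncps \<Rightarrow> ncps \<Rightarrow> ncps" is "\<lambda>a b w. a w + b w" .
lift_definition minus_ncps :: "ncps \<Rightarrow> ncps \<Rightarrow> ncps" is "\<lambda>a b w. a w - b w" .
lift_definition uminus_ncps :: "ncps \<Rightarrow> ncps" is "\<lambda>a w. - a w" .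
lift_definition times_ncps :: "ncps \<Rightarrow> ncps \<Rightarrow> ncps" is convolve .

instance
proof
  show "(0::ncps) \<noteq> 1" by transfer (auto simp: fun_eq_iff)
qed (transfer; auto simp: fun_eq_iff convolve_assoc convolve_one_left convolve_one_right
      convolve_add_left convolve_add_right)+

end

lemmas coeff_simps [simp] = zero_ncps.rep_eq one_ncps.rep_eq plus_ncps.rep_eq minus_ncps.rep_eq uminus_ncps.rep_eq

lemma coeff_times: "coeff (a * b) w = (\<Sum>i\<le>length w. coeff a (take i w) * coeff b (drop i w))"
  by (simp add: times_ncps.rep_eq convolve_sum)

lemma coeff_times_Nil [simp]: "coeff (a * b) [] = coeff a [] * coeff b []"
  by (simp add: coeff_times)

lift_definition ncps_var :: "nat \<Rightarrow> ncps" is "\<lambda>i w. if w = [i] then 1 else 0" .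

lemma coeff_var: "coeff (ncps_var i) w = (if w = [i] then 1 else 0)"
  by (simp add: ncps_var.rep_eq)

definition deg_ge :: "nat \<Rightarrow> ncps \<Rightarrow> bool" where
  "deg_ge n a \<longleftrightarrow> (\<forall>w. length w < n \<longrightarrow> coeff a w = 0)"

lemma deg_ge_0 [simp]: "deg_ge 0 a" "deg_ge n 0"
  by (auto simp: deg_ge_def)

lemma deg_ge_add: "deg_ge n a \<Longrightarrow> deg_ge n b \<Longrightarrow> deg_ge n (a + b)"
  by (auto simp: deg_ge_def)

lemma deg_ge_diff: "deg_ge n a \<Longrightarrow> deg_ge n b \<Longrightarrow> deg_ge n (a - b)"
  by (auto simp: deg_ge_def)

lemma deg_ge_minus: "deg_ge n a \<Longrightarrow> deg_ge n (- a)"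
  by (auto simp: deg_ge_def)

lemma deg_ge_mono: "deg_ge n a \<Longrightarrow> m \<le> n \<Longrightarrow> deg_ge m a"
  by (auto simp: deg_ge_def)

lemma deg_ge_times:
  assumes "deg_ge m a" "deg_ge n b"
  shows "deg_ge (m + n) (a * b)"
  unfolding deg_ge_def coeff_times
proof (intro allI impI sum.neutral ballI)
  fix w :: "nat list" and i assume "length w < m + n" "i \<in> {..length w}"
  then have "length (take i w) < m \<or> length (drop i w) < n" by auto
  then show "coeff a (take i w) * coeff b (drop i w) = 0" using assms by (auto simp: deg_ge_def)
qed

lemma deg_ge_times_left: "deg_ge n a \<Longrightarrow> deg_ge n (a * b)"
  using deg_ge_times[of n a 0 b] by simp

lemma deg_ge_1_iff: "deg_ge (Suc 0) a \<longleftrightarrow> coeff a [] = 0"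
  by (auto simp: deg_ge_def)

lemma coeff_times_homogeneous:
  assumes "\<And>w. length w \<noteq> m \<Longrightarrow> coeff a w = 0"
  shows "coeff (a * b) w = (if m \<le> length w then coeff a (take m w) * coeff b (drop m w) else 0)"
proof -
  have "coeff (a * b) w = (\<Sum>i\<le>length w. if i = m then coeff a (take m w) * coeff b (drop m w) else 0)"
    unfolding coeff_times using assms by (intro sum.cong) (auto simp: min_def)
  then show ?thesis by simp
qed

text \<open>Solves \<open>a * b = 1\<close> for \<open>b\<close> when the constant term of
  \<open>a\<close> is 1: the equation at a word expresses the coefficient of \<open>b\<close> there
  through those at proper suffixes.\<close>

function ncps_rinv :: "(nat list \<Rightarrow> int) \<Rightarrow> nat list \<Rightarrow> int" where
  "ncps_rinv a [] = 1"
| "ncps_rinv a (x # w) = - (\<Sum>i\<le>length w. a (x # take i w) * ncps_rinv a (drop i w))"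
  by pat_completeness auto
termination by (relation "inv_image less_than (\<lambda>(a, w). length w)") auto

lemma ncps_right_inverse:
  assumes "coeff a [] = 1"
  obtains b where "coeff b [] = 1" "a * b = 1"
proof
  let ?b = "Abs_ncps (ncps_rinv (coeff a))"
  have b: "coeff ?b = ncps_rinv (coeff a)" by (simp add: Abs_ncps_inverse)
  show "coeff ?b [] = 1" by (simp add: b)
  show "a * ?b = 1"
  proof (rule ncps_eqI)
    fix w show "coeff (a * ?b) w = coeff 1 w"
      using assms
      by (cases w) (auto simp: coeff_times b sum.atMost_Suc_shift simp del: sum.atMost_Suc)
  qed
qed

definition magnus_group :: "ncps monoid" where
  "magnus_group = \<lparr>carrier = {a. coeff a [] = 1}, monoid.mult = (*), one = 1\<rparr>"

lemma magnus_group_simps [simp]: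
  "a \<in> carrier magnus_group \<longleftrightarrow> coeff a [] = 1"
  "a \<otimes>\<^bsub>magnus_group\<^esub> b = a * b" "\<one>\<^bsub>magnus_group\<^esub> = 1"
  by (auto simp: magnus_group_def)

lemma group_magnus_group: "group magnus_group"
proof (rule groupI)
  fix a assume a: "a \<in> carrier magnus_group"
  then obtain b where b: "coeff b [] = 1" "a * b = 1" using ncps_right_inverse[of a] by auto
  then obtain c where c: "coeff c [] = 1" "b * c = 1" using ncps_right_inverse[of b] by auto
  \<comment> \<open>The right inverse of the right inverse is \<open>a\<close> again, so right
    inverses are two-sided.\<close>
  have "a = a * (b * c)" using c by simp
  also have "\<dots> = c" using b by (simp flip: mult.assoc)
  finally show "\<exists>b\<in>carrier magnus_group. b \<otimes>\<^bsub>magnus_group\<^esub> a = \<one>\<^bsub>magnus_group\<^esub>"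
    using b c by auto
qed (auto simp: mult.assoc)

primrec lie_poly :: "bracket \<Rightarrow> ncps" where
  "lie_poly (Leaf i) = ncps_var i"
| "lie_poly (Node a b) = lie_poly a * lie_poly b - lie_poly b * lie_poly a"

lemma lie_poly_homogeneous: "length w \<noteq> length (foliage t) \<Longrightarrow> coeff (lie_poly t) w = 0"
proof (induction t arbitrary: w)
  case (Leaf i)
  then show ?case by (auto simp: coeff_var)
next
  case (Node a b)
  show ?case using Node.prems Node.IH
    by (auto simp: coeff_times_homogeneous[OF Node.IH(1)] coeff_times_homogeneous[OF Node.IH(2)])
qed

lemma deg_ge_lie_poly: "deg_ge (length (foliage t)) (lie_poly t)"
  by (auto simp: deg_ge_def lie_poly_homogeneous)

lemma list_append_mono_length:
  fixes u u' v v' :: "'a::linorder list"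
  assumes "u \<le> u'" "v \<le> v'" "length u' = length u"
  shows "u @ v \<le> u' @ v'"
proof (cases "u = u'")
  case False
  then show ?thesis using assms list_less_append_append_length[of u u' v v'] by (simp add: less_imp_le)
qed (use assms in simp)

text \<open>Leading means least. The least words of the two products are
  \<open>foliage a @ foliage b\<close> and \<open>foliage b @ foliage a\<close>; the Lyndon property
  makes the first one strictly smaller, so it survives in the difference with coefficient 1.\<close>

lemma lie_poly_leading:
  assumes "hall t"
  shows "coeff (lie_poly t) (foliage t) = 1" "w < foliage t \<Longrightarrow> coeff (lie_poly t) w = 0"
proof -
  have "coeff (lie_poly t) (foliage t) = 1 \<and> (\<forall>w<foliage t. coeff (lie_poly t) w = 0)"
    using assms
  proof (induction t)
    case (Leaf i)
    then show ?case by (auto simp: coeff_var)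
  next
    case (Node a b)
    let ?m = "length (foliage a)" and ?n = "length (foliage b)"
    have ly: "lyndon (foliage a)" "lyndon (foliage b)" "foliage a < foliage b"
      using Node.prems lyndon_foliage by auto
    have less: "foliage a @ foliage b < foliage b @ foliage a"
      using lyndon_append_less[OF ly] list_less_append[of "foliage a" "foliage b"]
      by (meson foliage_nonempty less_trans)
    have ab: "coeff (lie_poly a * lie_poly b) w =
        (if ?m \<le> length w then coeff (lie_poly a) (take ?m w) * coeff (lie_poly b) (drop ?m w) else 0)" for w
      by (rule coeff_times_homogeneous) (rule lie_poly_homogeneous)
    have ba: "coeff (lie_poly b * lie_poly a) w =
        (if ?n \<le> length w then coeff (lie_poly b) (take ?n w) * coeff (lie_poly a) (drop ?n w) else 0)" for w
      by (rule coeff_times_homogeneous) (rule lie_poly_homogeneous)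
    have ba0: "coeff (lie_poly b * lie_poly a) w = 0" if w: "w \<le> foliage a @ foliage b" for w
    proof (rule ccontr)
      assume "coeff (lie_poly b * lie_poly a) w \<noteq> 0"
      then have n: "?n \<le> length w" "coeff (lie_poly b) (take ?n w) \<noteq> 0" "coeff (lie_poly a) (drop ?n w) \<noteq> 0"
        unfolding ba by (auto split: if_splits)
      then have "foliage b \<le> take ?n w" "foliage a \<le> drop ?n w"
        using Node by (auto simp: not_less[symmetric])
      then have "foliage b @ foliage a \<le> take ?n w @ drop ?n w"
        using n by (intro list_append_mono_length) auto
      then show False using less w by auto
    qed
    have ab0: "coeff (lie_poly a * lie_poly b) w = 0" if w: "w < foliage a @ foliage b" for w
    proof (rule ccontr)
      assume "coeff (lie_poly a * lie_poly b) w \<noteq> 0"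
      then have n: "?m \<le> length w" "coeff (lie_poly a) (take ?m w) \<noteq> 0" "coeff (lie_poly b) (drop ?m w) \<noteq> 0"
        unfolding ab by (auto split: if_splits)
      then have "foliage a \<le> take ?m w" "foliage b \<le> drop ?m w"
        using Node by (auto simp: not_less[symmetric])
      then have "foliage a @ foliage b \<le> take ?m w @ drop ?m w"
        using n by (intro list_append_mono_length) auto
      then show False using w by auto
    qed
    show ?case using ab0 ba0 Node by (auto simp: ab)
  qed
  then show "coeff (lie_poly t) (foliage t) = 1" "w < foliage t \<Longrightarrow> coeff (lie_poly t) w = 0" by auto
qed

section \<open>The Magnus-Witt theorem\<close>

primrec bracket_value :: "('a, 'm) monoid_scheme \<Rightarrow> (nat \<Rightarrow> 'a) \<Rightarrow> bracket \<Rightarrow> 'a" where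
  "bracket_value G e (Leaf i) = e i"
| "bracket_value G e (Node a b) = commutator G (bracket_value G e a) (bracket_value G e b)"

context group
begin

lemma bracket_value_closed:
  assumes "e ` {..<r} \<subseteq> carrier G" "set (foliage t) \<subseteq> {..<r}"
  shows "bracket_value G e t \<in> carrier G"
  using assms(2)
proof (induction t)
  case (Leaf i)
  then show ?case using assms(1) by auto
qed simp

lemma bracket_value_lower_central:
  assumes "e ` {..<r} \<subseteq> carrier G" "set (foliage t) \<subseteq> {..<r}"
  shows "bracket_value G e t \<in> lower_central G (length (foliage t))"
  using assms
proof (induction t)
  case (Node a b)
  then show ?case
    using length_foliage_pos[of a] length_foliage_pos[of b]
    by (auto simp del: length_foliage_pos intro!: commutator_lower_central simp: Suc_le_eq)
qed auto

lemma bracket_value_hall_trees: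
  assumes "e ` {..<r} \<subseteq> carrier G"
  shows "bracket_value G e ` hall_trees r n \<subseteq> lower_central G n"
proof
  fix u assume "u \<in> bracket_value G e ` hall_trees r n"
  then obtain t where u: "u = bracket_value G e t" and "t \<in> hall_trees r n" by (rule imageE)
  then have t: "set (foliage t) \<subseteq> {..<r}" "length (foliage t) = n" by (simp_all add: hall_trees_def)
  with u show "u \<in> lower_central G n" using bracket_value_lower_central[OF assms t(1)] by simp
qed

text \<open>Spans modulo the next term are kept as subgroups of \<open>G\<close> that contain it, so
  that no quotient has to be formed.\<close>

definition bracket_span :: "(nat \<Rightarrow> 'a) \<Rightarrow> bracket set \<Rightarrow> nat \<Rightarrow> 'a set" where
  "bracket_span e V n = generate G (bracket_value G e ` V \<union> lower_central G (Suc n))"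

lemma bracket_span_subgroup:
  assumes "e ` {..<r} \<subseteq> carrier G" "V \<subseteq> hall_trees r n"
  shows "subgroup (bracket_span e V n) G"
  unfolding bracket_span_def
proof (rule generate_is_subgroup)
  show "bracket_value G e ` V \<union> lower_central G (Suc n) \<subseteq> carrier G"
    using bracket_value_hall_trees[OF assms(1), of n] assms(2) lower_central_subset by blast
qed

lemma bracket_span_mono: "V \<subseteq> W \<Longrightarrow> bracket_span e V n \<subseteq> bracket_span e W n"
  unfolding bracket_span_def by (intro mono_generate) auto

lemma lower_central_subset_bracket_span: "lower_central G (Suc n) \<subseteq> bracket_span e V n"
  unfolding bracket_span_def by (auto intro: generate.incl)

lemma bracket_value_in_span: "t \<in> V \<Longrightarrow> bracket_value G e t \<in> bracket_span e V n"
  unfolding bracket_span_def by (auto intro: generate.incl)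

lemma bracket_span_subset:
  assumes "e ` {..<r} \<subseteq> carrier G" "V \<subseteq> hall_trees r n"
  shows "bracket_span e V n \<subseteq> lower_central G n"
  unfolding bracket_span_def
proof (rule generate_subgroup_incl)
  show "bracket_value G e ` V \<union> lower_central G (Suc n) \<subseteq> lower_central G n"
    using lower_central_Suc_subset[of n] bracket_value_hall_trees[OF assms(1), of n] assms(2)
    by blast
qed (rule subgroup_lower_central)

text \<open>Both bounds feed the recursion of the collecting process: the upper one makes right
  entries smaller, the lower one keeps new foliages above the word from which the rewriting
  started.\<close>

definition hall_between :: "nat \<Rightarrow> nat \<Rightarrow> nat list \<Rightarrow> nat list \<Rightarrow> bracket set" where
  "hall_between r n lo hi = {t \<in> hall_trees r n. lo \<le> foliage t \<and> foliage t < hi}"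

lemma bracket_value_hall_between:
  "e ` {..<r} \<subseteq> carrier G \<Longrightarrow> bracket_value G e ` hall_between r n lo hi \<subseteq> lower_central G n"
  using bracket_value_hall_trees unfolding hall_between_def by blast

text \<open>
  The rewriting of a bracket of two Hall trees into Hall trees terminates because, for a fixed
  total length, each application of the Jacobi identity lowers the foliage of the right entry, and
  there are only finitely many words of bounded length.
\<close>

lemma hall_pair_induct [case_names step]:
  assumes step: "\<And>a b. (\<And>a' b'. length (foliage a') + length (foliage b') < length (foliage a) + length (foliage b) \<or>
      length (foliage a') + length (foliage b') = length (foliage a) + length (foliage b) \<and>
      set (foliage b') \<subseteq> {..<r} \<and> foliage b' < foliage b \<Longrightarrow> P a' b') \<Longrightarrow> P a b"
  shows "P a b"
proof -
  define W where "W = (\<lambda>(a, b). {w. set w \<subseteq> {..<r::nat} \<and> length w \<le> length (foliage a) + length (foliage b) \<and> w < foliage b})"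
  have "P (fst p) (snd p)" for p
  proof (induction p rule: wf_induct_rule[OF wf_measures[of
        "[\<lambda>(a, b). length (foliage a) + length (foliage b), \<lambda>p. card (W p)]"]])
    case (1 p)
    obtain a b where p: "p = (a, b)" by (cases p)
    have card: "card (W (a', b')) < card (W (a, b))"
      if "length (foliage a') + length (foliage b') = length (foliage a) + length (foliage b)"
        "set (foliage b') \<subseteq> {..<r}" "foliage b' < foliage b" for a' b'
    proof (rule psubset_card_mono)
      have "finite {w. set w \<subseteq> {..<r} \<and> length w \<le> length (foliage a) + length (foliage b)}"
        by (rule finite_lists_length_le) simp
      then show "finite (W (a, b))" by (rule finite_subset[rotated]) (auto simp: W_def)
      have "W (a', b') \<subseteq> W (a, b)" using that by (auto simp: W_def intro: less_trans)
      moreover have "foliage b' \<in> W (a, b) - W (a', b')"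
        using that by (auto simp: W_def simp flip: that(1))
      ultimately show "W (a', b') \<subset> W (a, b)" by blast
    qed
    have "P a b"
    proof (rule step)
      fix a' b'
      assume *: "length (foliage a') + length (foliage b') < length (foliage a) + length (foliage b) \<or>
        length (foliage a') + length (foliage b') = length (foliage a) + length (foliage b) \<and>
        set (foliage b') \<subseteq> {..<r} \<and> foliage b' < foliage b"
      then have "((a', b'), p) \<in> measures [\<lambda>(a, b). length (foliage a) + length (foliage b), \<lambda>p. card (W p)]"
        using card by (auto simp: p)
      from 1[OF this] show "P a' b'" by simp
    qed
    then show ?case by (simp add: p)
  qed
  from this[of "(a, b)"] show ?thesis by simp
qed

text \<open>The collecting process. If \<open>Node a b\<close> is not a Hall tree, then
  \<open>a = Node a1 a2\<close> with \<open>foliage a2 < foliage b\<close>, and the Jacobi identity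
  reduces the claim to \<open>[a1, [a2, b]]\<close> and \<open>[a2, [b, a1]]\<close>. The inner
  commutators have smaller weight and are spanned by trees with foliage below that of
  \<open>b\<close>; the commutators of these with the outer entry then have a smaller right entry
  than \<open>b\<close>.\<close>

lemma commutator_bracket_value:
  assumes e: "e ` {..<r} \<subseteq> carrier G"
    and "hall a" "hall b" "foliage a < foliage b" "set (foliage a) \<subseteq> {..<r}" "set (foliage b) \<subseteq> {..<r}"
  shows "commutator G (bracket_value G e a) (bracket_value G e b) \<in>
    bracket_span e (hall_between r (length (foliage a) + length (foliage b)) (foliage a @ foliage b) (foliage b))
      (length (foliage a) + length (foliage b))"
  using assms(2-)
proof (induction a b rule: hall_pair_induct[of r])
  case (step a b)
  let ?v = "bracket_value G e" and ?l = "\<lambda>t. length (foliage t)"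
  define k where "k = ?l a + ?l b"
  have IH: "commutator G (?v a') (?v b') \<in> bracket_span e (hall_between r k (foliage a' @ foliage b') (foliage b')) k"
    if "?l a' + ?l b' = k" "foliage b' < foliage b" "set (foliage b') \<subseteq> {..<r}" "hall a'" "hall b'"
      "foliage a' < foliage b'" "set (foliage a') \<subseteq> {..<r}" for a' b'
    using step.IH[of a' b'] that unfolding k_def by simp
  let ?R = "bracket_span e (hall_between r k (foliage a @ foliage b) (foliage b)) k"
  have Rsub: "subgroup ?R G"
    by (rule bracket_span_subgroup[OF e]) (auto simp: hall_between_def)
  interpret R: subgroup ?R G by (rule Rsub)
  have Rlc: "lower_central G (Suc k) \<subseteq> ?R" by (rule lower_central_subset_bracket_span)
  have Rmono: "bracket_span e (hall_between r k lo hi) k \<subseteq> ?R"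
    if "foliage a @ foliage b \<le> lo" "hi \<le> foliage b" for lo hi
    using that by (intro bracket_span_mono) (auto simp: hall_between_def)
  have lyb: "lyndon (foliage b)" and lya: "lyndon (foliage a)" using step.prems lyndon_foliage by auto
  show ?case
  proof (cases "hall (Node a b)")
    case True
    have "foliage a @ foliage b < foliage b"
      using lyndon_append_less lya lyb step.prems by blast
    then have "Node a b \<in> hall_between r k (foliage a @ foliage b) (foliage b)"
      using True step.prems by (auto simp: hall_between_def hall_trees_def k_def)
    from bracket_value_in_span[OF this, of e k] show ?thesis unfolding k_def by simp
  next
    case False
    then obtain a1 a2 where a: "a = Node a1 a2" and a2b: "foliage a2 < foliage b"
      using step.prems by (cases a) auto
    let ?x = "?v a1" and ?y = "?v a2" and ?z = "?v b"
    have h: "hall a1" "hall a2" "foliage a1 < foliage a2" "set (foliage a1) \<subseteq> {..<r}" "set (foliage a2) \<subseteq> {..<r}"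
      using step.prems a by auto
    have pos: "1 \<le> ?l a1" "1 \<le> ?l a2" "1 \<le> ?l b" by (auto simp: Suc_le_eq)
    have k: "k = ?l a1 + ?l a2 + ?l b" by (simp add: k_def a)
    have lc: "?x \<in> lower_central G (?l a1)" "?y \<in> lower_central G (?l a2)" "?z \<in> lower_central G (?l b)"
      using bracket_value_lower_central[OF e] h step.prems by auto
    have c: "?x \<in> carrier G" "?y \<in> carrier G" "?z \<in> carrier G"
      using bracket_value_closed[OF e] h step.prems by auto
    have aa2: "foliage a < foliage a2"
      using lya a unfolding lyndon_def by (metis foliage.simps(2) foliage_nonempty)
    have "commutator G ?x ?z \<in> bracket_span e (hall_between r (?l a1 + ?l b) (foliage a1 @ foliage b) (foliage b)) (?l a1 + ?l b)"
      using h step.prems a2b a pos(2) by (intro step.IH) auto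
    then have xz: "commutator G ?z ?x \<in> bracket_span e (hall_between r (?l a1 + ?l b) (foliage a1 @ foliage b) (foliage b)) (?l a1 + ?l b)"
      using commutator_mem_commute[OF bracket_span_subgroup[OF e] c(1,3)] by (simp add: hall_between_def)
    have yz: "commutator G ?y ?z \<in> bracket_span e (hall_between r (?l a2 + ?l b) (foliage a2 @ foliage b) (foliage b)) (?l a2 + ?l b)"
      using h step.prems a2b a pos(1) by (intro step.IH) auto
    have yzx: "commutator G ?y (commutator G ?z ?x) \<in> ?R"
    proof -
      have "commutator G (commutator G ?z ?x) ?y \<in> ?R"
      proof (rule commutator_mem_generate[OF Rsub _ _ _ _ _ xz[unfolded bracket_span_def]])
        have "?l a1 + ?l b + ?l a2 = k" by (simp add: k)
        then show "lower_central G (Suc (?l a1 + ?l b + ?l a2)) \<subseteq> ?R" using Rlc by simp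
        show "?v ` hall_between r (?l a1 + ?l b) (foliage a1 @ foliage b) (foliage b) \<subseteq> lower_central G (?l a1 + ?l b)"
          by (rule bracket_value_hall_between[OF e])
      next
        fix u assume "u \<in> ?v ` hall_between r (?l a1 + ?l b) (foliage a1 @ foliage b) (foliage b)"
        then obtain t where u: "u = ?v t" and t': "t \<in> hall_between r (?l a1 + ?l b) (foliage a1 @ foliage b) (foliage b)" by (rule imageE)
        then have t: "hall t" "?l t = ?l a1 + ?l b" "set (foliage t) \<subseteq> {..<r}"
          "foliage a1 @ foliage b \<le> foliage t" "foliage t < foliage b"
          by (simp_all add: hall_between_def hall_trees_def)
        have tk: "?l t + ?l a2 = k" "?l a2 + ?l t = k" using t k by auto
        have uc: "u \<in> carrier G" using u bracket_value_closed[OF e t(3)] by simp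
        \<comment> \<open>Either order is possible on this side. The larger of the two trees becomes
          the right entry, and it is below \<open>foliage b\<close> in both cases.\<close>
        consider "foliage t < foliage a2" | "t = a2" | "foliage a2 < foliage t"
          using hall_inj t h by (meson linorder_less_linear)
        then show "commutator G u ?y \<in> ?R"
        proof cases
          case 1
          have "commutator G u ?y \<in> bracket_span e (hall_between r k (foliage t @ foliage a2) (foliage a2)) k"
            unfolding u by (rule IH) (use 1 h t tk a2b in auto)
          \<comment> \<open>After the common prefix \<open>foliage a1\<close> this rests on
            \<open>foliage a2 @ foliage b < foliage b @ foliage a2\<close>, which holds for Lyndon
            words in increasing order.\<close>
          moreover have "foliage a @ foliage b \<le> foliage t @ foliage a2"
          proof -
            have "foliage a2 @ foliage b < foliage b @ foliage a2"
              using lyndon_append_less[OF lyndon_foliage lyb a2b] list_less_append[of "foliage a2" "foliage b"] h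
              by (meson foliage_nonempty less_trans)
            then have "foliage a @ foliage b \<le> (foliage a1 @ foliage b) @ foliage a2"
              by (simp add: a less_imp_le)
            also have "\<dots> \<le> foliage t @ foliage a2"
              using t by (intro list_append_mono_length) auto
            finally show ?thesis .
          qed
          ultimately show ?thesis using Rmono a2b by (meson less_imp_le subsetD)
        next
          case 2
          then show ?thesis using u uc R.one_closed commutator_eq_one_iff[of u u] by simp
        next
          case 3
          have "commutator G ?y u \<in> bracket_span e (hall_between r k (foliage a2 @ foliage t) (foliage t)) k"
            unfolding u by (rule IH) (use 3 h t tk a2b in auto)
          moreover have "foliage a @ foliage b \<le> foliage a2 @ foliage t"
            by (rule less_imp_le, rule list_less_append_append_length[OF aa2]) (simp add: a)
          ultimately have "commutator G ?y u \<in> ?R" using Rmono t by (meson less_imp_le subsetD)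
          then show ?thesis using commutator_mem_commute[OF Rsub c(2) uc] by simp
        qed
      qed (use pos lc(2) in simp_all)
      then show ?thesis using commutator_mem_commute[OF Rsub] c by simp
    qed
    have xyz: "commutator G ?x (commutator G ?y ?z) \<in> ?R"
    proof -
      have "commutator G (commutator G ?y ?z) ?x \<in> ?R"
      proof (rule commutator_mem_generate[OF Rsub _ _ _ _ _ yz[unfolded bracket_span_def]])
        have "?l a2 + ?l b + ?l a1 = k" by (simp add: k)
        then show "lower_central G (Suc (?l a2 + ?l b + ?l a1)) \<subseteq> ?R" using Rlc by simp
        show "?v ` hall_between r (?l a2 + ?l b) (foliage a2 @ foliage b) (foliage b) \<subseteq> lower_central G (?l a2 + ?l b)"
          by (rule bracket_value_hall_between[OF e])
      next
        fix u assume "u \<in> ?v ` hall_between r (?l a2 + ?l b) (foliage a2 @ foliage b) (foliage b)"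
        then obtain t where u: "u = ?v t" and t': "t \<in> hall_between r (?l a2 + ?l b) (foliage a2 @ foliage b) (foliage b)" by (rule imageE)
        then have t: "hall t" "?l t = ?l a2 + ?l b" "set (foliage t) \<subseteq> {..<r}"
          "foliage a2 @ foliage b \<le> foliage t" "foliage t < foliage b"
          by (simp_all add: hall_between_def hall_trees_def)
        have tk: "?l a1 + ?l t = k" using t k by auto
        have uc: "u \<in> carrier G" using u bracket_value_closed[OF e t(3)] by simp
        \<comment> \<open>No case distinction on this side: \<open>foliage a1 < foliage a2\<close>,
          and \<open>foliage t\<close> is at least \<open>foliage a2 @ foliage b\<close>.\<close>
        have a1t: "foliage a1 < foliage t"
          using h(3) list_less_append[of "foliage b" "foliage a2"] t(4)
          by (meson foliage_nonempty less_le_trans less_trans)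
        have "commutator G ?x u \<in> bracket_span e (hall_between r k (foliage a1 @ foliage t) (foliage t)) k"
          unfolding u by (rule IH) (use h t tk a1t in auto)
        moreover have "foliage a @ foliage b \<le> foliage a1 @ foliage t" using t(4) by (simp add: a)
        ultimately have "commutator G ?x u \<in> ?R" using Rmono t by (meson less_imp_le subsetD)
        then show "commutator G u ?x \<in> ?R" using commutator_mem_commute[OF Rsub c(1) uc] by simp
      qed (use pos lc(1) in simp_all)
      then show ?thesis using commutator_mem_commute[OF Rsub] c by simp
    qed
    have "commutator G ?z (commutator G ?x ?y) \<in> ?R"
      by (rule Jacobi_mem[OF Rsub _ pos(3,2,1) lc(3,2,1) yzx xyz]) (use Rlc in \<open>simp add: k ac_simps\<close>)
    then have "commutator G (commutator G ?x ?y) ?z \<in> ?R"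
      using commutator_mem_commute[OF Rsub] c by simp
    then show ?thesis unfolding k_def by (simp add: a)
  qed
qed

text \<open>By bilinearity in both entries, commutators of \<open>lower_central G n\<close> with
  \<open>G\<close> reduce to those of a Hall tree of weight \<open>n\<close> with a single letter.
  These are collected as above, with the entries swapped if the letter is the smaller one.\<close>

lemma generate_hall_trees:
  assumes e: "e ` {..<r} \<subseteq> carrier G" and gen: "generate G (e ` {..<r}) = carrier G" and n: "1 \<le> n"
  shows "lower_central G n = bracket_span e (hall_trees r n) n"
proof (rule equalityI[rotated])
  show "bracket_span e (hall_trees r n) n \<subseteq> lower_central G n"
    by (rule bracket_span_subset[OF e]) simp
  let ?v = "bracket_value G e"
  have base: "carrier G \<subseteq> bracket_span e (hall_trees r 1) 1"
  proof -
    have "e i \<in> bracket_span e (hall_trees r 1) 1" if "i < r" for i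
      using bracket_value_in_span[of "Leaf i" "hall_trees r 1" e 1] that by (simp add: hall_trees_def)
    then have "generate G (e ` {..<r}) \<subseteq> bracket_span e (hall_trees r 1) 1"
      by (intro generate_subgroup_incl bracket_span_subgroup[OF e]) auto
    then show ?thesis using gen by simp
  qed
  have sub: "?v ` hall_trees r k \<subseteq> lower_central G k" for k
    by (rule bracket_value_hall_trees[OF e])
  show "lower_central G n \<subseteq> bracket_span e (hall_trees r n) n"
    using n
  proof (induction n rule: nat_induct_at_least)
    case base
    then show ?case using \<open>carrier G \<subseteq> _\<close> by simp
  next
    case (Suc n)
    then obtain m where m: "n = Suc m" by (cases n) auto
    let ?R = "bracket_span e (hall_trees r (Suc n)) (Suc n)"
    have R: "subgroup ?R G" by (rule bracket_span_subgroup[OF e]) simp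
    have Rlc: "lower_central G (Suc (Suc n)) \<subseteq> ?R" by (rule lower_central_subset_bracket_span)
    have trees: "commutator G (?v s) (?v t) \<in> ?R" if s: "s \<in> hall_trees r n" and t: "t \<in> hall_trees r 1" for s t
    proof -
      have st: "hall s" "length (foliage s) = n" "set (foliage s) \<subseteq> {..<r}"
        "hall t" "length (foliage t) = 1" "set (foliage t) \<subseteq> {..<r}"
        using s t unfolding hall_trees_def by auto
      have c: "?v s \<in> carrier G" "?v t \<in> carrier G" using bracket_value_closed[OF e] st by auto
      have between: "bracket_span e (hall_between r (Suc n) lo hi) (Suc n) \<subseteq> ?R" for lo hi
        by (rule bracket_span_mono) (auto simp: hall_between_def)
      consider "foliage s < foliage t" | "s = t" | "foliage t < foliage s"
        using hall_inj st by (meson linorder_less_linear)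
      then show ?thesis
      proof cases
        case 1
        have "commutator G (?v s) (?v t) \<in> bracket_span e (hall_between r (Suc n) (foliage s @ foliage t) (foliage t)) (Suc n)"
          using commutator_bracket_value[OF e st(1,4) 1 st(3,6), unfolded st(2,5)] by simp
        then show ?thesis using between by blast
      next
        case 2
        then show ?thesis using c subgroup.one_closed[OF R] by simp
      next
        case 3
        have "commutator G (?v t) (?v s) \<in> bracket_span e (hall_between r (Suc n) (foliage t @ foliage s) (foliage s)) (Suc n)"
          using commutator_bracket_value[OF e st(4,1) 3 st(6,3), unfolded st(2,5)] by simp
        then have "commutator G (?v t) (?v s) \<in> ?R" using between by blast
        then show ?thesis using commutator_mem_commute[OF R c] by simp
      qed
    qed
    have gens: "commutator G x y \<in> ?R" if x: "x \<in> lower_central G n" and y: "y \<in> carrier G" for x y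
    proof (rule commutator_mem_generate[OF R])
      show "lower_central G (Suc (n + 1)) \<subseteq> ?R" using Rlc by simp
      show "?v ` hall_trees r n \<subseteq> lower_central G n" by (rule sub)
      show "x \<in> generate G (?v ` hall_trees r n \<union> lower_central G (Suc n))"
        using Suc.IH x unfolding bracket_span_def by blast
      show "y \<in> lower_central G 1" using y by simp
      fix u assume "u \<in> ?v ` hall_trees r n"
      then obtain s where s: "u = ?v s" "s \<in> hall_trees r n" by (rule imageE)
      have u: "u \<in> lower_central G n" "u \<in> carrier G" using s sub lower_central_closed by auto
      have "commutator G y u \<in> ?R"
      proof (rule commutator_mem_generate[OF R])
        show "lower_central G (Suc (1 + n)) \<subseteq> ?R" using Rlc by simp
        show "?v ` hall_trees r 1 \<subseteq> lower_central G 1" by (rule sub)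
        show "y \<in> generate G (?v ` hall_trees r 1 \<union> lower_central G (Suc 1))"
          using base y unfolding bracket_span_def by blast
        show "u \<in> lower_central G n" by (rule u)
        show "commutator G w u \<in> ?R" if "w \<in> ?v ` hall_trees r 1" for w
        proof -
          from that obtain t where t: "w = ?v t" "t \<in> hall_trees r 1" by (rule imageE)
          then have "w \<in> carrier G" using sub[of 1] by auto
          then show ?thesis using trees[OF s(2) t(2)] s t u commutator_mem_commute[OF R] by simp
        qed
      qed (use Suc.hyps in auto)
      then show "commutator G u y \<in> ?R" using commutator_mem_commute[OF R u(2) y] by simp
    qed (use Suc.hyps in auto)
    show ?case unfolding m lower_central_Suc_Suc
    proof (rule generate_subgroup_incl)
      show "{commutator G x y |x y. x \<in> lower_central G (Suc m) \<and> y \<in> carrier G}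
        \<subseteq> bracket_span e (hall_trees r (Suc (Suc m))) (Suc (Suc m))"
        using gens unfolding m by blast
    qed (use R m in simp)
  qed
qed

text \<open>Conjugation changes elements of the smaller subgroup only modulo the next term, which it
  contains; so all powers of \<open>c\<close> can be moved to the front.\<close>

lemma generate_insert_mod_lower_central:
  assumes cU: "insert c U \<subseteq> lower_central G n"
    and z: "z \<in> generate G (insert c U \<union> lower_central G (Suc n))"
  obtains k :: int and z' where "z = c [^] k \<otimes> z'" "z' \<in> generate G (U \<union> lower_central G (Suc n))"
proof -
  let ?S = "generate G (U \<union> lower_central G (Suc n))"
  have Uc: "U \<union> lower_central G (Suc n) \<subseteq> carrier G"
    using cU lower_central_subset by blast
  have S: "subgroup ?S G" using Uc by (rule generate_is_subgroup)
  interpret S: subgroup ?S G by (rule S)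
  have Slc: "lower_central G (Suc n) \<subseteq> ?S" by (auto intro: generate.incl)
  have Sn: "?S \<subseteq> lower_central G n"
    using cU lower_central_Suc_subset by (intro generate_subgroup_incl subgroup_lower_central) auto
  have c: "c \<in> carrier G" using cU lower_central_closed by blast
  let ?T = "{c [^] k \<otimes> z' | (k::int) z'. z' \<in> ?S}"
  have conj: "g \<otimes> s \<otimes> inv g \<in> ?S" if "g \<in> carrier G" "s \<in> ?S" for g s
    using conj_mem_mod_lower_central[OF S Slc, of s g] Sn that by blast
  have "subgroup ?T G"
  proof
    show "?T \<subseteq> carrier G" using c S.subset by auto
    show "\<one> \<in> ?T"
      using S.one_closed by (intro CollectI exI[of _ 0] exI[of _ \<one>]) simp
  next
    fix x y assume "x \<in> ?T" "y \<in> ?T"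
    then obtain k l :: int and s t where x: "x = c [^] k \<otimes> s" "s \<in> ?S" and y: "y = c [^] l \<otimes> t" "t \<in> ?S" by blast
    have st: "s \<in> carrier G" "t \<in> carrier G" using x y S.subset by auto
    have "x \<otimes> y = c [^] (k + l) \<otimes> ((c [^] (-l) \<otimes> s \<otimes> inv (c [^] (-l))) \<otimes> t)"
      using st c by (simp add: x y int_pow_mult int_pow_neg group_word_simps)
    then show "x \<otimes> y \<in> ?T" using conj[of "c [^] (-l)" s] c x y by blast
  next
    fix x assume "x \<in> ?T"
    then obtain k :: int and s where x: "x = c [^] k \<otimes> s" "s \<in> ?S" by blast
    have s: "s \<in> carrier G" using x S.subset by auto
    have "inv x = c [^] (-k) \<otimes> (c [^] k \<otimes> inv s \<otimes> inv (c [^] k))"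
      using s c by (simp add: x int_pow_neg group_word_simps)
    then show "inv x \<in> ?T" using conj[of "c [^] k" "inv s"] c x by blast
  qed
  moreover have "insert c U \<union> lower_central G (Suc n) \<subseteq> ?T"
  proof -
    have "c \<in> ?T" using c S.one_closed by (intro CollectI exI[of _ 1] exI[of _ \<one>]) simp
    moreover have "s \<in> ?T" if "s \<in> ?S" for s
      using that S.subset by (intro CollectI exI[of _ 0] exI[of _ s]) auto
    ultimately show ?thesis by (auto intro: generate.incl)
  qed
  ultimately have "z \<in> ?T" using z generate_subgroup_incl by blast
  then show thesis using that by blast
qed

end

section \<open>Magnus expansions and the lower central series\<close>

lemma deg_ge_magnus_inverse:
  assumes "coeff a [] = 1" "deg_ge n (a - 1)"
  shows "deg_ge n (inv\<^bsub>magnus_group\<^esub> a - 1)"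
proof -
  interpret U: group magnus_group by (rule group_magnus_group)
  let ?b = "inv\<^bsub>magnus_group\<^esub> a"
  have "a * ?b = 1" using U.r_inv[of a] assms by simp
  then have "?b - 1 = - ((a - 1) * ?b)" by (simp add: algebra_simps)
  then show ?thesis using deg_ge_minus[OF deg_ge_times_left[OF assms(2)]] by metis
qed

text \<open>\<open>[1 + \<alpha>, 1 + \<beta>] - 1 = (\<alpha>\<beta> - \<beta>\<alpha>) (ba)\<^sup>-\<^sup>1\<close> with \<open>a = 1 + \<alpha>\<close> and \<open>b = 1 + \<beta>\<close>.\<close>

lemma magnus_commutator:
  assumes a: "coeff a [] = 1" "deg_ge m (a - 1)" and b: "coeff b [] = 1" "deg_ge n (b - 1)"
  shows "deg_ge (m + n) (commutator magnus_group a b - 1)"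
    and "deg_ge (Suc (m + n)) (commutator magnus_group a b - 1 - ((a - 1) * (b - 1) - (b - 1) * (a - 1)))"
proof -
  interpret U: group magnus_group by (rule group_magnus_group)
  define c where "c = inv\<^bsub>magnus_group\<^esub> a * inv\<^bsub>magnus_group\<^esub> b"
  have ia: "a * inv\<^bsub>magnus_group\<^esub> a = 1" and ib: "b * inv\<^bsub>magnus_group\<^esub> b = 1"
    using U.r_inv[of a] U.r_inv[of b] a b by auto
  have "inv\<^bsub>magnus_group\<^esub> a \<in> carrier magnus_group" "inv\<^bsub>magnus_group\<^esub> b \<in> carrier magnus_group"
    using a b by (intro U.inv_closed; simp)+
  then have c0: "coeff c [] = 1" by (simp add: c_def)
  have bac: "b * a * c = 1"
  proof -
    have "b * a * c = b * (a * inv\<^bsub>magnus_group\<^esub> a) * inv\<^bsub>magnus_group\<^esub> b"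
      by (simp only: c_def mult.assoc)
    then show ?thesis by (simp add: ia ib)
  qed
  let ?d = "(a - 1) * (b - 1) - (b - 1) * (a - 1)"
  have comm: "commutator magnus_group a b = a * b * c"
    by (simp add: commutator_def c_def mult.assoc)
  have d: "commutator magnus_group a b - 1 = ?d * c"
  proof -
    have "?d * c = (a * b - b * a) * c" by (simp add: algebra_simps)
    also have "\<dots> = a * b * c - b * a * c" by (simp add: left_diff_distrib)
    finally show ?thesis by (simp add: comm bac)
  qed
  have deg: "deg_ge (m + n) ?d"
    using deg_ge_times[OF a(2) b(2)] deg_ge_times[OF b(2) a(2)] by (intro deg_ge_diff) (auto simp: add.commute)
  show "deg_ge (m + n) (commutator magnus_group a b - 1)"
    unfolding d by (rule deg_ge_times_left[OF deg])
  have "deg_ge (m + n + 1) (?d * (c - 1))"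
    by (rule deg_ge_times[OF deg]) (use c0 in \<open>simp add: deg_ge_1_iff\<close>)
  moreover have "commutator magnus_group a b - 1 - ?d = ?d * (c - 1)"
    unfolding d by (simp add: right_diff_distrib)
  ultimately show "deg_ge (Suc (m + n)) (commutator magnus_group a b - 1 - ?d)" by simp
qed

definition dimension_subgroup :: "nat \<Rightarrow> ncps set" where
  "dimension_subgroup n = {a. coeff a [] = 1 \<and> deg_ge n (a - 1)}"

lemma subgroup_dimension_subgroup: "subgroup (dimension_subgroup n) magnus_group"
proof
  show "dimension_subgroup n \<subseteq> carrier magnus_group" by (auto simp: dimension_subgroup_def)
  show "\<one>\<^bsub>magnus_group\<^esub> \<in> dimension_subgroup n" by (simp add: dimension_subgroup_def)
next
  fix a b assume ab: "a \<in> dimension_subgroup n" "b \<in> dimension_subgroup n"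
  have "a * b - 1 = (a - 1) * b + (b - 1)" by (simp add: algebra_simps)
  moreover have "deg_ge n ((a - 1) * b)" "deg_ge n (b - 1)"
    using ab by (auto simp: dimension_subgroup_def deg_ge_times_left)
  ultimately have "deg_ge n (a * b - 1)" by (metis deg_ge_add)
  then show "a \<otimes>\<^bsub>magnus_group\<^esub> b \<in> dimension_subgroup n"
    using ab by (auto simp: dimension_subgroup_def)
next
  interpret U: group magnus_group by (rule group_magnus_group)
  fix a assume "a \<in> dimension_subgroup n"
  then show "inv\<^bsub>magnus_group\<^esub> a \<in> dimension_subgroup n"
    using deg_ge_magnus_inverse[of a n] U.inv_closed[of a] by (auto simp: dimension_subgroup_def)
qed

text \<open>By \<open>magnus_commutator\<close>, taking the commutator with any element raises the
  degree by at least 1.\<close>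

lemma lower_central_magnus_group: "lower_central magnus_group n \<subseteq> dimension_subgroup n"
proof -
  interpret U: group magnus_group by (rule group_magnus_group)
  show ?thesis
  proof (induction n rule: induct_nat_012)
    case 0
    then show ?case by (auto simp: dimension_subgroup_def)
  next
    case 1
    then show ?case by (auto simp: dimension_subgroup_def deg_ge_1_iff)
  next
    case (ge2 n)
    show ?case unfolding U.lower_central_Suc_Suc
    proof (rule U.generate_subgroup_incl)
      show "{commutator magnus_group x y |x y. x \<in> lower_central magnus_group (Suc n) \<and> y \<in> carrier magnus_group}
          \<subseteq> dimension_subgroup (Suc (Suc n))"
      proof safe
        fix x y assume x: "x \<in> lower_central magnus_group (Suc n)" and y: "y \<in> carrier magnus_group"
        have "coeff x [] = 1" "deg_ge (Suc n) (x - 1)" using x ge2 by (auto simp: dimension_subgroup_def)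
        moreover have "coeff y [] = 1" "deg_ge 1 (y - 1)" using y by (auto simp: deg_ge_1_iff)
        ultimately have "deg_ge (Suc n + 1) (commutator magnus_group x y - 1)" by (intro magnus_commutator)
        moreover have "commutator magnus_group x y \<in> carrier magnus_group"
          using \<open>coeff x [] = 1\<close> y by (intro U.commutator_closed) auto
        ultimately show "commutator magnus_group x y \<in> dimension_subgroup (Suc (Suc n))"
          by (auto simp: dimension_subgroup_def)
      qed
    qed (rule subgroup_dimension_subgroup)
  qed
qed

text \<open>All that the Magnus-Witt theorem needs of a free group with basis \<open>e\<close>;
  reduced words do not occur in the argument. The instance is
  \<open>magnus_hom_free_group\<close>.\<close>

locale magnus_hom = group G for G :: "('a, 'm) monoid_scheme" (structure) +
  fixes r :: nat and e :: "nat \<Rightarrow> 'a" and \<mu> :: "'a \<Rightarrow> ncps"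
  assumes e: "e ` {..<r} \<subseteq> carrier G" and generate_e: "generate G (e ` {..<r}) = carrier G"
    and mu: "\<mu> \<in> hom G magnus_group" and mu_e: "\<And>i. i < r \<Longrightarrow> \<mu> (e i) = 1 + ncps_var i"
begin

lemma mu_lower_central: "z \<in> lower_central G n \<Longrightarrow> coeff (\<mu> z) [] = 1 \<and> deg_ge n (\<mu> z - 1)"
  using hom_lower_central[OF is_group group_magnus_group mu, of n] lower_central_magnus_group[of n]
  by (auto simp: dimension_subgroup_def)

lemma mu_closed: "z \<in> carrier G \<Longrightarrow> coeff (\<mu> z) [] = 1"
  using hom_in_carrier[OF mu] by simp

lemma mu_mult: "x \<in> carrier G \<Longrightarrow> y \<in> carrier G \<Longrightarrow> \<mu> (x \<otimes> y) = \<mu> x * \<mu> y"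
  using hom_mult[OF mu] by simp

lemma mu_one: "\<mu> \<one> = 1"
  using hom_one[OF mu is_group group_magnus_group] by simp

text \<open>Induction along the tree: by the commutator formula, only the lowest homogeneous parts
  of the two entries contribute in the lowest degree.\<close>

lemma mu_bracket:
  assumes "set (foliage t) \<subseteq> {..<r}"
  shows "deg_ge (Suc (length (foliage t))) (\<mu> (bracket_value G e t) - 1 - lie_poly t)"
  using assms
proof (induction t)
  case (Leaf i)
  then show ?case by (simp add: mu_e)
next
  case (Node a b)
  let ?x = "bracket_value G e a" and ?y = "bracket_value G e b"
  let ?m = "length (foliage a)" and ?n = "length (foliage b)"
  have xc: "?x \<in> lower_central G ?m" and yc: "?y \<in> lower_central G ?n"
    using Node.prems bracket_value_lower_central[OF e] by auto
  define \<alpha> \<beta> p q where "\<alpha> = \<mu> ?x - 1" "\<beta> = \<mu> ?y - 1" "p = lie_poly a" "q = lie_poly b"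
  have deg: "deg_ge ?m \<alpha>" "deg_ge ?n \<beta>" using mu_lower_central xc yc by (auto simp: \<alpha>_\<beta>_p_q_def)
  have ap: "deg_ge (Suc ?m) (\<alpha> - p)" and bq: "deg_ge (Suc ?n) (\<beta> - q)"
    using Node by (auto simp: \<alpha>_\<beta>_p_q_def)
  have pq: "deg_ge ?m p" "deg_ge ?n q" by (auto simp: \<alpha>_\<beta>_p_q_def deg_ge_lie_poly)
  have diff: "\<alpha> * \<beta> - \<beta> * \<alpha> - (p * q - q * p) =
     (\<alpha> - p) * \<beta> + p * (\<beta> - q) - ((\<beta> - q) * \<alpha> + q * (\<alpha> - p))" by (simp add: algebra_simps)
  have "deg_ge (Suc (?m + ?n)) (\<alpha> * \<beta> - \<beta> * \<alpha> - (p * q - q * p))"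
    unfolding diff
    using deg_ge_times[OF ap deg(2)] deg_ge_times[OF pq(1) bq] deg_ge_times[OF bq deg(1)] deg_ge_times[OF pq(2) ap]
    by (intro deg_ge_diff deg_ge_add) (simp_all add: add.commute)
  moreover have "deg_ge (Suc (?m + ?n)) (commutator magnus_group (\<mu> ?x) (\<mu> ?y) - 1 - (\<alpha> * \<beta> - \<beta> * \<alpha>))"
    using magnus_commutator(2)[of "\<mu> ?x" ?m "\<mu> ?y" ?n] mu_lower_central[OF xc] mu_lower_central[OF yc]
    by (simp add: \<alpha>_\<beta>_p_q_def)
  ultimately have "deg_ge (Suc (?m + ?n)) (commutator magnus_group (\<mu> ?x) (\<mu> ?y) - 1 - (\<alpha> * \<beta> - \<beta> * \<alpha>)
      + (\<alpha> * \<beta> - \<beta> * \<alpha> - (p * q - q * p)))" by (intro deg_ge_add)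
  moreover have "\<mu> (bracket_value G e (Node a b)) = commutator magnus_group (\<mu> ?x) (\<mu> ?y)"
    using hom_commutator[OF is_group group_magnus_group mu] xc yc lower_central_closed by simp
  moreover have "c - 1 - d + (d - f) = c - 1 - f" for c d f :: ncps by simp
  ultimately show ?case by (simp add: \<alpha>_\<beta>_p_q_def(3,4))
qed

text \<open>The deviation from additivity is \<open>(\<mu> x - 1) * (\<mu> y - 1)\<close>, whose
  degree is at least \<open>n + n\<close> and so exceeds \<open>n\<close>.\<close>

lemma coeff_mu_mult:
  assumes "x \<in> lower_central G n" "y \<in> lower_central G n" "1 \<le> n" "length w = n"
  shows "coeff (\<mu> (x \<otimes> y)) w = coeff (\<mu> x) w + coeff (\<mu> y) w"
proof -
  have xy: "x \<in> carrier G" "y \<in> carrier G" using assms lower_central_closed by auto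
  have "deg_ge (n + n) ((\<mu> x - 1) * (\<mu> y - 1))"
    using assms mu_lower_central by (intro deg_ge_times) auto
  then have "coeff ((\<mu> x - 1) * (\<mu> y - 1)) w = 0" using assms by (auto simp: deg_ge_def)
  moreover have "\<mu> (x \<otimes> y) = (\<mu> x - 1) * (\<mu> y - 1) + \<mu> x + \<mu> y - 1"
    using xy by (simp add: mu_mult algebra_simps)
  ultimately show ?thesis using assms by auto
qed

lemma coeff_mu_inv:
  assumes "x \<in> lower_central G n" "1 \<le> n" "length w = n"
  shows "coeff (\<mu> (inv x)) w = - coeff (\<mu> x) w"
proof -
  have "inv x \<in> lower_central G n" using assms subgroup.m_inv_closed[OF subgroup_lower_central] by blast
  from coeff_mu_mult[OF assms(1) this assms(2,3)]
  show ?thesis using assms lower_central_closed[OF assms(1)] by (auto simp: mu_one split: if_splits)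
qed

lemma lower_central_nat_pow: "x \<in> lower_central G n \<Longrightarrow> x [^] (k::nat) \<in> lower_central G n"
  using subgroup.m_closed[OF subgroup_lower_central] subgroup.one_closed[OF subgroup_lower_central]
  by (induction k) auto

lemma coeff_mu_nat_pow:
  assumes "x \<in> lower_central G n" "1 \<le> n" "length w = n"
  shows "coeff (\<mu> (x [^] (k::nat))) w = int k * coeff (\<mu> x) w"
proof (induction k)
  case 0
  then show ?case using assms by (auto simp: mu_one)
next
  case (Suc k)
  then show ?case
    using coeff_mu_mult[OF lower_central_nat_pow assms(1) assms(2,3)] assms by (simp add: algebra_simps)
qed

lemma coeff_mu_int_pow:
  assumes "x \<in> lower_central G n" "1 \<le> n" "length w = n"
  shows "coeff (\<mu> (x [^] (k::int))) w = k * coeff (\<mu> x) w"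
proof (cases k)
  case (nonneg l)
  then show ?thesis using coeff_mu_nat_pow[OF assms] by (simp add: int_pow_int)
next
  case (neg l)
  have xk: "x [^] k = inv (x [^] Suc l)"
    using lower_central_closed[OF assms(1)] unfolding neg by (metis int_pow_neg int_pow_int)
  have "coeff (\<mu> (x [^] k)) w = - (int (Suc l) * coeff (\<mu> x) w)"
    unfolding xk coeff_mu_inv[OF lower_central_nat_pow[OF assms(1)] assms(2,3)] coeff_mu_nat_pow[OF assms] ..
  also have "\<dots> = k * coeff (\<mu> x) w" unfolding neg by (simp add: algebra_simps)
  finally show ?thesis .
qed

text \<open>Triangularity. Let \<open>t\<close> be the tree in \<open>V\<close> with least foliage
  \<open>w\<close>. The Lie polynomials of the other trees have no term at \<open>w\<close>, so the
  coefficient at \<open>w\<close> reads off the exponent \<open>j\<close> of \<open>t\<close> in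
  \<open>z\<close>. It is 0, and \<open>t\<close> can be removed from \<open>V\<close>.\<close>

lemma lower_central_Suc_if_deg_ge:
  assumes "finite V" "V \<subseteq> hall_trees r n" "1 \<le> n" "z \<in> bracket_span e V n" "deg_ge (Suc n) (\<mu> z - 1)"
  shows "z \<in> lower_central G (Suc n)"
  using assms(1,2,4,5)
proof (induction "card V" arbitrary: V z)
  case 0
  then have "generate G (lower_central G (Suc n)) = lower_central G (Suc n)"
    by (intro generateI[symmetric] subgroup_lower_central) auto
  then show ?case using 0 by (simp add: bracket_span_def)
next
  case (Suc k)
  define w where "w = Min (foliage ` V)"
  have "V \<noteq> {}" using Suc.hyps(2) by auto
  then have "w \<in> foliage ` V" unfolding w_def using Suc.prems by (intro Min_in) auto
  then obtain t where t: "t \<in> V" "foliage t = w" by blast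
  have min: "w < foliage s" if "s \<in> V - {t}" for s
  proof -
    have "w \<le> foliage s" unfolding w_def using that Suc.prems by (intro Min_le) auto
    moreover have "hall s" "hall t" using that t Suc.prems by (auto simp: hall_trees_def)
    then have "w \<noteq> foliage s" using hall_inj[of s t] t that by auto
    ultimately show ?thesis by simp
  qed
  have tr: "hall t" "length w = n" "set (foliage t) \<subseteq> {..<r}" using t Suc.prems by (auto simp: hall_trees_def)
  have wne: "w \<noteq> []" using tr \<open>1 \<le> n\<close> by auto
  let ?v = "bracket_value G e"
  have V: "insert t (V - {t}) = V" using t by blast
  have "z \<in> generate G (insert (?v t) (?v ` (V - {t})) \<union> lower_central G (Suc n))"
    using Suc.prems(3) unfolding bracket_span_def by (metis V image_insert)
  moreover have "insert (?v t) (?v ` (V - {t})) \<subseteq> lower_central G n"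
  proof -
    have "insert (?v t) (?v ` (V - {t})) = ?v ` V" by (metis V image_insert)
    then show ?thesis using bracket_value_hall_trees[OF e, of n] Suc.prems by blast
  qed
  ultimately obtain j :: int and z' where z: "z = ?v t [^] j \<otimes> z'" and z': "z' \<in> bracket_span e (V - {t}) n"
    unfolding bracket_span_def using generate_insert_mod_lower_central by blast
  have W: "V - {t} \<subseteq> hall_trees r n" using Suc.prems by blast
  have vt: "?v t \<in> lower_central G n" using bracket_value_lower_central[OF e tr(3)] tr t by simp
  have z'n: "z' \<in> lower_central G n" using bracket_span_subset[OF e W] z' by blast
  have co: "coeff (\<mu> (?v s)) w = coeff (lie_poly s) w" if "s \<in> V" for s
  proof -
    have "set (foliage s) \<subseteq> {..<r}" "length (foliage s) = n" using that Suc.prems by (auto simp: hall_trees_def)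
    then have "coeff (\<mu> (?v s) - 1 - lie_poly s) w = 0"
      using mu_bracket[of s] tr by (auto simp: deg_ge_def)
    then show ?thesis using wne by simp
  qed
  have "coeff (\<mu> z') w = 0"
  proof -
    \<comment> \<open>The coefficient at \<open>w\<close> is additive on
      \<open>lower_central G n\<close>, so its vanishing need only be seen on generators.\<close>
    let ?K = "{y \<in> lower_central G n. coeff (\<mu> y) w = 0}"
    have "subgroup ?K G"
      using subgroup.m_closed[OF subgroup_lower_central] subgroup.one_closed[OF subgroup_lower_central]
        subgroup.m_inv_closed[OF subgroup_lower_central] \<open>1 \<le> n\<close> tr coeff_mu_mult coeff_mu_inv
      by (intro subgroup.intro) (auto simp: lower_central_closed mu_one)
    moreover have "?v ` (V - {t}) \<union> lower_central G (Suc n) \<subseteq> ?K"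
    proof (intro Un_least subsetI)
      fix y assume "y \<in> ?v ` (V - {t})"
      then obtain s where s: "y = ?v s" "s \<in> V - {t}" by (rule imageE)
      have "hall s" using s Suc.prems by (auto simp: hall_trees_def)
      then have "coeff (lie_poly s) w = 0" using lie_poly_leading(2) min[OF s(2)] by blast
      moreover have "y \<in> lower_central G n" using bracket_value_hall_trees[OF e, of n] W s by blast
      ultimately show "y \<in> ?K" using co s by simp
    next
      fix y assume y: "y \<in> lower_central G (Suc n)"
      then have "coeff (\<mu> y - 1) w = 0" using mu_lower_central tr by (auto simp: deg_ge_def)
      then show "y \<in> ?K" using y lower_central_Suc_subset wne by auto
    qed
    ultimately show ?thesis using z' generate_subgroup_incl unfolding bracket_span_def by blast
  qed
  moreover have "coeff (\<mu> z) w = 0"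
  proof -
    have "coeff (\<mu> z - 1) w = 0" using Suc.prems tr by (auto simp: deg_ge_def)
    then show ?thesis using wne by simp
  qed
  moreover have "?v t [^] j \<in> lower_central G n"
    using subgroup_int_pow_closed[OF subgroup_lower_central vt] by simp
  moreover have "coeff (\<mu> (?v t)) w = 1"
    using co[OF t(1)] lie_poly_leading(1)[OF tr(1)] t by simp
  ultimately have "j = 0"
    using coeff_mu_mult[of "?v t [^] j" n z' w] coeff_mu_int_pow[OF vt, of w j] z z'n tr \<open>1 \<le> n\<close> by simp
  then have "z = z'" using z lower_central_closed[OF z'n] by simp
  moreover have "card (V - {t}) = k" using Suc.hyps t Suc.prems by simp
  ultimately show ?case using Suc.hyps(1)[of "V - {t}" z] Suc.prems z' W by simp
qed

text \<open>An element of \<open>lower_central G n\<close> is a product of Hall brackets modulo the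
  next term, and all the exponents are visible in degree \<open>n\<close>.\<close>

theorem Magnus_Witt:
  assumes "z \<in> carrier G" "deg_ge n (\<mu> z - 1)"
  shows "z \<in> lower_central G n"
  using assms(2)
proof (induction n)
  case 0
  then show ?case using assms by simp
next
  case (Suc n)
  show ?case
  proof (cases "n = 0")
    case True
    then show ?thesis using assms by simp
  next
    case False
    have "z \<in> lower_central G n" using Suc deg_ge_mono by (meson le_SucI order_refl)
    then have "z \<in> bracket_span e (hall_trees r n) n"
      using generate_hall_trees[OF e generate_e, of n] False by simp
    then show ?thesis
      using lower_central_Suc_if_deg_ge[OF finite_hall_trees subset_refl, where z = z] Suc.prems False by simp
  qed
qed

text \<open>At the last term \<open>i\<close> of the series that contains \<open>z\<close>, passing
  to the power multiplies the coefficients of degree \<open>i\<close> by \<open>k\<close>, and the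
  integers have no torsion.\<close>

lemma lower_central_torsion_free:
  assumes "z \<in> carrier G" "z [^] (k::nat) \<in> lower_central G n" "0 < k"
  shows "z \<in> lower_central G n"
proof (rule ccontr)
  assume "z \<notin> lower_central G n"
  then obtain i where i: "z \<in> lower_central G i" "z \<notin> lower_central G (Suc i)" "Suc i \<le> n"
  proof -
    define j where "j = (LEAST j. z \<notin> lower_central G j)"
    have j: "z \<notin> lower_central G j" unfolding j_def by (rule LeastI) fact
    have jn: "j \<le> n" unfolding j_def by (rule Least_le) fact
    have "j \<noteq> 0" using j assms(1) by (cases j) auto
    then obtain i where ji: "j = Suc i" by (cases j) auto
    then have "z \<in> lower_central G i" using not_less_Least[of i "\<lambda>j. z \<notin> lower_central G j"] j_def by auto
    then show thesis using that j jn ji by blast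
  qed
  have "1 \<le> i" using i assms by (cases i) auto
  have "deg_ge (Suc i) (\<mu> z - 1)"
    unfolding deg_ge_def
  proof (intro allI impI)
    fix w :: "nat list" assume w: "length w < Suc i"
    show "coeff (\<mu> z - 1) w = 0"
    proof (cases "length w = i")
      case True
      have "deg_ge n (\<mu> (z [^] k) - 1)" using mu_lower_central assms(2) by blast
      then have "coeff (\<mu> (z [^] k)) w = 0" using True i \<open>1 \<le> i\<close> by (auto simp: deg_ge_def)
      then have "coeff (\<mu> z) w = 0"
        using coeff_mu_nat_pow[OF i(1) \<open>1 \<le> i\<close> True, of k] assms(3) by simp
      then show ?thesis using True \<open>1 \<le> i\<close> by auto
    next
      case False
      then show ?thesis using w mu_lower_central[OF i(1)] by (auto simp: deg_ge_def)
    qed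
  qed
  then show False using Magnus_Witt[OF assms(1)] i by blast
qed

end

section \<open>Finite groups of prime power order are nilpotent\<close>

text \<open>Orbit counting: orbits that are not singletons have size divisible by \<open>p\<close>,
  so a single fixed point would make the cardinality 1 modulo \<open>p\<close>.\<close>

lemma (in group_action) prime_dvd_card_invariant_subset:
  fixes p :: nat
  assumes p: "prime p" "Coset.order G = p ^ k" and E: "finite \<Omega>" "\<Omega> \<subseteq> E"
    and inv: "\<And>g x. g \<in> carrier G \<Longrightarrow> x \<in> \<Omega> \<Longrightarrow> \<phi> g x \<in> \<Omega>"
    and dvd: "p dvd card \<Omega>" and a: "a \<in> \<Omega>" "\<And>g. g \<in> carrier G \<Longrightarrow> \<phi> g a = a"
  obtains x where "x \<in> \<Omega>" "x \<noteq> a" "\<And>g. g \<in> carrier G \<Longrightarrow> \<phi> g x = x"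
proof (rule ccontr)
  assume neg: "\<not> thesis"
  note witness = that
  let ?o = "orbit G \<phi>"
  have sub: "?o x \<subseteq> \<Omega>" if "x \<in> \<Omega>" for x using inv that by (auto simp: orbit_def)
  have mem: "x \<in> ?o x" if "x \<in> \<Omega>" for x using orbit_refl that E by blast
  have "\<Union> (?o ` \<Omega>) = \<Omega>" using sub mem by blast
  moreover have "card (\<Union> (?o ` \<Omega>)) = (\<Sum>C\<in>?o ` \<Omega>. card C)"
  proof (rule card_Union_disjoint)
    show "pairwise disjnt (?o ` \<Omega>)"
    proof (rule pairwiseI)
      fix A B assume AB: "A \<in> ?o ` \<Omega>" "B \<in> ?o ` \<Omega>" "A \<noteq> B"
      then have "A \<in> orbits G E \<phi>" "B \<in> orbits G E \<phi>" using E by (auto simp: orbits_def)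
      then show "disjnt A B" using disjoint_union AB(3) by (auto simp: disjnt_def)
    qed
    show "finite A" if "A \<in> ?o ` \<Omega>" for A using that sub E finite_subset by blast
  qed
  ultimately have card: "card \<Omega> = (\<Sum>C\<in>?o ` \<Omega>. card C)" by simp
  have oa: "?o a = {a}" using a mem[of a] by (auto simp: orbit_def)
  have "p dvd card A" if A: "A \<in> ?o ` \<Omega> - {?o a}" for A
  proof -
    obtain x where x: "x \<in> \<Omega>" "A = ?o x" using A by blast
    have xa: "x \<noteq> a" using A x by auto
    have "card A dvd p ^ k"
      using orbit_stabilizer_theorem[of x] x E p by (metis dvd_triv_left subsetD)
    then obtain j where j: "card A = p ^ j" using divides_primepow_nat p by blast
    moreover have "j \<noteq> 0"
    proof
      assume "j = 0"
      then have "card A = 1" using j by simp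
      then obtain y where "A = {y}" by (rule card_1_singletonE)
      then have "A = {x}" using mem[OF x(1)] x(2) by auto
      then have "\<phi> g x = x" if "g \<in> carrier G" for g using that x by (auto simp: orbit_def)
      then show False using neg witness[OF x(1) xa] by blast
    qed
    ultimately show ?thesis by simp
  qed
  then have "p dvd (\<Sum>A\<in>?o ` \<Omega> - {?o a}. card A)" by (rule dvd_sum)
  moreover have "card \<Omega> = card (?o a) + (\<Sum>A\<in>?o ` \<Omega> - {?o a}. card A)"
    unfolding card using E a by (intro sum.remove) auto
  ultimately have "p dvd 1" using dvd oa by (metis card_1_singleton_iff dvd_add_left_iff One_nat_def)
  then show False using p by simp
qed

context group
begin

lemma coset_conj:
  assumes M: "M \<lhd> G" and x: "x \<in> carrier G" and g: "g \<in> carrier G"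
  shows "g <# (M #> x) #> inv g = M #> (g \<otimes> x \<otimes> inv g)"
proof -
  interpret M: normal M G by fact
  have "g <# (M #> x) #> inv g = (g <# M) #> x #> inv g"
    using M.subset x g by (simp add: coset_assoc r_coset_subset_G lcos_m_assoc)
  also have "\<dots> = (M #> g) #> x #> inv g" using M.coset_eq g by simp
  also have "\<dots> = M #> (g \<otimes> x \<otimes> inv g)"
    using M.subset x g by (simp add: coset_mult_assoc m_assoc)
  finally show ?thesis .
qed

lemma coset_conj_eq_imp:
  assumes M: "M \<lhd> G" and x: "x \<in> carrier G" and g: "g \<in> carrier G"
    and eq: "M #> (g \<otimes> x \<otimes> inv g) = M #> x"
  shows "commutator G g x \<in> M"
proof -
  interpret M: normal M G by fact
  have "g \<otimes> x \<otimes> inv g \<in> M #> x"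
    using eq rcos_self[OF _ M.subgroup_axioms, of "g \<otimes> x \<otimes> inv g"] x g by auto
  then obtain m where m: "m \<in> M" "g \<otimes> x \<otimes> inv g = m \<otimes> x" by (auto simp: r_coset_def)
  then have "commutator G g x = m"
    using x M.subset by (auto simp: commutator_def group_word_simps)
  then show ?thesis using m by simp
qed

text \<open>The series stabilises at some \<open>L\<close>. If \<open>L\<close> is not trivial, let
  \<open>M\<close> be maximal among the normal subgroups of \<open>G\<close> properly contained in
  \<open>L\<close>. Conjugation permutes the cosets of \<open>M\<close> in \<open>L\<close>, whose
  number is a positive power of \<open>p\<close>, so a coset other than \<open>M\<close> is fixed.
  Its elements are central modulo \<open>M\<close>; by maximality all of \<open>L\<close> is, so the
  next term lies in \<open>M\<close>, a contradiction.\<close>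

lemma prime_power_order_nilpotent:
  fixes p :: nat
  assumes p: "prime p" "Coset.order G = p ^ k" 
  shows "\<exists>c\<ge>1. lower_central G c = {\<one>}"
proof -
  have fin: "finite (carrier G)"
  proof (rule card_ge_0_finite)
    show "0 < card (carrier G)" using p prime_gt_0_nat[of p] by (simp add: Coset.order_def)
  qed
  have finl: "finite (lower_central G n)" for n
    using lower_central_subset fin finite_subset by blast
  obtain n where n: "1 \<le> n" "lower_central G (Suc n) = lower_central G n"
  proof -
    have "\<exists>n\<ge>1. lower_central G (Suc n) = lower_central G n"
    proof (rule ccontr)
      assume "\<not> ?thesis"
      then have less: "lower_central G (Suc n) \<subset> lower_central G n" if "1 \<le> n" for n
        using that lower_central_Suc_subset by blast
      have "card (lower_central G (Suc n)) + n \<le> card (carrier G)" for n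
      proof (induction n)
        case (Suc n)
        then show ?case using psubset_card_mono[OF finl less[of "Suc n"]] by simp
      qed simp
      from this[of "Suc (card (carrier G))"] show False by simp
    qed
    then show thesis using that by blast
  qed
  define L where "L = lower_central G n"
  have L: "L \<lhd> G" unfolding L_def by (rule lower_central_normal)
  interpret L: normal L G by (rule L)
  have "L = {\<one>}"
  proof (rule ccontr)
    assume "L \<noteq> {\<one>}"
    then have "{\<one>} \<subset> L" using L.one_closed by blast
    define \<M> where "\<M> = {M. M \<lhd> G \<and> M \<subset> L}"
    have "{\<one>} \<in> \<M>" using \<open>{\<one>} \<subset> L\<close> one_is_normal by (simp add: \<M>_def)
    then have "\<M> \<noteq> {}" by blast
    moreover have "finite \<M>"
      by (rule finite_subset[of _ "Pow L"]) (use finl in \<open>auto simp: L_def \<M>_def\<close>)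
    ultimately have "\<exists>M\<in>\<M>. \<forall>K\<in>\<M>. M \<subseteq> K \<longrightarrow> M = K" by (intro finite_has_maximal)
    then obtain M where "M \<in> \<M>" and maximal: "\<forall>K\<in>\<M>. M \<subseteq> K \<longrightarrow> M = K" by (rule bexE)
    then have M: "M \<lhd> G" "M \<subset> L" by (simp_all add: \<M>_def)
    have max: "M = K" if "K \<lhd> G" "K \<subset> L" "M \<subseteq> K" for K
      using maximal that by (simp add: \<M>_def)
    interpret M: normal M G by (rule M)
    interpret act: group_action G "{H. H \<subseteq> carrier G}" "\<lambda>g. \<lambda>H\<in>{H. H \<subseteq> carrier G}. g <# H #> inv g"
      by (rule action_by_conjugation_on_power_set)
    define \<Omega> where "\<Omega> = (\<lambda>x. M #> x) ` L"
    have \<Omega>: "\<Omega> \<subseteq> {H. H \<subseteq> carrier G}"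
      using M.subset L.subset by (auto simp: \<Omega>_def r_coset_def)
    have act: "(\<lambda>H\<in>{H. H \<subseteq> carrier G}. g <# H #> inv g) (M #> x) = M #> (g \<otimes> x \<otimes> inv g)"
      if "x \<in> L" "g \<in> carrier G" for x g
      using that L.subset coset_conj[OF M(1), of x g] r_coset_subset_G[OF M.subset, of x] by auto
    have "card \<Omega> * card M = card L"
    proof -
      interpret GL: group "G\<lparr>carrier := L\<rparr>" using L.subgroup_axioms by (rule subgroup_imp_group)
      have "subgroup M (G\<lparr>carrier := L\<rparr>)"
        using M.subgroup_axioms L.subgroup_axioms M(2) subgroup_incl by blast
      moreover have "rcosets\<^bsub>G\<lparr>carrier := L\<rparr>\<^esub> M = \<Omega>"
        unfolding \<Omega>_def RCOSETS_def r_coset_def by auto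
      ultimately show ?thesis using GL.lagrange[of M] by (simp add: Coset.order_def)
    qed
    moreover have "card L dvd p ^ k"
      using lagrange[OF L.subgroup_axioms] p by (metis dvd_triv_right)
    ultimately have "card \<Omega> dvd p ^ k" by (metis dvd_trans dvd_triv_left)
    then obtain j where j: "card \<Omega> = p ^ j" using divides_primepow_nat p by blast
    have "j \<noteq> 0"
    proof
      assume "j = 0"
      then have "card M = card L" using \<open>card \<Omega> * card M = card L\<close> j by simp
      then show False using psubset_card_mono[of L M] M(2) finl by (simp add: L_def)
    qed
    then have "p dvd card \<Omega>" using j by simp
    moreover have "finite \<Omega>" using finl by (simp add: \<Omega>_def L_def)
    moreover have "M \<in> \<Omega>" using L.one_closed coset_mult_one[OF M.subset] unfolding \<Omega>_def by (metis imageI)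
    moreover have "(\<lambda>H\<in>{H. H \<subseteq> carrier G}. g <# H #> inv g) X \<in> \<Omega>" if "g \<in> carrier G" "X \<in> \<Omega>" for g X
    proof -
      from that(2) obtain x where x: "X = M #> x" "x \<in> L" unfolding \<Omega>_def by (rule imageE)
      show ?thesis unfolding x(1) act[OF x(2) that(1)] \<Omega>_def
        using L.inv_op_closed2 that(1) x(2) by (intro imageI)
    qed
    moreover have "(\<lambda>H\<in>{H. H \<subseteq> carrier G}. g <# H #> inv g) M = M" if "g \<in> carrier G" for g
      using act[OF L.one_closed that] that coset_mult_one[OF M.subset] by simp
    ultimately obtain X where X: "X \<in> \<Omega>" "X \<noteq> M"
      and fixed: "\<And>g. g \<in> carrier G \<Longrightarrow> (\<lambda>H\<in>{H. H \<subseteq> carrier G}. g <# H #> inv g) X = X"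
      using act.prime_dvd_card_invariant_subset[OF p _ \<Omega>, of M] by blast
    then obtain x where x: "x \<in> L" "X = M #> x" unfolding \<Omega>_def by blast
    have xc: "x \<in> carrier G" using x L.subset by blast
    have xM: "x \<notin> M" using x X(2) M.rcos_const[OF is_group] by blast
    define K where "K = {x \<in> L. \<forall>g\<in>carrier G. commutator G g x \<in> M}"
    have Mconj: "g \<otimes> m \<otimes> inv g \<in> M" if "g \<in> carrier G" "m \<in> M" for g m
      using M.inv_op_closed2 that by blast
    have K: "K \<lhd> G"
    proof (rule normal_invI)
      show "subgroup K G"
      proof
        show "K \<subseteq> carrier G" using L.subset by (auto simp: K_def)
        show "\<one> \<in> K" by (simp add: K_def commutator_def)
      next
        fix a b assume "a \<in> K" "b \<in> K"
        then show "a \<otimes> b \<in> K" using Mconj L.subset by (auto simp: K_def commutator_mult_right)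
      next
        fix a assume a: "a \<in> K"
        then have ac: "a \<in> carrier G" using L.subset by (auto simp: K_def)
        have "inv a \<otimes> inv (commutator G g a) \<otimes> a \<in> M" if "g \<in> carrier G" for g
          using Mconj[of "inv a" "inv (commutator G g a)"] a ac that by (simp add: K_def)
        then show "inv a \<in> K" using a ac by (simp add: K_def commutator_inv_right)
      qed
    next
      fix a h assume a: "a \<in> K" and h: "h \<in> carrier G"
      then have ac: "a \<in> carrier G" using L.subset by (auto simp: K_def)
      have "commutator G g (h \<otimes> a \<otimes> inv h) \<in> M" if g: "g \<in> carrier G" for g
      proof -
        have "commutator G g (h \<otimes> a \<otimes> inv h) = h \<otimes> commutator G (inv h \<otimes> g \<otimes> h) a \<otimes> inv h"
          using ac h g by (simp add: commutator_def group_word_simps)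
        then show ?thesis using Mconj a h g by (simp add: K_def)
      qed
      then show "h \<otimes> a \<otimes> inv h \<in> K" using a h L.inv_op_closed2 by (simp add: K_def)
    qed
    have MK: "M \<subseteq> K"
    proof
      fix m assume m: "m \<in> M"
      have "commutator G g m \<in> M" if "g \<in> carrier G" for g
        using Mconj[OF that m] m by (simp add: commutator_def)
      then show "m \<in> K" using m M(2) by (auto simp: K_def)
    qed
    have "commutator G g x \<in> M" if g: "g \<in> carrier G" for g
      using fixed[OF g] act[OF x(1) g] x coset_conj_eq_imp[OF M(1) xc g] by simp
    then have "x \<in> K" using x by (simp add: K_def)
    then have "K = L" using max[OF K _ MK] xM by (auto simp: K_def)
    have "lower_central G (Suc n) \<subseteq> M"
    proof -
      obtain m where m: "n = Suc m" using n(1) by (cases n) auto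
      have "commutator G a b \<in> M" if "a \<in> lower_central G n" "b \<in> carrier G" for a b
      proof -
        have "commutator G b a \<in> M" using that \<open>K = L\<close> by (auto simp: K_def L_def)
        moreover have "a \<in> carrier G" using that(1) by (rule lower_central_closed)
        ultimately show ?thesis using commutator_mem_commute[OF M.subgroup_axioms] that(2) by blast
      qed
      then show ?thesis unfolding m lower_central_Suc_Suc
        by (intro generate_subgroup_incl M.subgroup_axioms) auto
    qed
    then show False using n M(2) by (auto simp: L_def)
  qed
  then show ?thesis using n by (auto simp: L_def)
qed

end

section \<open>Finite quotients of prime power order\<close>

lemma hom_lower_central_surj:
  assumes "group G" "group H" "h \<in> hom G H" "h ` carrier G = carrier H"
  shows "lower_central H n \<subseteq> h ` lower_central G n"
proof -
  interpret group_hom G H h using assms by (simp add: group_hom_def group_hom_axioms_def)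
  show ?thesis
  proof (induction n rule: induct_nat_012)
    case (ge2 n)
    show ?case unfolding H.lower_central_Suc_Suc
    proof (rule H.generate_subgroup_incl)
      show "subgroup (h ` lower_central G (Suc (Suc n))) H"
        using G.subgroup_lower_central by (rule subgroup_img_is_subgroup)
      show "{commutator H x y |x y. x \<in> lower_central H (Suc n) \<and> y \<in> carrier H} \<subseteq> h ` lower_central G (Suc (Suc n))"
      proof safe
        fix x y assume "x \<in> lower_central H (Suc n)" "y \<in> carrier H"
        then obtain x' y' where xy: "x = h x'" "x' \<in> lower_central G (Suc n)" "y = h y'" "y' \<in> carrier G"
          using ge2(2) assms(4) by blast
        then have "commutator H x y = h (commutator G x' y')"
          using hom_commutator[OF assms(1-3)] G.lower_central_closed by simp
        then show "commutator H x y \<in> h ` lower_central G (Suc (Suc n))"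
          using G.commutator_lower_central_Suc xy by blast
      qed
    qed
  qed (use assms in auto)
qed

text \<open>A homomorphism to \<open>H\<close>, whose \<open>c\<close>-th term is trivial, factors
  through the quotient of \<open>F\<close> by its \<open>c\<close>-th term. The result is described
  by corresponding representatives \<open>g\<close> and \<open>f\<close>, the form needed for
  combining transfers in both directions.\<close>

lemma transfer_hom:
  assumes "group G" "group F" "group H" and c: "\<psi> \<in> iso (G Mod lower_central G c) (F Mod lower_central F c)"
    and h: "h \<in> hom F H" and H: "lower_central H c = {\<one>\<^bsub>H\<^esub>}"
  obtains h' where "h' \<in> hom G H"
    "\<And>g f. g \<in> carrier G \<Longrightarrow> f \<in> carrier F \<Longrightarrow>
      \<psi> (lower_central G c #>\<^bsub>G\<^esub> g) = lower_central F c #>\<^bsub>F\<^esub> f \<Longrightarrow> h' g = h f"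
proof -
  interpret G: group G by fact
  interpret F: group F by fact
  interpret H: group H by fact
  interpret h: group_hom F H h using h by unfold_locales
  interpret GN: normal "lower_central G c" G by (rule G.lower_central_normal)
  interpret FN: normal "lower_central F c" F by (rule F.lower_central_normal)
  let ?R = "\<lambda>g f. f \<in> carrier F \<and> \<psi> (lower_central G c #>\<^bsub>G\<^esub> g) = lower_central F c #>\<^bsub>F\<^esub> f"
  have hom: "\<psi> \<in> hom (G Mod lower_central G c) (F Mod lower_central F c)" using c by (simp add: iso_def)
  have ex: "\<exists>f. ?R g f" if "g \<in> carrier G" for g
  proof -
    have "lower_central G c #>\<^bsub>G\<^esub> g \<in> carrier (G Mod lower_central G c)"
      using that by (simp add: carrier_FactGroup)
    then have "\<psi> (lower_central G c #>\<^bsub>G\<^esub> g) \<in> carrier (F Mod lower_central F c)"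
      using hom by (rule hom_in_carrier[rotated])
    then show ?thesis by (auto simp: carrier_FactGroup)
  qed
  have hc: "h x = \<one>\<^bsub>H\<^esub>" if "x \<in> lower_central F c" for x
    using hom_lower_central[OF F.is_group H.is_group h, of c] H that by blast
  have wd: "h f = h f'" if "f \<in> carrier F" "f' \<in> carrier F"
    "lower_central F c #>\<^bsub>F\<^esub> f = lower_central F c #>\<^bsub>F\<^esub> f'" for f f'
  proof -
    have "f \<in> lower_central F c #>\<^bsub>F\<^esub> f'"
      using that F.rcos_self[OF that(1) FN.subgroup_axioms] by simp
    then obtain z where "z \<in> lower_central F c" "f = z \<otimes>\<^bsub>F\<^esub> f'" by (auto simp: r_coset_def)
    then show ?thesis using hc that FN.subset by auto
  qed
  define h' where "h' g = h (SOME f. ?R g f)" for g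
  have key: "h' g = h f" if "g \<in> carrier G" "f \<in> carrier F"
    "\<psi> (lower_central G c #>\<^bsub>G\<^esub> g) = lower_central F c #>\<^bsub>F\<^esub> f" for g f
  proof -
    have "?R g (SOME f. ?R g f)" using ex[OF that(1)] by (rule someI_ex)
    then show ?thesis using wd that unfolding h'_def by metis
  qed
  have "h' \<in> hom G H"
  proof (rule homI)
    fix g assume g: "g \<in> carrier G"
    then show "h' g \<in> carrier H" using ex[OF g] key by auto
  next
    fix g g' assume g: "g \<in> carrier G" "g' \<in> carrier G"
    obtain f where f1: "?R g f" using ex[OF g(1)] by (rule exE)
    obtain f' where f2: "?R g' f'" using ex[OF g(2)] by (rule exE)
    note f = f1 f2
    have "\<psi> (lower_central G c #>\<^bsub>G\<^esub> (g \<otimes>\<^bsub>G\<^esub> g')) =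
        \<psi> ((lower_central G c #>\<^bsub>G\<^esub> g) <#>\<^bsub>G\<^esub> (lower_central G c #>\<^bsub>G\<^esub> g'))"
      using g by (simp add: GN.rcos_sum)
    also have "\<dots> = \<psi> (lower_central G c #>\<^bsub>G\<^esub> g) <#>\<^bsub>F\<^esub> \<psi> (lower_central G c #>\<^bsub>G\<^esub> g')"
      using hom_mult[OF hom, of "lower_central G c #>\<^bsub>G\<^esub> g" "lower_central G c #>\<^bsub>G\<^esub> g'"] g
      by (simp add: carrier_FactGroup)
    also have "\<dots> = lower_central F c #>\<^bsub>F\<^esub> (f \<otimes>\<^bsub>F\<^esub> f')"
      using f by (simp add: FN.rcos_sum)
    finally have "h' (g \<otimes>\<^bsub>G\<^esub> g') = h (f \<otimes>\<^bsub>F\<^esub> f')" using f g by (intro key) auto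
    then show "h' (g \<otimes>\<^bsub>G\<^esub> g') = h' g \<otimes>\<^bsub>H\<^esub> h' g'"
      using key[OF g(1), of f] key[OF g(2), of f'] f by simp
  qed
  then show thesis using key that by blast
qed

section \<open>Truncated Magnus groups modulo an integer\<close>

definition word_set :: "nat \<Rightarrow> nat \<Rightarrow> nat list set" where
  "word_set R c = {w. set w \<subseteq> {..<R} \<and> length w < c}"

lemma finite_word_set: "finite (word_set R c)"
  by (rule finite_subset[OF _ finite_lists_length_le[of "{..<R}" c]]) (auto simp: word_set_def)

text \<open>A normal form for series in \<open>R\<close> letters, truncated at length
  \<open>c\<close>, over the integers modulo \<open>m\<close>. Keeping it inside \<open>ncps\<close>
  places the finite quotients for all parameters in one type.\<close>

definition ncps_reduce :: "nat \<Rightarrow> nat \<Rightarrow> int \<Rightarrow> ncps \<Rightarrow> ncps" where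
  "ncps_reduce R c m a = Abs_ncps (\<lambda>w. if w \<in> word_set R c then coeff a w mod m else 0)"

lemma coeff_ncps_reduce:
  "coeff (ncps_reduce R c m a) w = (if w \<in> word_set R c then coeff a w mod m else 0)"
  by (simp add: ncps_reduce_def Abs_ncps_inverse)

lemma sum_mod_cong:
  fixes m :: int
  assumes "\<And>i. i \<in> A \<Longrightarrow> f i mod m = g i mod m"
  shows "sum f A mod m = sum g A mod m"
  using assms by (subst (1 2) mod_sum_eq[symmetric]) (simp cong: sum.cong)

text \<open>Prefixes of words in \<open>word_set R c\<close> stay in it, so discarded coefficients
  never contribute to those that are kept.\<close>

lemma ncps_reduce_times_left: "ncps_reduce R c m (ncps_reduce R c m a * b) = ncps_reduce R c m (a * b)"
proof (rule ncps_eqI)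
  fix w
  have "(\<Sum>i\<le>length w. coeff (ncps_reduce R c m a) (take i w) * coeff b (drop i w)) mod m =
      (\<Sum>i\<le>length w. coeff a (take i w) * coeff b (drop i w)) mod m" if w: "w \<in> word_set R c"
  proof (rule sum_mod_cong)
    fix i assume "i \<in> {..length w}"
    have "take i w \<in> word_set R c" using w set_take_subset[of i w] by (auto simp: word_set_def)
    then show "coeff (ncps_reduce R c m a) (take i w) * coeff b (drop i w) mod m =
        coeff a (take i w) * coeff b (drop i w) mod m"
      by (simp add: coeff_ncps_reduce mod_mult_left_eq)
  qed
  then show "coeff (ncps_reduce R c m (ncps_reduce R c m a * b)) w = coeff (ncps_reduce R c m (a * b)) w"
    by (simp add: coeff_ncps_reduce coeff_times)
qed

lemma ncps_reduce_times_right: "ncps_reduce R c m (a * ncps_reduce R c m b) = ncps_reduce R c m (a * b)"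
proof (rule ncps_eqI)
  fix w
  have "(\<Sum>i\<le>length w. coeff a (take i w) * coeff (ncps_reduce R c m b) (drop i w)) mod m =
      (\<Sum>i\<le>length w. coeff a (take i w) * coeff b (drop i w)) mod m" if w: "w \<in> word_set R c"
  proof (rule sum_mod_cong)
    fix i assume "i \<in> {..length w}"
    have "drop i w \<in> word_set R c" using w set_drop_subset[of i w] by (auto simp: word_set_def)
    then show "coeff a (take i w) * coeff (ncps_reduce R c m b) (drop i w) mod m =
        coeff a (take i w) * coeff b (drop i w) mod m"
      by (simp add: coeff_ncps_reduce mod_mult_right_eq)
  qed
  then show "coeff (ncps_reduce R c m (a * ncps_reduce R c m b)) w = coeff (ncps_reduce R c m (a * b)) w"
    by (simp add: coeff_ncps_reduce coeff_times)
qed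

lemma ncps_reduce_idem: "ncps_reduce R c m (ncps_reduce R c m a) = ncps_reduce R c m a"
  using ncps_reduce_times_left[of R c m a 1] by simp

definition magnus_quotient :: "nat \<Rightarrow> nat \<Rightarrow> int \<Rightarrow> ncps monoid" where
  "magnus_quotient R c m = \<lparr>carrier = ncps_reduce R c m ` carrier magnus_group,
     monoid.mult = (\<lambda>a b. ncps_reduce R c m (a * b)), one = ncps_reduce R c m 1\<rparr>"

lemma magnus_quotient:
  shows "group (magnus_quotient R c m)"
    and "ncps_reduce R c m \<in> hom magnus_group (magnus_quotient R c m)"
proof -
  show "group (magnus_quotient R c m)"
  proof (rule groupI)
    interpret U: group magnus_group by (rule group_magnus_group)
    fix x assume "x \<in> carrier (magnus_quotient R c m)"
    then obtain a where a: "x = ncps_reduce R c m a" "coeff a [] = 1"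
      by (auto simp: magnus_quotient_def)
    let ?b = "inv\<^bsub>magnus_group\<^esub> a"
    have "?b \<in> carrier magnus_group" "?b * a = 1" using U.l_inv[of a] U.inv_closed[of a] a by auto
    then show "\<exists>y\<in>carrier (magnus_quotient R c m). y \<otimes>\<^bsub>magnus_quotient R c m\<^esub> x = \<one>\<^bsub>magnus_quotient R c m\<^esub>"
      using a by (intro bexI[of _ "ncps_reduce R c m ?b"])
        (auto simp: magnus_quotient_def ncps_reduce_times_left ncps_reduce_times_right)
  qed (auto simp: magnus_quotient_def ncps_reduce_times_left ncps_reduce_times_right
      ncps_reduce_idem mult.assoc)
  show "ncps_reduce R c m \<in> hom magnus_group (magnus_quotient R c m)"
    by (auto simp: hom_def magnus_quotient_def ncps_reduce_times_left ncps_reduce_times_right)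
qed

lemma lower_central_magnus_quotient: "lower_central (magnus_quotient R c m) c = {\<one>\<^bsub>magnus_quotient R c m\<^esub>}"
proof -
  interpret Q: group "magnus_quotient R c m" by (rule magnus_quotient)
  have "lower_central (magnus_quotient R c m) c \<subseteq> ncps_reduce R c m ` lower_central magnus_group c"
    by (rule hom_lower_central_surj[OF group_magnus_group magnus_quotient]) (simp add: magnus_quotient_def)
  also have "\<dots> \<subseteq> ncps_reduce R c m ` dimension_subgroup c"
    using lower_central_magnus_group by (rule image_mono)
  also have "\<dots> \<subseteq> {\<one>\<^bsub>magnus_quotient R c m\<^esub>}"
    by (auto simp: dimension_subgroup_def magnus_quotient_def deg_ge_def word_set_def coeff_ncps_reduce
        intro!: ncps_eqI)
  finally show ?thesis using Q.subgroup_lower_central[of c] subgroup.one_closed by blast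
qed

text \<open>The constant coefficient is fixed and those at nonempty words are arbitrary residues.
  With \<open>m\<close> a power of 2 this gives a 2-group.\<close>

lemma order_magnus_quotient:
  assumes "0 < c" "1 < m"
  shows "Coset.order (magnus_quotient R c (int m)) = m ^ card (word_set R c - {[]})"
proof -
  let ?W = "word_set R c - {[]}"
  let ?g = "\<lambda>a. restrict (coeff a) ?W"
  have "bij_betw ?g (carrier (magnus_quotient R c (int m))) (?W \<rightarrow>\<^sub>E {0..<int m})"
  proof (rule bij_betwI')
    fix a b assume "a \<in> carrier (magnus_quotient R c (int m))" "b \<in> carrier (magnus_quotient R c (int m))"
    then obtain a' b' where ab: "a = ncps_reduce R c m a'" "coeff a' [] = 1" "b = ncps_reduce R c m b'" "coeff b' [] = 1"
      by (auto simp: magnus_quotient_def)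
    show "(?g a = ?g b) = (a = b)"
    proof
      assume eq: "?g a = ?g b"
      have "coeff a w = coeff b w" for w
      proof (cases "w \<in> ?W")
        case True
        then show ?thesis using fun_cong[OF eq, of w] by simp
      next
        case False
        then show ?thesis using ab by (auto simp: coeff_ncps_reduce)
      qed
      then show "a = b" by (rule ncps_eqI)
    qed simp
  next
    fix a assume "a \<in> carrier (magnus_quotient R c (int m))"
    then show "?g a \<in> ?W \<rightarrow>\<^sub>E {0..<int m}"
      using assms by (auto simp: magnus_quotient_def coeff_ncps_reduce)
  next
    fix f assume f: "f \<in> ?W \<rightarrow>\<^sub>E {0..<int m}"
    define a where "a = Abs_ncps (\<lambda>w. if w = [] then 1 else if w \<in> ?W then f w else 0)"
    have a: "coeff a w = (if w = [] then 1 else if w \<in> ?W then f w else 0)" for w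
      by (simp add: a_def Abs_ncps_inverse)
    have f': "f w mod int m = f w" if "w \<in> ?W" for w using PiE_mem[OF f that] by simp
    have "ncps_reduce R c m a \<in> carrier (magnus_quotient R c (int m))"
      using a by (auto simp: magnus_quotient_def)
    moreover have "f = ?g (ncps_reduce R c m a)"
      using f f' by (auto simp: fun_eq_iff coeff_ncps_reduce a PiE_def extensional_def)
    ultimately show "\<exists>x\<in>carrier (magnus_quotient R c (int m)). f = ?g x" by blast
  qed
  then have "card (carrier (magnus_quotient R c (int m))) = card (?W \<rightarrow>\<^sub>E {0..<int m})"
    by (rule bij_betw_same_card)
  then show ?thesis using finite_word_set[of R c] by (simp add: Coset.order_def card_PiE)
qed

text \<open>By \<open>Magnus_Witt\<close> each element of \<open>T\<close> has a nonzero coefficient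
  at some nonempty word of length less than \<open>c\<close>. The alphabet is taken large enough to
  keep all these words, and the modulus is a power of 2 beyond the absolute values of all these
  coefficients.\<close>

lemma (in magnus_hom) separating_quotient:
  assumes T: "finite T" "T \<subseteq> carrier G" "T \<inter> lower_central G c = {}" and c: "1 \<le> c"
  obtains Q :: "ncps monoid" and q k where "group Q" "Coset.order Q = 2 ^ k" "lower_central Q c = {\<one>\<^bsub>Q\<^esub>}"
    "q \<in> hom G Q" "\<And>z. z \<in> T \<Longrightarrow> q z \<noteq> \<one>\<^bsub>Q\<^esub>"
proof -
  have "\<exists>w. length w < c \<and> coeff (\<mu> z - 1) w \<noteq> 0" if "z \<in> T" for z
  proof -
    have "\<not> deg_ge c (\<mu> z - 1)" using Magnus_Witt[of z c] that T by blast
    then show ?thesis unfolding deg_ge_def by blast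
  qed
  then obtain w where w: "\<And>z. z \<in> T \<Longrightarrow> length (w z) < c \<and> coeff (\<mu> z - 1) (w z) \<noteq> 0" by metis
  obtain R where R: "\<Union> (set ` w ` T) \<subseteq> {..<R}"
  proof -
    have "finite (\<Union> (set ` w ` T))" using T by simp
    then show thesis using that finite_nat_iff_bounded by blast
  qed
  obtain M where M: "(\<lambda>z. nat \<bar>coeff (\<mu> z) (w z)\<bar>) ` T \<subseteq> {..<M}"
    using finite_nat_iff_bounded[of "(\<lambda>z. nat \<bar>coeff (\<mu> z) (w z)\<bar>) ` T"] T by blast
  define m :: nat where "m = 2 ^ (M + 1)"
  have m: "M < m" "1 < m" using power_gt_expt[of 2 "M + 1"] unfolding m_def by linarith+
  let ?Q = "magnus_quotient R c (int m)"
  have hom: "ncps_reduce R c m \<circ> \<mu> \<in> hom G ?Q"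
    by (rule Group.hom_compose[OF mu magnus_quotient(2)])
  have "ncps_reduce R c m (\<mu> z) \<noteq> \<one>\<^bsub>?Q\<^esub>" if z: "z \<in> T" for z
  proof
    assume "ncps_reduce R c m (\<mu> z) = \<one>\<^bsub>?Q\<^esub>"
    moreover have wz: "w z \<in> word_set R c" using w[OF z] R z by (auto simp: word_set_def)
    ultimately have "coeff (\<mu> z) (w z) mod int m = coeff 1 (w z) mod int m"
      by (metis coeff_ncps_reduce magnus_quotient_def monoid.select_convs(2))
    moreover have wne: "w z \<noteq> []" using w[OF z] mu_closed[of z] z T by auto
    ultimately have "int m dvd coeff (\<mu> z) (w z)" by auto
    moreover have "\<bar>coeff (\<mu> z) (w z)\<bar> < int m" using M m z by force
    moreover have "coeff (\<mu> z) (w z) \<noteq> 0" using w[OF z] wne by simp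
    ultimately show False using dvd_imp_le_int[of "coeff (\<mu> z) (w z)" "int m"] by simp
  qed
  moreover have "Coset.order ?Q = 2 ^ ((M + 1) * card (word_set R c - {[]}))"
    using order_magnus_quotient[of c m R] c m(2) unfolding m_def power_mult[symmetric] by simp
  ultimately show thesis
    using that[of ?Q _ "ncps_reduce R c m \<circ> \<mu>"] magnus_quotient(1) lower_central_magnus_quotient hom by simp
qed

section \<open>The Magnus expansion of a free group\<close>

lemma generate_free_group: "generate (free_group B) ((\<lambda>x. [(x, True)]) ` B) = carrier (free_group B)"
proof -
  interpret F: group "free_group B" by (rule group_free_group)
  let ?S = "generate (free_group B) ((\<lambda>x. [(x, True)]) ` B)"
  have S: "(\<lambda>x. [(x, True)]) ` B \<subseteq> carrier (free_group B)" by (auto simp: free_group_def reduced_Cons)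
  have letter: "[p] \<in> ?S" if "fst p \<in> B" for p
  proof (cases p)
    case (Pair x b)
    have t: "[(x, True)] \<in> ?S" using that Pair by (auto intro: generate.incl)
    have "[(x, False)] \<otimes>\<^bsub>free_group B\<^esub> [(x, True)] = \<one>\<^bsub>free_group B\<^esub>"
      by (simp add: free_group_def)
    then have "inv\<^bsub>free_group B\<^esub> [(x, True)] = [(x, False)]"
      using that Pair by (intro F.inv_equality) (auto simp: free_group_def reduced_Cons)
    then have "[(x, False)] \<in> ?S"
      using F.generate_m_inv_closed[OF S t] by simp
    then show ?thesis using t Pair by (cases b) auto
  qed
  have "ws \<in> ?S" if "ws \<in> carrier (free_group B)" for ws
    using that
  proof (induction ws)
    case Nil
    then show ?case using generate.one[of "free_group B"] by (simp add: free_group_def)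
  next
    case (Cons p ws)
    then have "ws \<in> ?S" "[p] \<in> ?S" using letter by (auto simp: free_group_def reduced_Cons)
    then have "[p] \<otimes>\<^bsub>free_group B\<^esub> ws \<in> ?S" by (rule generate.eng[rotated])
    moreover have "[p] \<otimes>\<^bsub>free_group B\<^esub> ws = p # ws"
      using Cons.prems by (cases ws) (auto simp: free_group_def reduced_Cons)
    ultimately show ?case by simp
  qed
  then show ?thesis using F.generate_incl[OF S] by blast
qed

lemma magnus_hom_free_group:
  assumes "finite B"
  obtains e \<mu> where "magnus_hom (free_group B) (card B) e \<mu>"
proof -
  obtain b where b: "bij_betw b {0..<card B} B" using ex_bij_betw_nat_finite[OF assms] by blast
  define idx where "idx = inv_into {0..<card B} b"
  have idx: "idx (b i) = i" if "i < card B" for i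
    using that b by (simp add: idx_def bij_betw_def)
  obtain \<mu> where \<mu>: "\<mu> \<in> hom (free_group B) magnus_group"
      "\<And>x. x \<in> B \<Longrightarrow> \<mu> [(x, True)] = 1 + ncps_var (idx x)"
    by (rule free_group_universal[OF group_magnus_group, of "\<lambda>x. 1 + ncps_var (idx x)" B])
      (auto simp: coeff_var)
  have img: "(\<lambda>i. [(b i, True)]) ` {..<card B} = (\<lambda>x. [(x, True)]) ` B"
    using b by (auto simp: bij_betw_def lessThan_atLeast0 image_image[symmetric])
  have bB: "b i \<in> B" if "i < card B" for i using b that by (auto simp: bij_betw_def)
  have "magnus_hom (free_group B) (card B) (\<lambda>i. [(b i, True)]) \<mu>"
  proof (intro magnus_hom.intro group_free_group magnus_hom_axioms.intro)
    show "(\<lambda>i. [(b i, True)]) ` {..<card B} \<subseteq> carrier (free_group B)"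
      using bB by (auto simp: free_group_def reduced_Cons)
    show "generate (free_group B) ((\<lambda>i. [(b i, True)]) ` {..<card B}) = carrier (free_group B)"
      unfolding img by (rule generate_free_group)
    show "\<mu> [(b i, True)] = 1 + ncps_var i" if "i < card B" for i
      using \<mu>(2)[OF bB[OF that]] idx[OF that] by simp
  qed (rule \<mu>)
  then show thesis by (rule that)
qed

section \<open>Counting derivations modulo a power of 2\<close>

text \<open>The semidirect product of the functions \<open>Q \<rightarrow> \<int>/m\<close> with
  \<open>Q\<close>, in other words a wreath product; \<open>Q\<close> acts by left translation, and
  residues are represented in \<open>{0..<m}\<close>.\<close>

definition cocycle_group :: "('q, 'm) monoid_scheme \<Rightarrow> int \<Rightarrow> (('q \<Rightarrow> int) \<times> 'q) monoid" where
  "cocycle_group Q m = \<lparr>carrier = (carrier Q \<rightarrow>\<^sub>E {0..<m}) \<times> carrier Q,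
     monoid.mult = (\<lambda>(u, a) (v, b). (\<lambda>y\<in>carrier Q. (u y + v (inv\<^bsub>Q\<^esub> a \<otimes>\<^bsub>Q\<^esub> y)) mod m, a \<otimes>\<^bsub>Q\<^esub> b)),
     one = (\<lambda>y\<in>carrier Q. 0, \<one>\<^bsub>Q\<^esub>)\<rparr>"

lemma group_cocycle_group:
  assumes "group Q" "0 < m"
  shows "group (cocycle_group Q m)"
proof -
  interpret Q: group Q by fact
  show ?thesis
  proof (rule groupI)
    fix x y assume "x \<in> carrier (cocycle_group Q m)" "y \<in> carrier (cocycle_group Q m)"
    then show "x \<otimes>\<^bsub>cocycle_group Q m\<^esub> y \<in> carrier (cocycle_group Q m)"
      using assms by (auto simp: cocycle_group_def)
  next
    show "\<one>\<^bsub>cocycle_group Q m\<^esub> \<in> carrier (cocycle_group Q m)"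
      using assms by (auto simp: cocycle_group_def)
  next
    fix x y z assume "x \<in> carrier (cocycle_group Q m)" "y \<in> carrier (cocycle_group Q m)" "z \<in> carrier (cocycle_group Q m)"
    then show "x \<otimes>\<^bsub>cocycle_group Q m\<^esub> y \<otimes>\<^bsub>cocycle_group Q m\<^esub> z = x \<otimes>\<^bsub>cocycle_group Q m\<^esub> (y \<otimes>\<^bsub>cocycle_group Q m\<^esub> z)"
      by (auto simp: cocycle_group_def fun_eq_iff mod_simps Q.m_assoc Q.inv_mult_group add.assoc)
  next
    fix x assume x: "x \<in> carrier (cocycle_group Q m)"
    obtain u a where ua: "x = (u, a)" by (cases x)
    have u: "u \<in> carrier Q \<rightarrow>\<^sub>E {0..<m}" and a: "a \<in> carrier Q" using x ua by (auto simp: cocycle_group_def)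
    have um: "u y mod m = u y" if "y \<in> carrier Q" for y using PiE_mem[OF u that] by simp
    have "(\<lambda>y\<in>carrier Q. (0 + u (inv\<^bsub>Q\<^esub> \<one>\<^bsub>Q\<^esub> \<otimes>\<^bsub>Q\<^esub> y)) mod m) = u"
      using u um by (auto simp: fun_eq_iff PiE_def extensional_def)
    then show "\<one>\<^bsub>cocycle_group Q m\<^esub> \<otimes>\<^bsub>cocycle_group Q m\<^esub> x = x"
      using a by (simp add: cocycle_group_def ua cong: restrict_cong)
    let ?y = "(\<lambda>y\<in>carrier Q. (- u (a \<otimes>\<^bsub>Q\<^esub> y)) mod m, inv\<^bsub>Q\<^esub> a)"
    have "?y \<in> carrier (cocycle_group Q m)" using a assms by (auto simp: cocycle_group_def)
    moreover have "?y \<otimes>\<^bsub>cocycle_group Q m\<^esub> x = \<one>\<^bsub>cocycle_group Q m\<^esub>"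
      using a by (auto simp: cocycle_group_def ua fun_eq_iff mod_simps)
    ultimately show "\<exists>y\<in>carrier (cocycle_group Q m). y \<otimes>\<^bsub>cocycle_group Q m\<^esub> x = \<one>\<^bsub>cocycle_group Q m\<^esub>"
      by blast
  qed
qed

lemma order_cocycle_group:
  assumes "finite (carrier Q)"
  shows "Coset.order (cocycle_group Q (int m)) = m ^ card (carrier Q) * Coset.order Q"
  using assms by (simp add: Coset.order_def cocycle_group_def card_cartesian_product card_PiE)

lemma hom_eq_on_generators:
  assumes "group G" "group H" "h \<in> hom G H" "k \<in> hom G H" and S: "S \<subseteq> carrier G" "\<And>s. s \<in> S \<Longrightarrow> h s = k s"
    and x: "x \<in> generate G S"
  shows "h x = k x"
proof -
  interpret h: group_hom G H h using assms by (simp add: group_hom_def group_hom_axioms_def)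
  interpret k: group_hom G H k using assms by (simp add: group_hom_def group_hom_axioms_def)
  show ?thesis using x
  proof (induction x rule: generate.induct)
    case (inv s)
    then have "s \<in> carrier G" using S by blast
    then show ?case using S(2)[OF inv] by simp
  next
    case (eng a b)
    then have "a \<in> carrier G" "b \<in> carrier G" using h.G.generate_in_carrier[OF S(1)] by auto
    then show ?case using eng by simp
  qed (use S in auto)
qed

text \<open>Here \<open>g\<close> acts on functions on \<open>Q\<close> by left translation with
  \<open>q g\<close>. For a homomorphism \<open>q\<close> these are the first components of the
  homomorphisms from \<open>G\<close> to \<open>cocycle_group Q m\<close> with second component
  \<open>q\<close>.\<close>

definition derivation_mod ::
    "('a, 'm) monoid_scheme \<Rightarrow> ('q, 'n) monoid_scheme \<Rightarrow> ('a \<Rightarrow> 'q) \<Rightarrow> int \<Rightarrow> ('a \<Rightarrow> 'q \<Rightarrow> int) \<Rightarrow> bool" where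
  "derivation_mod G Q q m \<delta> \<longleftrightarrow>
     (\<forall>g\<in>carrier G. \<delta> g \<in> carrier Q \<rightarrow>\<^sub>E {0..<m}) \<and>
     (\<forall>g\<in>carrier G. \<forall>h\<in>carrier G. \<forall>y\<in>carrier Q.
        \<delta> (g \<otimes>\<^bsub>G\<^esub> h) y = (\<delta> g y + \<delta> h (inv\<^bsub>Q\<^esub> (q g) \<otimes>\<^bsub>Q\<^esub> y)) mod m)"

text \<open>
  A derivation with values in the functions \<open>Q \<rightarrow> \<int>/m\<close> is a homomorphism to a semidirect product
  of order a power of 2. That group is nilpotent, so \<open>G\<close> has as many of these homomorphisms as the
  free group has.
\<close>

lemma many_derivations:
  fixes B :: "'x set"
  assumes G: "group G" and Q: "group Q" and genus: "same_nilpotent_genus G (free_group B)"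
    and ord: "Coset.order Q = 2 ^ k" and q: "q \<in> hom G Q"
  obtains \<Phi> where
    "\<And>f. f \<in> B \<rightarrow>\<^sub>E (carrier Q \<rightarrow>\<^sub>E {0..<2 ^ j :: int}) \<Longrightarrow> derivation_mod G Q q (2 ^ j) (\<Phi> f)"
    "\<And>f f'. f \<in> B \<rightarrow>\<^sub>E (carrier Q \<rightarrow>\<^sub>E {0..<2 ^ j :: int}) \<Longrightarrow> f' \<in> B \<rightarrow>\<^sub>E (carrier Q \<rightarrow>\<^sub>E {0..<2 ^ j :: int}) \<Longrightarrow>
      (\<And>g. g \<in> carrier G \<Longrightarrow> \<Phi> f g = \<Phi> f' g) \<Longrightarrow> f = f'"
proof -
  interpret G: group G by fact
  interpret Q: group Q by fact
  let ?F = "free_group B" and ?m = "2 ^ j :: int"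
  interpret F: group ?F by (rule group_free_group)
  define P where "P = cocycle_group Q ?m"
  have P: "group P" unfolding P_def by (rule group_cocycle_group) (use Q in auto)
  interpret P: group P by (rule P)
  have finQ: "finite (carrier Q)"
    by (rule card_ge_0_finite) (use ord in \<open>simp add: Coset.order_def\<close>)
  have "Coset.order P = 2 ^ (j * card (carrier Q) + k)"
    using order_cocycle_group[OF finQ, of "2 ^ j"] ord by (simp add: P_def power_add power_mult)
  then obtain c1 where c1: "1 \<le> c1" "lower_central P c1 = {\<one>\<^bsub>P\<^esub>}"
    using P.prime_power_order_nilpotent[of 2] by auto
  obtain c2 where c2: "1 \<le> c2" "lower_central Q c2 = {\<one>\<^bsub>Q\<^esub>}"
    using Q.prime_power_order_nilpotent[of 2, OF _ ord] by auto
  \<comment> \<open>Large enough for both targets: \<open>q\<close> is carried to the free group,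
    and homomorphisms to \<open>P\<close> are carried back, through the same isomorphism of
    quotients.\<close>
  define c where "c = max c1 c2"
  have c: "1 \<le> c" "lower_central P c = {\<one>\<^bsub>P\<^esub>}" "lower_central Q c = {\<one>\<^bsub>Q\<^esub>}"
    using P.lower_central_trivial_mono[OF c1(2)] Q.lower_central_trivial_mono[OF c2(2)] c1
    by (auto simp: c_def)
  obtain \<psi> where \<psi>: "\<psi> \<in> iso (G Mod lower_central G c) (?F Mod lower_central ?F c)"
    using genus c(1) unfolding same_nilpotent_genus_def is_iso_def by blast
  define \<xi> where "\<xi> = inv_into (carrier (G Mod lower_central G c)) \<psi>"
  interpret GN: normal "lower_central G c" G by (rule G.lower_central_normal)
  have \<xi>: "\<xi> \<in> iso (?F Mod lower_central ?F c) (G Mod lower_central G c)"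
    unfolding \<xi>_def by (rule group.iso_set_sym[OF GN.factorgroup_is_group \<psi>])
  have bij: "bij_betw \<psi> (carrier (G Mod lower_central G c)) (carrier (?F Mod lower_central ?F c))"
    using \<psi> by (simp add: iso_def)
  have bij': "bij_betw \<xi> (carrier (?F Mod lower_central ?F c)) (carrier (G Mod lower_central G c))"
    using \<xi> by (simp add: iso_def)
  let ?R = "\<lambda>g f. \<psi> (lower_central G c #>\<^bsub>G\<^esub> g) = lower_central ?F c #>\<^bsub>?F\<^esub> f"
  have cG: "lower_central G c #>\<^bsub>G\<^esub> g \<in> carrier (G Mod lower_central G c)" if "g \<in> carrier G" for g
    using that by (simp add: carrier_FactGroup)
  have cF: "lower_central ?F c #>\<^bsub>?F\<^esub> f \<in> carrier (?F Mod lower_central ?F c)" if "f \<in> carrier ?F" for f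
    using that by (simp add: carrier_FactGroup)
  have exF: "\<exists>f\<in>carrier ?F. ?R g f" if "g \<in> carrier G" for g
  proof -
    have "\<psi> (lower_central G c #>\<^bsub>G\<^esub> g) \<in> carrier (?F Mod lower_central ?F c)"
      using bij_betwE[OF bij] cG[OF that] by blast
    then show ?thesis unfolding carrier_FactGroup by blast
  qed
  have exG: "\<exists>g\<in>carrier G. ?R g f" if f: "f \<in> carrier ?F" for f
  proof -
    obtain X where "X \<in> carrier (G Mod lower_central G c)" "\<psi> X = lower_central ?F c #>\<^bsub>?F\<^esub> f"
      using bij cF[OF f] by (metis bij_betw_imp_surj_on imageE)
    then show ?thesis by (auto simp: carrier_FactGroup)
  qed
  have R_sym: "\<xi> (lower_central ?F c #>\<^bsub>?F\<^esub> f) = lower_central G c #>\<^bsub>G\<^esub> g"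
    if "g \<in> carrier G" "f \<in> carrier ?F" "?R g f" for g f
    unfolding \<xi>_def that(3)[symmetric] using bij cG[OF that(1)] by (metis bij_betw_inv_into_left)
  \<comment> \<open>The counterpart of \<open>q\<close> on the free group, to serve as second
    component of the homomorphisms to \<open>P\<close>.\<close>
  obtain q' where q': "q' \<in> hom ?F Q"
    "\<And>f g. f \<in> carrier ?F \<Longrightarrow> g \<in> carrier G \<Longrightarrow>
      \<xi> (lower_central ?F c #>\<^bsub>?F\<^esub> f) = lower_central G c #>\<^bsub>G\<^esub> g \<Longrightarrow> q' f = q g"
    by (rule transfer_hom[OF F.is_group G Q \<xi> q c(3)]) blast
  let ?D = "B \<rightarrow>\<^sub>E (carrier Q \<rightarrow>\<^sub>E {0..<?m})"
  have gen: "[(x, True)] \<in> carrier ?F" if "x \<in> B" for x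
    using that by (simp add: free_group_def reduced_Cons)
  have "\<exists>h. h \<in> hom ?F P \<and> (\<forall>x\<in>B. h [(x, True)] = (f x, q' [(x, True)]))" if "f \<in> ?D" for f
  proof -
    have "(\<lambda>x. (f x, q' [(x, True)])) \<in> B \<rightarrow> carrier P"
      using that hom_in_carrier[OF q'(1) gen] by (auto simp: P_def cocycle_group_def PiE_def)
    from free_group_universal[OF P this] show ?thesis by metis
  qed
  then obtain h where h: "\<And>f. f \<in> ?D \<Longrightarrow> h f \<in> hom ?F P"
    and h_gen: "\<And>f x. f \<in> ?D \<Longrightarrow> x \<in> B \<Longrightarrow> h f [(x, True)] = (f x, q' [(x, True)])" by metis
  have snd_P: "snd \<in> hom P Q" by (auto simp: P_def cocycle_group_def hom_def)
  have snd_h: "snd (h f z) = q' z" if f: "f \<in> ?D" and z: "z \<in> carrier ?F" for f z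
  proof -
    have "(snd \<circ> h f) z = q' z"
    proof (rule hom_eq_on_generators[OF F.is_group Q _ q'(1)])
      show "snd \<circ> h f \<in> hom ?F Q" by (rule Group.hom_compose[OF h[OF f] snd_P])
      show "z \<in> generate ?F ((\<lambda>x. [(x, True)]) ` B)" using z by (simp add: generate_free_group)
      show "(\<lambda>x. [(x, True)]) ` B \<subseteq> carrier ?F" using gen by auto
      show "(snd \<circ> h f) s = q' s" if "s \<in> (\<lambda>x. [(x, True)]) ` B" for s
        using that h_gen[OF f] by auto
    qed
    then show ?thesis by simp
  qed
  have "\<exists>k. k \<in> hom G P \<and> (\<forall>g\<in>carrier G. \<forall>z\<in>carrier ?F. ?R g z \<longrightarrow> k g = h f z)" if "f \<in> ?D" for f
    by (rule transfer_hom[OF G F.is_group P \<psi> h[OF that] c(2)]) blast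
  then obtain k where k: "\<And>f. f \<in> ?D \<Longrightarrow> k f \<in> hom G P"
    and kh: "\<And>f g z. f \<in> ?D \<Longrightarrow> g \<in> carrier G \<Longrightarrow> z \<in> carrier ?F \<Longrightarrow> ?R g z \<Longrightarrow> k f g = h f z" by metis
  have snd_k: "snd (k f g) = q g" if f: "f \<in> ?D" and g: "g \<in> carrier G" for f g
  proof -
    obtain z where z: "z \<in> carrier ?F" "?R g z" using exF[OF g] by blast
    then show ?thesis using kh[OF f g z] snd_h[OF f z(1)] q'(2)[OF z(1) g R_sym[OF g z]] by simp
  qed
  have k_closed: "k f g \<in> carrier P" if "f \<in> ?D" "g \<in> carrier G" for f g
    using hom_in_carrier[OF k[OF that(1)] that(2)] .
  show thesis
  proof (rule that[of "\<lambda>f g. fst (k f g)"])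
    fix f assume f: "f \<in> ?D"
    show "derivation_mod G Q q ?m (\<lambda>g. fst (k f g))"
      unfolding derivation_mod_def
    proof (intro conjI ballI)
      fix g assume "g \<in> carrier G"
      then show "fst (k f g) \<in> carrier Q \<rightarrow>\<^sub>E {0..<?m}"
        using k_closed[OF f] by (fastforce simp: P_def cocycle_group_def)
    next
      fix g g' y assume g: "g \<in> carrier G" "g' \<in> carrier G" and y: "y \<in> carrier Q"
      have "k f (g \<otimes>\<^bsub>G\<^esub> g') = k f g \<otimes>\<^bsub>P\<^esub> k f g'" using hom_mult[OF k[OF f]] g by simp
      moreover have "k f g = (fst (k f g), q g)" "k f g' = (fst (k f g'), q g')"
        using snd_k[OF f] g by (metis prod.collapse)+
      ultimately have "k f (g \<otimes>\<^bsub>G\<^esub> g') = (fst (k f g), q g) \<otimes>\<^bsub>P\<^esub> (fst (k f g'), q g')" by metis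
      then show "fst (k f (g \<otimes>\<^bsub>G\<^esub> g')) y = (fst (k f g) y + fst (k f g') (inv\<^bsub>Q\<^esub> (q g) \<otimes>\<^bsub>Q\<^esub> y)) mod ?m"
        using y by (simp add: P_def cocycle_group_def)
    qed
  next
    fix f f' assume f: "f \<in> ?D" "f' \<in> ?D" and eq: "\<And>g. g \<in> carrier G \<Longrightarrow> fst (k f g) = fst (k f' g)"
    show "f = f'"
    proof (rule PiE_ext[OF f])
      fix x assume x: "x \<in> B"
      \<comment> \<open>An element of \<open>G\<close> corresponding to the letter: the transferred
        derivation takes the value \<open>f x\<close> there.\<close>
      obtain g where g: "g \<in> carrier G" "?R g [(x, True)]" using exG[OF gen[OF x]] by blast
      then show "f x = f' x"
        using kh[OF f(1) g(1) gen[OF x] g(2)] kh[OF f(2) g(1) gen[OF x] g(2)] h_gen[OF f(1) x] h_gen[OF f(2) x] eq[OF g(1)]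
        by simp
    qed
  qed
qed

section \<open>Fox calculus and integer points\<close>

text \<open>Positive words only. The generating set of \<open>G\<close> will be closed under
  inverses, and the relations between a letter and its inverse are among the pairs of words with
  equal value.\<close>

primrec word_val :: "('a, 'm) monoid_scheme \<Rightarrow> 'a list \<Rightarrow> 'a" where
  "word_val G [] = \<one>\<^bsub>G\<^esub>"
| "word_val G (s # u) = s \<otimes>\<^bsub>G\<^esub> word_val G u"

text \<open>
  \<open>fox q Q x u\<close> is the value at the word \<open>u\<close> of the derivation with values \<open>x (s, \<cdot>)\<close> at the letters
  \<open>s\<close>, where \<open>s\<close> acts on the functions on \<open>Q\<close> through left translation by \<open>q s\<close>.
\<close>

primrec fox :: "('a \<Rightarrow> 'q) \<Rightarrow> ('q, 'n) monoid_scheme \<Rightarrow> ('a \<times> 'q \<Rightarrow> 'r::ab_group_add) \<Rightarrow> 'a list \<Rightarrow> 'q \<Rightarrow> 'r" where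
  "fox q Q x [] y = 0"
| "fox q Q x (s # u) y = x (s, y) + fox q Q x u (inv\<^bsub>Q\<^esub> (q s) \<otimes>\<^bsub>Q\<^esub> y)"

lemma (in group) word_val_closed: "set u \<subseteq> carrier G \<Longrightarrow> word_val G u \<in> carrier G"
  by (induction u) auto

lemma (in group) word_val_append:
  "set u \<subseteq> carrier G \<Longrightarrow> set v \<subseteq> carrier G \<Longrightarrow> word_val G (u @ v) = word_val G u \<otimes> word_val G v"
  by (induction u) (auto simp: word_val_closed m_assoc)

lemma fox_diff: "fox q Q (\<lambda>i. x i - x' i) u y = fox q Q x u y - fox q Q x' u y"
  by (induction u arbitrary: y) auto

lemma fox_of_int: "fox q Q (\<lambda>i. of_int (x i)) u y = (of_int (fox q Q x u y) :: real)"
  by (induction u arbitrary: y) auto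

text \<open>A cocycle is encoded by its values on the letters. The pairs in \<open>E\<close> are
  meant to spell equal elements, and \<open>u0\<close> the element at which the cocycle has to
  vanish. \<open>E\<close> will be finite, since all relations at once are out of reach of the
  counting argument.\<close>

definition fox_solutions :: "('q, 'n) monoid_scheme \<Rightarrow> ('a \<Rightarrow> 'q) \<Rightarrow> 'a set \<Rightarrow> ('a list \<times> 'a list) set \<Rightarrow> 'a list \<Rightarrow> ('a \<times> 'q \<Rightarrow> real) set" where
  "fox_solutions Q q S E u0 = {x. (\<forall>i. i \<notin> S \<times> carrier Q \<longrightarrow> x i = 0) \<and>
     (\<forall>(u, v)\<in>E. \<forall>y\<in>carrier Q. fox q Q x u y = fox q Q x v y) \<and> (\<forall>y\<in>carrier Q. fox q Q x u0 y = 0)}"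

lemma small_int_dvd: "m dvd x \<Longrightarrow> \<bar>x\<bar> < m \<Longrightarrow> x = 0" for x m :: int
  using dvd_imp_le_int[of x m] abs_ge_self[of m] by linarith

context
  fixes G :: "('a, 'm) monoid_scheme" and Q :: "('q, 'n) monoid_scheme" and q :: "'a \<Rightarrow> 'q"
  assumes G: "group G" and Q: "group Q" and q: "q \<in> hom G Q"
begin

interpretation G: group G by (rule G)
interpretation Q: group Q by (rule Q)

lemma q_closed: "g \<in> carrier G \<Longrightarrow> q g \<in> carrier Q"
  using q by (rule hom_in_carrier)

lemma fox_cong:
  assumes "\<And>s y. s \<in> set u \<Longrightarrow> y \<in> carrier Q \<Longrightarrow> x (s, y) = x' (s, y)" "set u \<subseteq> carrier G" "y \<in> carrier Q"
  shows "fox q Q x u y = fox q Q x' u y"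
  using assms by (induction u arbitrary: y) (auto simp: q_closed)

lemma fox_mod_cong:
  fixes x x' :: "'a \<times> 'q \<Rightarrow> int"
  assumes "\<And>s y. s \<in> set u \<Longrightarrow> y \<in> carrier Q \<Longrightarrow> x (s, y) mod m = x' (s, y) mod m"
    "set u \<subseteq> carrier G" "y \<in> carrier Q"
  shows "fox q Q x u y mod m = fox q Q x' u y mod m"
  using assms
proof (induction u arbitrary: y)
  case (Cons s u)
  then have "fox q Q x u (inv\<^bsub>Q\<^esub> (q s) \<otimes>\<^bsub>Q\<^esub> y) mod m = fox q Q x' u (inv\<^bsub>Q\<^esub> (q s) \<otimes>\<^bsub>Q\<^esub> y) mod m"
    by (simp add: q_closed)
  moreover have "x (s, y) mod m = x' (s, y) mod m" using Cons by simp
  ultimately show ?case unfolding fox.simps by (rule mod_add_cong[rotated])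
qed simp

lemma fox_bound:
  fixes x :: "'a \<times> 'q \<Rightarrow> int"
  assumes "\<And>s y. s \<in> set u \<Longrightarrow> y \<in> carrier Q \<Longrightarrow> \<bar>x (s, y)\<bar> \<le> C" "set u \<subseteq> carrier G" "y \<in> carrier Q"
  shows "\<bar>fox q Q x u y\<bar> \<le> int (length u) * C"
  using assms
proof (induction u arbitrary: y)
  case (Cons s u)
  then have "\<bar>fox q Q x u (inv\<^bsub>Q\<^esub> (q s) \<otimes>\<^bsub>Q\<^esub> y)\<bar> \<le> int (length u) * C" "\<bar>x (s, y)\<bar> \<le> C"
    by (simp_all add: q_closed)
  then show ?case by (simp add: algebra_simps)
qed simp

lemma fox_append:
  assumes "set u \<subseteq> carrier G" "set v \<subseteq> carrier G" "y \<in> carrier Q"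
  shows "fox q Q x (u @ v) y = fox q Q x u y + fox q Q x v (inv\<^bsub>Q\<^esub> (q (word_val G u)) \<otimes>\<^bsub>Q\<^esub> y)"
  using assms
proof (induction u arbitrary: y)
  case Nil
  then show ?case using hom_one[OF q G Q] by simp
next
  case (Cons s u)
  then show ?case
    by (simp add: q_closed hom_mult[OF q] G.word_val_closed Q.inv_mult_group Q.m_assoc add.assoc)
qed

text \<open>Right translation commutes with the action by left translation; this is the symmetry of
  the solution space.\<close>

lemma fox_translate:
  assumes "set u \<subseteq> carrier G" "y \<in> carrier Q" "c \<in> carrier Q"
  shows "fox q Q (\<lambda>(s, y). x (s, y \<otimes>\<^bsub>Q\<^esub> c)) u y = fox q Q x u (y \<otimes>\<^bsub>Q\<^esub> c)"
  using assms by (induction u arbitrary: y) (auto simp: q_closed Q.m_assoc)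

lemma derivation_mod_fox:
  assumes \<delta>: "derivation_mod G Q q m \<delta>" and u: "set u \<subseteq> carrier G" "y \<in> carrier Q"
  shows "fox q Q (\<lambda>(s, y). \<delta> s y) u y mod m = \<delta> (word_val G u) y"
  using u
proof (induction u arbitrary: y)
  case Nil
  \<comment> \<open>The value at the unit equals twice itself modulo \<open>m\<close>, hence is
    0.\<close>
  have "\<delta> (\<one>\<^bsub>G\<^esub> \<otimes>\<^bsub>G\<^esub> \<one>\<^bsub>G\<^esub>) y = (\<delta> \<one>\<^bsub>G\<^esub> y + \<delta> \<one>\<^bsub>G\<^esub> (inv\<^bsub>Q\<^esub> (q \<one>\<^bsub>G\<^esub>) \<otimes>\<^bsub>Q\<^esub> y)) mod m"
    using \<delta> Nil unfolding derivation_mod_def by blast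
  then have eq: "\<delta> \<one>\<^bsub>G\<^esub> y = (\<delta> \<one>\<^bsub>G\<^esub> y + \<delta> \<one>\<^bsub>G\<^esub> y) mod m"
    using Nil hom_one[OF q G Q] by simp
  have "\<delta> \<one>\<^bsub>G\<^esub> \<in> carrier Q \<rightarrow>\<^sub>E {0..<m}" using \<delta> unfolding derivation_mod_def by blast
  then have range: "0 \<le> \<delta> \<one>\<^bsub>G\<^esub> y" "\<delta> \<one>\<^bsub>G\<^esub> y < m" using Nil by auto
  then have "(\<delta> \<one>\<^bsub>G\<^esub> y + \<delta> \<one>\<^bsub>G\<^esub> y) mod m = \<delta> \<one>\<^bsub>G\<^esub> y mod m" using eq by simp
  then have "(\<delta> \<one>\<^bsub>G\<^esub> y + \<delta> \<one>\<^bsub>G\<^esub> y - \<delta> \<one>\<^bsub>G\<^esub> y) mod m = 0" by (simp add: mod_eq_dvd_iff)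
  then show ?case using range by simp
next
  case (Cons s u)
  have "\<delta> (s \<otimes>\<^bsub>G\<^esub> word_val G u) y = (\<delta> s y + \<delta> (word_val G u) (inv\<^bsub>Q\<^esub> (q s) \<otimes>\<^bsub>Q\<^esub> y)) mod m"
    using \<delta> Cons.prems G.word_val_closed[of u] unfolding derivation_mod_def by simp
  also have "\<dots> = (\<delta> s y + fox q Q (\<lambda>(s, y). \<delta> s y) u (inv\<^bsub>Q\<^esub> (q s) \<otimes>\<^bsub>Q\<^esub> y) mod m) mod m"
    using Cons by (simp add: q_closed)
  finally show ?case by (simp add: mod_simps)
qed

text \<open>Since \<open>J\<close> determines the solutions, this is a lower bound for the dimension
  of the solution space. Each derivation \<open>\<Phi> f\<close> modulo \<open>m\<close> is shifted
  by all points \<open>b\<close> of a box of side \<open>h\<close>. If two shifts agree modulo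
  \<open>m\<close>, then \<open>z = b - b'\<close> solves the equations modulo \<open>m\<close>;
  being small compared with \<open>m\<close>, it solves them exactly and is determined by its
  entries on \<open>J\<close>. So at most \<open>h ^ card J\<close> shifts coincide. Comparing
  cardinalities, with \<open>m = D * h\<close> and \<open>h\<close> much larger than
  \<open>D\<close>, bounds the exponent \<open>card J\<close> from below.\<close>

lemma fox_solutions_coordinates:
  fixes B :: "'x set"
  assumes S: "finite S" "S \<subseteq> carrier G" "\<And>g. g \<in> carrier G \<Longrightarrow> \<exists>u. set u \<subseteq> S \<and> word_val G u = g"
    and finQ: "finite (carrier Q)" and B: "finite B" "B \<noteq> {}"
    and \<Phi>: "\<And>j. \<exists>\<Phi>. (\<forall>f\<in>B \<rightarrow>\<^sub>E (carrier Q \<rightarrow>\<^sub>E {0..<2 ^ j :: int}). derivation_mod G Q q (2 ^ j) (\<Phi> f)) \<and>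
      (\<forall>f\<in>B \<rightarrow>\<^sub>E (carrier Q \<rightarrow>\<^sub>E {0..<2 ^ j :: int}). \<forall>f'\<in>B \<rightarrow>\<^sub>E (carrier Q \<rightarrow>\<^sub>E {0..<2 ^ j :: int}).
         (\<forall>g\<in>carrier G. \<Phi> f g = \<Phi> f' g) \<longrightarrow> f = f')"
    and E: "finite E" "\<And>u v. (u, v) \<in> E \<Longrightarrow> set u \<subseteq> S \<and> set v \<subseteq> S \<and> word_val G u = word_val G v"
    and u0: "set u0 \<subseteq> S"
    and J: "J \<subseteq> S \<times> carrier Q"
      "\<And>x. x \<in> fox_solutions Q q S E u0 \<Longrightarrow> (\<And>i. i \<in> J \<Longrightarrow> x i = 0) \<Longrightarrow> x = (\<lambda>_. 0)"
  shows "(card B - 1) * card (carrier Q) \<le> card J"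
proof (rule ccontr)
  assume neg: "\<not> ?thesis"
  define I where "I = S \<times> carrier Q"
  define n where "n = card S"
  define \<kappa> where "\<kappa> = card (carrier Q)"
  define r where "r = card B"
  have finI: "finite I" and cardI: "card I = n * \<kappa>"
    using S finQ by (auto simp: I_def n_def \<kappa>_def card_cartesian_product)
  have finJ: "finite J" using J(1) finI finite_subset unfolding I_def by blast
  have r: "1 \<le> r" using B by (simp add: r_def Suc_le_eq card_gt_0_iff)
  obtain l where l: "\<And>u v. (u, v) \<in> E \<Longrightarrow> length u + length v \<le> l" "length u0 \<le> l"
  proof -
    let ?L = "insert (length u0) ((\<lambda>(u, v). length u + length v) ` E)"
    have "\<forall>k\<in>?L. k \<le> Max ?L" using E by auto
    then show thesis by (intro that[of "Max ?L"]) auto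
  qed
  \<comment> \<open>\<open>D\<close> exceeds the total length \<open>l\<close> of every equation, so
    an equation evaluated at entries below \<open>h\<close> in absolute value stays below
    \<open>m = D * h\<close>.\<close>
  define D :: nat where "D = 2 ^ l"
  have lD: "l < D" unfolding D_def by (rule power_gt_expt) simp
  \<comment> \<open>Chosen to give \<open>D ^ ((n + 1) * \<kappa>) < h\<close>: all powers of
    \<open>D\<close> lost in the final comparison are worth less than one factor
    \<open>h\<close>.\<close>
  define i where "i = l * ((n + 1) * \<kappa>) + 1"
  define h :: nat where "h = 2 ^ i"
  have hD: "D ^ ((n + 1) * \<kappa>) < h"
    unfolding h_def D_def i_def power_mult[symmetric] by simp
  define m :: nat where "m = D * h"
  have m2: "int m = 2 ^ (l + i)" by (simp add: m_def D_def h_def power_add)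
  have pos: "0 < h" "0 < D" "0 < m" by (auto simp: h_def D_def m_def)
  let ?F = "B \<rightarrow>\<^sub>E (carrier Q \<rightarrow>\<^sub>E {0..<int m})"
  obtain \<Phi> where der: "\<And>f. f \<in> ?F \<Longrightarrow> derivation_mod G Q q (int m) (\<Phi> f)"
    and inj: "\<And>f f'. f \<in> ?F \<Longrightarrow> f' \<in> ?F \<Longrightarrow> (\<And>g. g \<in> carrier G \<Longrightarrow> \<Phi> f g = \<Phi> f' g) \<Longrightarrow> f = f'"
    using \<Phi>[of "l + i"] unfolding m2 by metis
  have \<Phi>_range: "\<Phi> f g \<in> carrier Q \<rightarrow>\<^sub>E {0..<int m}" if "f \<in> ?F" "g \<in> carrier G" for f g
    using der that unfolding derivation_mod_def by blast
  let ?A = "(I \<rightarrow>\<^sub>E {0..<int h}) \<times> ?F"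
  let ?T = "(I \<rightarrow>\<^sub>E {0..<int m}) \<times> (carrier Q \<rightarrow>\<^sub>E {0..<int m})"
  \<comment> \<open>The second component records the value at \<open>u0\<close>. It costs the factor
    \<open>m ^ \<kappa>\<close> and accounts for the 1 in \<open>card B - 1\<close>.\<close>
  define \<tau> where "\<tau> = (\<lambda>(b, f). (\<lambda>i\<in>I. (b i + \<Phi> f (fst i) (snd i)) mod int m, \<Phi> f (word_val G u0)))"
  have u0G: "word_val G u0 \<in> carrier G" using u0 S G.word_val_closed by blast
  have \<tau>T: "\<tau> a \<in> ?T" if "a \<in> ?A" for a
    using that \<Phi>_range u0G pos by (auto simp: \<tau>_def)
  have fibre: "card {a \<in> ?A. \<tau> a = t} \<le> h ^ card J" for t
  proof -
    have "card {a \<in> ?A. \<tau> a = t} \<le> card (J \<rightarrow>\<^sub>E {0..<int h})"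
    proof (rule card_inj_on_le)
      show "(\<lambda>a. restrict (fst a) J) ` {a \<in> ?A. \<tau> a = t} \<subseteq> J \<rightarrow>\<^sub>E {0..<int h}"
        using J(1) by (fastforce simp: I_def)
      show "finite (J \<rightarrow>\<^sub>E {0..<int h})" using finJ by (intro finite_PiE) auto
      show "inj_on (\<lambda>a. restrict (fst a) J) {a \<in> ?A. \<tau> a = t}"
      proof (rule inj_onI)
        fix a a' assume a: "a \<in> {a \<in> ?A. \<tau> a = t}" "a' \<in> {a \<in> ?A. \<tau> a = t}"
          and eqJ: "restrict (fst a) J = restrict (fst a') J"
        obtain b f b' f' where ab: "a = (b, f)" "a' = (b', f')" by (cases a, cases a')
        have b: "b \<in> I \<rightarrow>\<^sub>E {0..<int h}" "b' \<in> I \<rightarrow>\<^sub>E {0..<int h}" and f: "f \<in> ?F" "f' \<in> ?F"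
          and \<tau>: "\<tau> (b, f) = \<tau> (b', f')" using a ab by auto
        define z where "z = (\<lambda>i. if i \<in> I then b i - b' i else 0)"
        have zb: "\<bar>z i\<bar> \<le> int h - 1" for i
        proof (cases "i \<in> I")
          case True
          then have "b i \<in> {0..<int h}" "b' i \<in> {0..<int h}" using b by auto
          then show ?thesis using True by (auto simp: z_def)
        qed (use pos in \<open>auto simp: z_def\<close>)
        have \<tau>1: "(b i + \<Phi> f (fst i) (snd i)) mod int m = (b' i + \<Phi> f' (fst i) (snd i)) mod int m" if "i \<in> I" for i
          using \<tau> that by (auto simp: \<tau>_def dest!: fun_cong[of _ _ i])
        have \<tau>2: "\<Phi> f (word_val G u0) = \<Phi> f' (word_val G u0)"
          using \<tau> by (simp add: \<tau>_def)
        have zmod: "z (s, y) mod int m = (\<Phi> f' s y - \<Phi> f s y) mod int m" if "s \<in> S" "y \<in> carrier Q" for s y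
          using \<tau>1[of "(s, y)"] that by (simp add: I_def z_def mod_eq_dvd_iff algebra_simps)
        have foxz: "fox q Q z u y mod int m = (\<Phi> f' (word_val G u) y - \<Phi> f (word_val G u) y) mod int m"
          if u: "set u \<subseteq> S" and y: "y \<in> carrier Q" for u y
        proof -
          have uG: "set u \<subseteq> carrier G" using u S by blast
          have "fox q Q z u y mod int m
              = fox q Q (\<lambda>i. (\<lambda>(s, y). \<Phi> f' s y) i - (\<lambda>(s, y). \<Phi> f s y) i) u y mod int m"
            by (rule fox_mod_cong) (use zmod u uG y in auto)
          also have "\<dots> = (fox q Q (\<lambda>(s, y). \<Phi> f' s y) u y mod int m - fox q Q (\<lambda>(s, y). \<Phi> f s y) u y mod int m) mod int m"
            unfolding fox_diff by (simp add: mod_simps)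
          finally show ?thesis using derivation_mod_fox[OF der uG y] f by simp
        qed
        have foxb: "\<bar>fox q Q z u y\<bar> \<le> int (length u) * (int h - 1)" if "set u \<subseteq> S" "y \<in> carrier Q" for u y
          using fox_bound[of u z "int h - 1" y] zb that S by blast
        \<comment> \<open>The passage from congruences modulo \<open>m\<close> to equations.\<close>
        have small: "x = 0" if "\<bar>x\<bar> \<le> int k * (int h - 1)" "k \<le> l" "int m dvd x" for x k
        proof (rule small_int_dvd[OF that(3)])
          have "\<bar>x\<bar> \<le> int l * (int h - 1)"
            using that pos by (meson diff_ge_0_iff_ge int_one_le_iff_zero_less mult_right_mono of_nat_0_less_iff of_nat_mono order_trans)
          also have "\<dots> \<le> int l * int h" by (simp add: mult_left_mono)
          also have "\<dots> < int m" using lD pos by (simp add: m_def)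
          finally show "\<bar>x\<bar> < int m" .
        qed
        have "(\<lambda>i. real_of_int (z i)) \<in> fox_solutions Q q S E u0"
          unfolding fox_solutions_def
        proof (intro CollectI conjI ballI allI impI)
          show "real_of_int (z i) = 0" if "i \<notin> S \<times> carrier Q" for i using that by (simp add: z_def I_def)
        next
          fix y assume y: "y \<in> carrier Q"
          have "int m dvd fox q Q z u0 y" using foxz[OF u0 y] \<tau>2 by (simp add: dvd_eq_mod_eq_0)
          then have "fox q Q z u0 y = 0" using small[OF foxb[OF u0 y] l(2)] by simp
          then show "fox q Q (\<lambda>i. real_of_int (z i)) u0 y = 0" by (simp add: fox_of_int)
        next
          fix e assume e: "e \<in> E"
          obtain u v where uv: "e = (u, v)" by (cases e)
          have E': "set u \<subseteq> S" "set v \<subseteq> S" "word_val G u = word_val G v" using E(2) e uv by auto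
          have "fox q Q z u y = fox q Q z v y" if y: "y \<in> carrier Q" for y
          proof -
            have "fox q Q z u y mod int m = fox q Q z v y mod int m"
              using foxz[OF E'(1) y] foxz[OF E'(2) y] E'(3) by simp
            then have "int m dvd fox q Q z u y - fox q Q z v y" by (simp add: mod_eq_dvd_iff)
            moreover have "\<bar>fox q Q z u y - fox q Q z v y\<bar> \<le> int (length u + length v) * (int h - 1)"
              using foxb[OF E'(1) y] foxb[OF E'(2) y] by (simp add: algebra_simps)
            ultimately show ?thesis using small l(1) e uv by (metis eq_iff_diff_eq_0)
          qed
          then show "case e of (u, v) \<Rightarrow> \<forall>y\<in>carrier Q. fox q Q (\<lambda>i. real_of_int (z i)) u y = fox q Q (\<lambda>i. real_of_int (z i)) v y"
            by (simp add: uv fox_of_int)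
        qed
        moreover have "real_of_int (z i) = 0" if "i \<in> J" for i
          using fun_cong[OF eqJ, of i] that by (simp add: ab z_def)
        ultimately have "(\<lambda>i. real_of_int (z i)) = (\<lambda>_. 0)" by (rule J(2))
        then have z0: "z i = 0" for i by (metis of_int_eq_0_iff)
        have bb: "b = b'"
        proof (rule PiE_ext[OF b])
          show "b i = b' i" if "i \<in> I" for i using z0[of i] that by (simp add: z_def)
        qed
        have "f = f'"
        proof (rule inj[OF f])
          fix g assume "g \<in> carrier G"
          then obtain u where u: "set u \<subseteq> S" "word_val G u = g" using S(3) by blast
          have g: "g \<in> carrier G" by fact
          show "\<Phi> f g = \<Phi> f' g"
          proof (rule PiE_ext[OF \<Phi>_range[OF f(1) g] \<Phi>_range[OF f(2) g]])
            fix y assume y: "y \<in> carrier Q"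
            have "(\<Phi> f' g y - \<Phi> f g y) mod int m = fox q Q z u y mod int m"
              using foxz[OF u(1) y] u(2) by simp
            moreover have "fox q Q z u y = 0" using foxb[OF u(1) y] z0
              fox_bound[of u z 0 y] u(1) S y by auto
            ultimately have dvd: "int m dvd \<Phi> f' g y - \<Phi> f g y" by (simp add: dvd_eq_mod_eq_0)
            have "\<Phi> f g y \<in> {0..<int m}" "\<Phi> f' g y \<in> {0..<int m}"
              using \<Phi>_range f g y by (meson PiE_mem)+
            then have "\<bar>\<Phi> f' g y - \<Phi> f g y\<bar> < int m" by auto
            then show "\<Phi> f g y = \<Phi> f' g y" using small_int_dvd[OF dvd] by simp
          qed
        qed
        then show "a = a'" using ab bb by simp
      qed
    qed
    also have "card (J \<rightarrow>\<^sub>E {0..<int h}) = h ^ card J" using finJ by (simp add: card_PiE)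
    finally show ?thesis .
  qed
  have finF: "finite ?F" using B finQ by (intro finite_PiE) auto
  have finA: "finite ?A" using B finQ finI by (intro finite_cartesian_product finite_PiE) auto
  have finT: "finite ?T" using finI finQ by (intro finite_cartesian_product finite_PiE) auto
  have A: "(\<Union>t\<in>?T. {a \<in> ?A. \<tau> a = t}) = ?A" using \<tau>T by blast
  have "card ?A \<le> (\<Sum>t\<in>?T. card {a \<in> ?A. \<tau> a = t})"
    using card_UN_le[OF finT, of "\<lambda>t. {a \<in> ?A. \<tau> a = t}"] unfolding A .
  also have "\<dots> \<le> (\<Sum>t\<in>?T. h ^ card J)" by (rule sum_mono) (rule fibre)
  also have "\<dots> = card ?T * h ^ card J" by simp
  finally have "h ^ (n * \<kappa>) * (m ^ \<kappa>) ^ r \<le> m ^ (n * \<kappa>) * m ^ \<kappa> * h ^ card J"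
    using B finI finQ cardI by (simp add: card_cartesian_product card_PiE \<kappa>_def[symmetric] r_def[symmetric])
  \<comment> \<open>After substituting \<open>m = D * h\<close> the exponents of \<open>h\<close>
    are to be compared, while the powers of \<open>D\<close> are error terms.\<close>
  then have ineq: "h ^ (n * \<kappa> + \<kappa> * r) * D ^ (\<kappa> * r) \<le> D ^ ((n + 1) * \<kappa>) * h ^ (n * \<kappa> + \<kappa> + card J)"
    by (simp add: m_def power_mult_distrib power_add algebra_simps flip: power_mult)
  have "card J < (r - 1) * \<kappa>" using neg by (simp add: r_def \<kappa>_def)
  then have a: "n * \<kappa> + \<kappa> + card J + 1 \<le> n * \<kappa> + \<kappa> * r"
    using r by (cases r) (auto simp: algebra_simps)
  have "h * h ^ (n * \<kappa> + \<kappa> + card J) = h ^ (n * \<kappa> + \<kappa> + card J + 1)" by simp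
  also have "\<dots> \<le> h ^ (n * \<kappa> + \<kappa> * r)" using a pos by (intro power_increasing) auto
  also have "\<dots> \<le> h ^ (n * \<kappa> + \<kappa> * r) * D ^ (\<kappa> * r)" using pos by simp
  also note ineq
  finally have "h \<le> D ^ ((n + 1) * \<kappa>)" using pos by simp
  then show False using hD by simp
qed

end

section \<open>Square-summable functions\<close>

typedef 'i ell2 = "{f :: 'i \<Rightarrow> real. (\<lambda>i. f i * f i) summable_on UNIV}"
  morphisms entry Abs_ell2
  by (rule exI[of _ "\<lambda>_. 0"]) simp

setup_lifting type_definition_ell2

lemma square_summable_product:
  fixes f g :: "'i \<Rightarrow> real"
  assumes "(\<lambda>i. f i * f i) summable_on UNIV" "(\<lambda>i. g i * g i) summable_on UNIV"
  shows "(\<lambda>i. f i * g i) summable_on UNIV"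
  by (rule iffD2[OF summable_on_iff_abs_summable_on_real], rule abs_summable_product)
     (use assms[THEN iffD1[OF summable_on_iff_abs_summable_on_real]] in auto)

lemma square_summable_add:
  fixes f g :: "'i \<Rightarrow> real"
  assumes "(\<lambda>i. f i * f i) summable_on UNIV" "(\<lambda>i. g i * g i) summable_on UNIV"
  shows "(\<lambda>i. (f i + g i) * (f i + g i)) summable_on UNIV"
proof -
  have "(\<lambda>i. f i * f i + g i * g i + 2 * (f i * g i)) summable_on UNIV"
    using square_summable_product[OF assms] assms
    by (intro summable_on_add summable_on_cmult_right) auto
  then show ?thesis by (simp add: algebra_simps)
qed

lemma square_summable_scale:
  fixes f :: "'i \<Rightarrow> real"
  assumes "(\<lambda>i. f i * f i) summable_on UNIV"
  shows "(\<lambda>i. (c * f i) * (c * f i)) summable_on UNIV"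
  using summable_on_cmult_right[OF assms, of "c * c"] by (simp add: ac_simps)

instantiation ell2 :: (type) real_vector
begin
lift_definition zero_ell2 :: "'a ell2" is "\<lambda>_. 0" by simp
lift_definition plus_ell2 :: "'a ell2 \<Rightarrow> 'a ell2 \<Rightarrow> 'a ell2" is "\<lambda>f g i. f i + g i"
  by (rule square_summable_add)
lift_definition uminus_ell2 :: "'a ell2 \<Rightarrow> 'a ell2" is "\<lambda>f i. - f i" by simp
lift_definition minus_ell2 :: "'a ell2 \<Rightarrow> 'a ell2 \<Rightarrow> 'a ell2" is "\<lambda>f g i. f i - g i"
  using square_summable_add[of _ "\<lambda>i. - _ i"] by simp
lift_definition scaleR_ell2 :: "real \<Rightarrow> 'a ell2 \<Rightarrow> 'a ell2" is "\<lambda>c f i. c * f i"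
  by (rule square_summable_scale)
instance by standard (transfer; simp add: fun_eq_iff algebra_simps)+
end

instantiation ell2 :: (type) real_inner
begin
lift_definition inner_ell2 :: "'a ell2 \<Rightarrow> 'a ell2 \<Rightarrow> real" is "\<lambda>f g. infsum (\<lambda>i. f i * g i) UNIV" .
definition norm_ell2 :: "'a ell2 \<Rightarrow> real" where "norm_ell2 x = sqrt (inner x x)"
definition dist_ell2 :: "'a ell2 \<Rightarrow> 'a ell2 \<Rightarrow> real" where "dist_ell2 x y = norm (x - y)"
definition sgn_ell2 :: "'a ell2 \<Rightarrow> 'a ell2" where "sgn_ell2 x = x /\<^sub>R norm x"
definition uniformity_ell2 :: "('a ell2 \<times> 'a ell2) filter" where
  "uniformity_ell2 = (INF e\<in>{0<..}. principal {(x, y). dist x y < e})"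
definition open_ell2 :: "'a ell2 set \<Rightarrow> bool" where
  "open_ell2 U \<longleftrightarrow> (\<forall>x\<in>U. \<forall>\<^sub>F (x', y) in uniformity. x' = x \<longrightarrow> y \<in> U)"
instance
proof
  fix x y z :: "'a ell2" and r :: real and U :: "'a ell2 set"
  show "dist x y = norm (x - y)" by (rule dist_ell2_def)
  show "sgn x = x /\<^sub>R norm x" by (rule sgn_ell2_def)
  show "uniformity = (INF e\<in>{0<..}. principal {(x :: 'a ell2, y). dist x y < e})"
    by (rule uniformity_ell2_def)
  show "open U \<longleftrightarrow> (\<forall>x\<in>U. \<forall>\<^sub>F (x', y) in uniformity. x' = x \<longrightarrow> y \<in> U)" by (rule open_ell2_def)
  show "inner x y = inner y x" by transfer (simp add: mult.commute)
  show "inner (x + y) z = inner x z + inner y z"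
    by transfer (simp add: distrib_right infsum_add square_summable_product)
  show "inner (r *\<^sub>R x) y = r * inner x y"
    by transfer (simp add: infsum_cmult_right' mult.assoc)
  show "0 \<le> inner x x" by transfer (simp add: infsum_nonneg)
  show "inner x x = 0 \<longleftrightarrow> x = 0"
  proof
    assume "inner x x = 0"
    then show "x = 0"
    proof transfer
      fix f :: "'a \<Rightarrow> real" assume f: "(\<lambda>i. f i * f i) summable_on UNIV" "infsum (\<lambda>i. f i * f i) UNIV = 0"
      have "f i * f i = 0" for i
        by (rule nonneg_infsum_le_0D[of "\<lambda>i. f i * f i" UNIV]) (use f in auto)
      then show "f = (\<lambda>_. 0)" by auto
    qed
  qed (transfer; simp)
  show "norm x = sqrt (inner x x)" by (rule norm_ell2_def)
qed
end

lemmas entry_simps [simp] = zero_ell2.rep_eq plus_ell2.rep_eq uminus_ell2.rep_eq minus_ell2.rep_eq scaleR_ell2.rep_eq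

lemma entry_sum [simp]: "entry (sum f A) i = (\<Sum>a\<in>A. entry (f a) i)"
  by (induction A rule: infinite_finite_induct) auto

lemma ell2_eqI: "(\<And>i. entry f i = entry g i) \<Longrightarrow> f = g"
  by (simp add: entry_inject[symmetric] fun_eq_iff)

lemma entry_square_summable: "(\<lambda>i. (entry f i)\<^sup>2) summable_on UNIV"
  using entry[of f] by (simp add: power2_eq_square)

lemma norm_ell2_square: "(norm f)\<^sup>2 = infsum (\<lambda>i. (entry f i)\<^sup>2) UNIV"
  unfolding power2_norm_eq_inner by (simp add: inner_ell2.rep_eq power2_eq_square)

lemma sum_entry_le_norm: "finite F \<Longrightarrow> (\<Sum>i\<in>F. (entry f i)\<^sup>2) \<le> (norm f)\<^sup>2"
  unfolding norm_ell2_square by (rule finite_sum_le_infsum[OF entry_square_summable]) auto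

lemma entry_le_norm: "\<bar>entry f i\<bar> \<le> norm f"
  using sum_entry_le_norm[of "{i}" f] abs_le_square_iff[of "entry f i" "norm f"] by simp

lemma norm_ell2_le:
  assumes "\<And>F. finite F \<Longrightarrow> (\<Sum>i\<in>F. (entry f i)\<^sup>2) \<le> C"
  shows "(norm f)\<^sup>2 \<le> C"
  unfolding norm_ell2_square by (rule infsum_le_finite_sums[OF entry_square_summable]) (use assms in auto)

lemma ell2_of_bounded:
  assumes "\<And>F. finite F \<Longrightarrow> (\<Sum>i\<in>F. (f i)\<^sup>2) \<le> (C :: real)"
  shows "\<exists>x. (\<forall>i. entry x i = f i) \<and> (norm x)\<^sup>2 \<le> C"
proof -
  have "(\<lambda>i. f i * f i) summable_on UNIV"
    by (rule nonneg_bdd_above_summable_on)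
       (use assms in \<open>auto intro!: bdd_aboveI[of _ C] simp: power2_eq_square\<close>)
  then have x: "entry (Abs_ell2 f) = f" by (simp add: Abs_ell2_inverse)
  then have "(norm (Abs_ell2 f))\<^sup>2 \<le> C" using assms by (intro norm_ell2_le) simp
  with x show ?thesis by (intro exI[of _ "Abs_ell2 f"]) simp
qed

lemma bounded_linear_entry: "bounded_linear (\<lambda>x. entry x i)"
  by (rule bounded_linear_intro[of _ 1]) (auto simp: entry_le_norm)

instance ell2 :: (type) complete_space
proof
  fix X :: "nat \<Rightarrow> 'a ell2" assume X: "Cauchy X"
  have "convergent (\<lambda>n. entry (X n) i)" for i
    using bounded_linear.Cauchy[OF bounded_linear_entry X] by (rule Cauchy_convergent)
  then obtain f where f: "\<And>i. (\<lambda>n. entry (X n) i) \<longlonglongrightarrow> f i" unfolding convergent_def by metis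
  obtain C where C: "\<And>n. norm (X n) \<le> C" using Cauchy_Bseq[OF X] unfolding Bseq_def by blast
  have "(\<Sum>i\<in>F. (f i)\<^sup>2) \<le> C\<^sup>2" if "finite F" for F
  proof (rule LIMSEQ_le_const2)
    show "(\<lambda>n. \<Sum>i\<in>F. (entry (X n) i)\<^sup>2) \<longlonglongrightarrow> (\<Sum>i\<in>F. (f i)\<^sup>2)"
      using f by (intro tendsto_sum tendsto_power)
    have "(\<Sum>i\<in>F. (entry (X n) i)\<^sup>2) \<le> C\<^sup>2" for n
      using sum_entry_le_norm[OF that, of "X n"] power_mono[OF C norm_ge_zero, of n 2] by linarith
    then show "\<exists>N. \<forall>n\<ge>N. (\<Sum>i\<in>F. (entry (X n) i)\<^sup>2) \<le> C\<^sup>2" by blast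
  qed
  then obtain x where x: "\<And>i. entry x i = f i" using ell2_of_bounded[of f "C\<^sup>2"] by blast
  have "X \<longlonglongrightarrow> x"
  proof (rule metric_LIMSEQ_I)
    fix e :: real assume "e > 0"
    then obtain M where M: "\<And>m n. m \<ge> M \<Longrightarrow> n \<ge> M \<Longrightarrow> norm (X m - X n) < e / 2"
      using X unfolding Cauchy_def dist_norm by (meson half_gt_zero)
    have "norm (X n - x) < e" if n: "n \<ge> M" for n
    proof -
      have "(norm (X n - x))\<^sup>2 \<le> (e / 2)\<^sup>2"
      proof (rule norm_ell2_le)
        fix F :: "'a set" assume F: "finite F"
        show "(\<Sum>i\<in>F. (entry (X n - x) i)\<^sup>2) \<le> (e / 2)\<^sup>2"
        proof (rule LIMSEQ_le_const2)
          show "(\<lambda>m. \<Sum>i\<in>F. (entry (X n - X m) i)\<^sup>2) \<longlonglongrightarrow> (\<Sum>i\<in>F. (entry (X n - x) i)\<^sup>2)"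
            using f by (auto intro!: tendsto_sum tendsto_power tendsto_diff simp: x)
          show "\<exists>N. \<forall>m\<ge>N. (\<Sum>i\<in>F. (entry (X n - X m) i)\<^sup>2) \<le> (e / 2)\<^sup>2"
          proof (intro exI[of _ M] allI impI)
            fix m assume "m \<ge> M"
            have "(\<Sum>i\<in>F. (entry (X n - X m) i)\<^sup>2) \<le> (norm (X n - X m))\<^sup>2" by (rule sum_entry_le_norm[OF F])
            also have "\<dots> \<le> (e / 2)\<^sup>2" using M[OF n \<open>m \<ge> M\<close>] by (intro power_mono) auto
            finally show "(\<Sum>i\<in>F. (entry (X n - X m) i)\<^sup>2) \<le> (e / 2)\<^sup>2" .
          qed
        qed
      qed
      then have "norm (X n - x) \<le> e / 2" by (rule power2_le_imp_le) (use \<open>e > 0\<close> in simp)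
      then show ?thesis using \<open>e > 0\<close> by simp
    qed
    then show "\<exists>M. \<forall>n\<ge>M. dist (X n) x < e" by (auto simp: dist_norm)
  qed
  then show "convergent X" by (auto simp: convergent_def)
qed

lift_definition ket :: "'i \<Rightarrow> 'i ell2" is "\<lambda>i j. if j = i then 1 else 0"
proof -
  fix i :: 'i
  have "(\<lambda>j. (if j = i then 1 else 0) * (if j = i then 1 else 0 :: real)) summable_on {i}" by simp
  then show "(\<lambda>j. (if j = i then 1 else 0) * (if j = i then 1 else 0 :: real)) summable_on UNIV"
    by (rule summable_on_cong_neutral[THEN iffD1, rotated -1]) auto
qed

lemma entry_ket [simp]: "entry (ket i) j = (if j = i then 1 else 0)"
  by (simp add: ket.rep_eq)

lemma inner_ket: "inner (ket i) f = entry f i"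
proof -
  have "infsum (\<lambda>j. entry (ket i) j * entry f j) UNIV = infsum (\<lambda>j. entry (ket i) j * entry f j) {i}"
    by (rule infsum_cong_neutral) auto
  then show ?thesis by (simp add: inner_ell2.rep_eq)
qed

lemma norm_ket [simp]: "norm (ket i) = 1"
  by (simp add: norm_eq_sqrt_inner inner_ket)

lemma norm_finite_combination:
  assumes "finite F"
  shows "(norm (\<Sum>i\<in>F. c i *\<^sub>R ket i))\<^sup>2 = (\<Sum>i\<in>F. (c i)\<^sup>2)"
proof -
  have "inner (ket i) (\<Sum>i\<in>F. c i *\<^sub>R ket i) = c i" if "i \<in> F" for i
    using that assms by (simp add: inner_ket if_distrib[of "\<lambda>x. _ * x"] cong: if_cong)
  then show ?thesis
    unfolding power2_norm_eq_inner
    by (subst inner_sum_left, intro sum.cong) (simp_all add: power2_eq_square)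
qed

lemma ell2_approx:
  assumes "e > 0"
  obtains F where "finite F" "norm (f - (\<Sum>i\<in>F. entry f i *\<^sub>R ket i)) < e"
proof -
  have "((\<lambda>i. (entry f i)\<^sup>2) has_sum (norm f)\<^sup>2) UNIV"
    unfolding norm_ell2_square by (rule has_sum_infsum[OF entry_square_summable])
  then have "(sum (\<lambda>i. (entry f i)\<^sup>2) \<longlongrightarrow> (norm f)\<^sup>2) (finite_subsets_at_top UNIV)"
    by (simp add: has_sum_def)
  then have "\<forall>\<^sub>F F in finite_subsets_at_top UNIV. dist (\<Sum>i\<in>F. (entry f i)\<^sup>2) ((norm f)\<^sup>2) < e\<^sup>2"
    using assms by (intro tendstoD) auto
  then obtain F where F: "finite F" "dist (\<Sum>i\<in>F. (entry f i)\<^sup>2) ((norm f)\<^sup>2) < e\<^sup>2"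
    by (auto simp: eventually_finite_subsets_at_top)
  let ?s = "\<Sum>i\<in>F. entry f i *\<^sub>R ket i"
  have "inner f ?s = (\<Sum>i\<in>F. (entry f i)\<^sup>2)"
    by (simp add: inner_sum_right inner_ket inner_commute[of f] power2_eq_square)
  then have "(norm (f - ?s))\<^sup>2 = (norm f)\<^sup>2 - (\<Sum>i\<in>F. (entry f i)\<^sup>2)"
    using norm_finite_combination[OF F(1), of "entry f"]
    by (simp add: power2_norm_eq_inner inner_diff_left inner_diff_right inner_commute)
  also have "\<dots> < e\<^sup>2" using F(2) by (simp add: dist_real_def)
  finally have "norm (f - ?s) < e" using assms by (simp add: power_less_imp_less_base)
  then show thesis using F(1) that by blast
qed

lemma bounded_linear_zero_on_kets:
  fixes T :: "'i ell2 \<Rightarrow> 'b::real_normed_vector"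
  assumes T: "bounded_linear T" and zero: "\<And>i. T (ket i) = 0"
  shows "T f = 0"
proof -
  interpret T: bounded_linear T by (rule T)
  obtain K where K: "\<And>x. norm (T x) \<le> norm x * K" "0 < K" using T.pos_bounded by blast
  have "norm (T f) \<le> 0 + e" if "e > 0" for e
  proof -
    have "0 < e / K" using that K by simp
    then obtain F where F: "finite F" "norm (f - (\<Sum>i\<in>F. entry f i *\<^sub>R ket i)) < e / K"
      by (rule ell2_approx)
    have "T (f - (\<Sum>i\<in>F. entry f i *\<^sub>R ket i)) = T f" by (simp add: T.diff T.sum T.scaleR zero)
    then have "norm (T f) \<le> norm (f - (\<Sum>i\<in>F. entry f i *\<^sub>R ket i)) * K" using K(1) by metis
    also have "\<dots> \<le> e / K * K" using F K by (intro mult_right_mono) auto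
    finally show ?thesis using K by simp
  qed
  then have "norm (T f) \<le> 0" by (rule field_le_epsilon)
  then show ?thesis by simp
qed

text \<open>The rows lie in \<open>ell2\<close>, so the entries of \<open>T c\<close> make sense for
  every \<open>c\<close>; the bound passes from finite combinations to all \<open>c\<close> by
  density. Its form on finite sections fits the last clause of
  \<open>cocycle_conditions\<close>.\<close>

lemma matrix_operator:
  fixes k :: "'j \<Rightarrow> 'i ell2"
  assumes C: "C \<ge> 0"
    and bound: "\<And>F A c. finite F \<Longrightarrow> finite A \<Longrightarrow>
      (\<Sum>j\<in>F. (\<Sum>i\<in>A. c i * entry (k j) i)\<^sup>2) \<le> C\<^sup>2 * (\<Sum>i\<in>A. (c i)\<^sup>2)"
  obtains T where "bounded_linear T" "\<And>c j. entry (T c) j = inner (k j) c" "\<And>c. norm (T c) \<le> C * norm c"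
proof -
  have sq: "(\<Sum>j\<in>F. (inner (k j) c)\<^sup>2) \<le> C\<^sup>2 * (norm c)\<^sup>2" if F: "finite F" for F c
  proof -
    have "bounded_linear (\<lambda>x. inner (k j) x)" for j by (rule bounded_linear_inner_right)
    have cont: "continuous_on UNIV (\<lambda>x. C\<^sup>2 * (norm x)\<^sup>2 - (\<Sum>j\<in>F. (inner (k j) x)\<^sup>2))"
      by (intro continuous_intros)
    obtain s where s: "s \<longlonglongrightarrow> c" and sF: "\<And>n. \<exists>A. finite A \<and> s n = (\<Sum>i\<in>A. entry c i *\<^sub>R ket i)"
    proof -
      have "\<exists>A. finite A \<and> norm (c - (\<Sum>i\<in>A. entry c i *\<^sub>R ket i)) < 1 / real (Suc n)" for n
        using ell2_approx[of "1 / real (Suc n)" c] by (metis of_nat_0_less_iff zero_less_Suc zero_less_divide_1_iff)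
      then obtain A where A: "\<And>n. finite (A n)" "\<And>n. norm (c - (\<Sum>i\<in>A n. entry c i *\<^sub>R ket i)) < 1 / real (Suc n)"
        by metis
      have "(\<lambda>n. (\<Sum>i\<in>A n. entry c i *\<^sub>R ket i)) \<longlonglongrightarrow> c"
      proof (rule metric_LIMSEQ_I)
        fix e :: real assume "e > 0"
        then obtain N where N: "1 / real (Suc N) < e" using nat_approx_posE by blast
        have "dist (\<Sum>i\<in>A n. entry c i *\<^sub>R ket i) c < e" if "n \<ge> N" for n
        proof -
          have "1 / real (Suc n) \<le> 1 / real (Suc N)" using that by (simp add: frac_le)
          then show ?thesis using A(2)[of n] N by (simp add: dist_norm norm_minus_commute)
        qed
        then show "\<exists>N. \<forall>n\<ge>N. dist (\<Sum>i\<in>A n. entry c i *\<^sub>R ket i) c < e" by blast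
      qed
      then show thesis using that A(1) by blast
    qed
    have "0 \<le> C\<^sup>2 * (norm (s n))\<^sup>2 - (\<Sum>j\<in>F. (inner (k j) (s n))\<^sup>2)" for n
    proof -
      obtain A where A: "finite A" "s n = (\<Sum>i\<in>A. entry c i *\<^sub>R ket i)" using sF by blast
      have "inner (k j) (s n) = (\<Sum>i\<in>A. entry c i * entry (k j) i)" for j
        by (simp add: A(2) inner_sum_right inner_ket inner_commute[of "k j"])
      then show ?thesis
        using bound[OF F A(1), of "entry c"] norm_finite_combination[OF A(1), of "entry c"] A(2) by simp
    qed
    moreover have "(\<lambda>n. C\<^sup>2 * (norm (s n))\<^sup>2 - (\<Sum>j\<in>F. (inner (k j) (s n))\<^sup>2)) \<longlonglongrightarrow>
        C\<^sup>2 * (norm c)\<^sup>2 - (\<Sum>j\<in>F. (inner (k j) c)\<^sup>2)"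
      using s by (intro tendsto_intros)
    ultimately have "0 \<le> C\<^sup>2 * (norm c)\<^sup>2 - (\<Sum>j\<in>F. (inner (k j) c)\<^sup>2)"
      by (intro LIMSEQ_le_const) auto
    then show ?thesis by simp
  qed
  have "\<exists>y. (\<forall>j. entry y j = inner (k j) c) \<and> (norm y)\<^sup>2 \<le> C\<^sup>2 * (norm c)\<^sup>2" for c
    by (rule ell2_of_bounded[OF sq])
  then obtain T where T: "\<And>c j. entry (T c) j = inner (k j) c" "\<And>c. (norm (T c))\<^sup>2 \<le> C\<^sup>2 * (norm c)\<^sup>2"
    by metis
  have norm: "norm (T c) \<le> C * norm c" for c
    by (rule power2_le_imp_le) (use T(2)[of c] C in \<open>auto simp: power_mult_distrib\<close>)
  have "bounded_linear T"
    by (rule bounded_linear_intro[of _ C])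
       (auto intro!: ell2_eqI simp: T(1) inner_add_right norm mult.commute)
  then show thesis using T(1) norm by (rule that)
qed

text \<open>The entries of \<open>T' y\<close> are forced. Their square-summability follows by
  testing \<open>T\<close> on the finite combination that has these very entries as coefficients,
  and cancelling its norm.\<close>

lemma adjoint_exists:
  fixes T :: "'i ell2 \<Rightarrow> 'j ell2"
  assumes T: "bounded_linear T" and C: "C \<ge> 0" "\<And>x. norm (T x) \<le> C * norm x"
  obtains T' where "bounded_linear T'" "\<And>x y. inner (T x) y = inner x (T' y)" "\<And>y. norm (T' y) \<le> C * norm y"
proof -
  interpret T: bounded_linear T by (rule T)
  have "\<exists>z. (\<forall>i. entry z i = inner (T (ket i)) y) \<and> (norm z)\<^sup>2 \<le> (C * norm y)\<^sup>2" for y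
  proof -
    have "(\<Sum>i\<in>F. (inner (T (ket i)) y)\<^sup>2) \<le> (C * norm y)\<^sup>2" if F: "finite F" for F
    proof -
      define s where "s = (\<Sum>i\<in>F. (inner (T (ket i)) y)\<^sup>2)"
      let ?c = "\<Sum>i\<in>F. inner (T (ket i)) y *\<^sub>R ket i"
      have s0: "0 \<le> s" unfolding s_def by (rule sum_nonneg) simp
      have nc: "norm ?c = sqrt s"
        by (rule real_sqrt_unique[symmetric]) (simp_all only: norm_finite_combination[OF F] s_def norm_ge_zero)
      have "s = inner (T ?c) y" by (simp add: s_def T.sum T.scaleR inner_sum_left power2_eq_square)
      also have "\<dots> \<le> norm (T ?c) * norm y" by (rule norm_cauchy_schwarz)
      also have "\<dots> \<le> C * norm ?c * norm y" using C(2) by (intro mult_right_mono) auto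
      finally have le: "sqrt s * sqrt s \<le> sqrt s * (C * norm y)" using s0 by (simp add: nc ac_simps)
      have "sqrt s \<le> C * norm y"
      proof (cases "s = 0")
        case True
        then show ?thesis using C(1) by simp
      next
        case False
        then have "0 < sqrt s" using s0 by simp
        then show ?thesis using mult_left_le_imp_le[OF le] by simp
      qed
      then show ?thesis using s0 unfolding s_def[symmetric] by (simp add: sqrt_le_D)
    qed
    then show ?thesis by (rule ell2_of_bounded)
  qed
  then obtain T' where T': "\<And>y i. entry (T' y) i = inner (T (ket i)) y" "\<And>y. (norm (T' y))\<^sup>2 \<le> (C * norm y)\<^sup>2"
    by metis
  have norm: "norm (T' y) \<le> C * norm y" for y
    by (rule power2_le_imp_le[OF T'(2)]) (use C(1) in simp)
  have lin: "bounded_linear T'"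
    by (rule bounded_linear_intro[of _ C]) (auto intro!: ell2_eqI simp: T'(1) inner_add_right norm mult.commute)
  have "inner (T x) y = inner x (T' y)" for x y
  proof -
    have "bounded_linear (\<lambda>x. inner (T x) y - inner x (T' y))"
      by (intro bounded_linear_sub bounded_linear_inner_left_comp T bounded_linear_inner_left)
    from bounded_linear_zero_on_kets[OF this, of x] show ?thesis by (simp add: inner_ket T'(1))
  qed
  then show thesis using that lin norm by blast
qed

definition ell2_permute :: "('i \<Rightarrow> 'i) \<Rightarrow> 'i ell2 \<Rightarrow> 'i ell2" where
  "ell2_permute \<pi> f = Abs_ell2 (\<lambda>i. entry f (\<pi> i))"

context
  fixes \<pi> :: "'i \<Rightarrow> 'i"
  assumes bij: "bij \<pi>"
begin

lemma entry_permute [simp]: "entry (ell2_permute \<pi> f) i = entry f (\<pi> i)"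
proof -
  have "(\<lambda>i. entry f (\<pi> i) * entry f (\<pi> i)) summable_on UNIV"
    using entry[of f] summable_on_reindex_bij_betw[OF bij, of "\<lambda>i. entry f i * entry f i"] by simp
  then show ?thesis by (simp add: ell2_permute_def Abs_ell2_inverse)
qed

lemma inner_permute: "inner (ell2_permute \<pi> f) (ell2_permute \<pi> g) = inner f g"
  using infsum_reindex_bij_betw[OF bij, of "\<lambda>i. entry f i * entry g i"] by (simp add: inner_ell2.rep_eq)

lemma norm_permute: "norm (ell2_permute \<pi> f) = norm f"
  by (simp only: norm_eq_sqrt_inner inner_permute)

lemma permute_diff: "ell2_permute \<pi> (f - g) = ell2_permute \<pi> f - ell2_permute \<pi> g"
  by (rule ell2_eqI) simp

lemma permute_ket: "ell2_permute \<pi> (ket (\<pi> i)) = ket i"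
  using bij by (intro ell2_eqI) (auto simp: bij_def inj_def)

end

section \<open>Projections onto finite-dimensional spaces\<close>

definition orthonormal :: "'v::real_inner set \<Rightarrow> bool" where
  "orthonormal U \<longleftrightarrow> (\<forall>u\<in>U. \<forall>v\<in>U. inner u v = (if u = v then 1 else 0))"

definition proj :: "'v::real_inner set \<Rightarrow> 'v \<Rightarrow> 'v" where
  "proj U x = (\<Sum>u\<in>U. inner u x *\<^sub>R u)"

lemma inner_proj:
  assumes "finite U" "orthonormal U" "u \<in> U"
  shows "inner u (proj U x) = inner u x"
proof -
  have "inner u (proj U x) = (\<Sum>v\<in>U. if v = u then inner u x else 0)"
    unfolding proj_def inner_sum_right
    using assms by (intro sum.cong) (auto simp: orthonormal_def)
  then show ?thesis using assms by simp
qed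

lemma inner_proj_square:
  assumes "finite U" "orthonormal U"
  shows "inner x (proj U x) = (\<Sum>u\<in>U. (inner u x)\<^sup>2)" "(norm (proj U x))\<^sup>2 = (\<Sum>u\<in>U. (inner u x)\<^sup>2)"
proof -
  show "inner x (proj U x) = (\<Sum>u\<in>U. (inner u x)\<^sup>2)"
    by (simp add: proj_def inner_sum_right inner_commute[of x] power2_eq_square)
  have "inner (proj U x) (proj U x) = (\<Sum>u\<in>U. inner u x * inner u (proj U x))"
    by (subst (1) proj_def) (simp add: inner_sum_left)
  also have "\<dots> = (\<Sum>u\<in>U. (inner u x)\<^sup>2)"
    using assms by (intro sum.cong) (auto simp: inner_proj power2_eq_square)
  finally show "(norm (proj U x))\<^sup>2 = (\<Sum>u\<in>U. (inner u x)\<^sup>2)" by (simp add: power2_norm_eq_inner)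
qed

lemma norm_proj_le:
  assumes "finite U" "orthonormal U"
  shows "(norm (proj U x))\<^sup>2 \<le> (norm x)\<^sup>2"
proof -
  have "0 \<le> inner (x - proj U x) (x - proj U x)" by simp
  also have "\<dots> = (norm x)\<^sup>2 - (norm (proj U x))\<^sup>2"
    using inner_proj_square[OF assms, of x]
    by (simp add: inner_diff_left inner_diff_right inner_commute[of "proj U x" x] power2_norm_eq_inner)
  finally show ?thesis by simp
qed

text \<open>The trace of a projection is its rank: both sides are the sum of the squares of all
  entries of the members of \<open>U\<close>.\<close>

lemma orthonormal_card_le:
  fixes U :: "'i ell2 set"
  assumes U: "finite U" "orthonormal U" and I: "finite I" "\<And>u i. u \<in> U \<Longrightarrow> i \<notin> I \<Longrightarrow> entry u i = 0"
  shows "real (card U) = (\<Sum>i\<in>I. (norm (proj U (ket i)))\<^sup>2)"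
proof -
  have "(\<Sum>i\<in>I. (entry u i)\<^sup>2) = 1" if "u \<in> U" for u
  proof -
    have "inner u u = infsum (\<lambda>i. entry u i * entry u i) UNIV" by (simp add: inner_ell2.rep_eq)
    also have "\<dots> = infsum (\<lambda>i. entry u i * entry u i) I"
      using I that by (intro infsum_cong_neutral) auto
    finally show ?thesis using I that U(2) by (simp add: orthonormal_def power2_eq_square)
  qed
  then have "real (card U) = (\<Sum>u\<in>U. \<Sum>i\<in>I. (entry u i)\<^sup>2)" by simp
  also have "\<dots> = (\<Sum>i\<in>I. \<Sum>u\<in>U. (entry u i)\<^sup>2)" by (rule sum.swap)
  finally show ?thesis
    by (simp add: inner_proj_square[OF U] inner_commute[of _ "ket _"] inner_ket)
qed

text \<open>An orthonormal system in \<open>W\<close> of greatest size spans \<open>W\<close>, by a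
  Gram-Schmidt step. To bound its size from below, take a smallest set \<open>J\<close> of
  coordinates that determines \<open>W\<close>: for each \<open>j\<close> in it some vector of
  \<open>W\<close> vanishes on the rest of \<open>J\<close> but not at \<open>j\<close>, and these
  vectors are independent.\<close>

lemma orthonormal_basis_exists:
  fixes W :: "'i ell2 set"
  assumes W: "subspace W" and I: "finite I" "\<And>x i. x \<in> W \<Longrightarrow> i \<notin> I \<Longrightarrow> entry x i = 0"
    and k: "\<And>J. J \<subseteq> I \<Longrightarrow> (\<And>x. x \<in> W \<Longrightarrow> (\<And>i. i \<in> J \<Longrightarrow> entry x i = 0) \<Longrightarrow> x = 0) \<Longrightarrow> k \<le> card J"
  obtains U where "finite U" "orthonormal U" "U \<subseteq> W" "k \<le> card U" "\<forall>x\<in>W. proj U x = x"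
proof -
  define P where "P n \<longleftrightarrow> (\<exists>U. finite U \<and> orthonormal U \<and> U \<subseteq> W \<and> card U = n)" for n
  have bound: "n \<le> card I" if "P n" for n
  proof -
    from that obtain U where U: "finite U" "orthonormal U" "U \<subseteq> W" "card U = n"
      unfolding P_def by blast
    have "real (card U) = (\<Sum>i\<in>I. (norm (proj U (ket i)))\<^sup>2)"
      using U I by (intro orthonormal_card_le) auto
    also have "\<dots> \<le> (\<Sum>i\<in>I. 1)"
      using norm_proj_le[OF U(1,2)] by (intro sum_mono) (metis norm_ket one_power2)
    finally show ?thesis using U by simp
  qed
  have "P 0" unfolding P_def by (intro exI[of _ "{}"]) (simp add: orthonormal_def)
  define n where "n = Greatest P"
  have n: "P n" "\<And>n'. P n' \<Longrightarrow> n' \<le> n"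
    unfolding n_def using GreatestI_nat[of P, OF \<open>P 0\<close>] Greatest_le_nat[of P] bound by blast+
  from n(1) obtain U where U: "finite U" "orthonormal U" "U \<subseteq> W" "card U = n"
    unfolding P_def by blast
  have projW: "proj U x \<in> W" for x
    unfolding proj_def using U W by (intro subspace_sum subspace_scale) auto
  have full: "proj U x = x" if x: "x \<in> W" for x
  proof (rule ccontr)
    assume neq: "proj U x \<noteq> x"
    define v where "v = x - proj U x"
    have v: "v \<in> W" "v \<noteq> 0" using W x projW neq by (auto simp: v_def subspace_diff)
    have uv: "inner u v = 0" if "u \<in> U" for u
      using inner_proj[OF U(1,2) that] by (simp add: v_def inner_diff_right)
    define e where "e = v /\<^sub>R norm v"
    have e: "e \<in> W" "inner e e = 1" using v W by (auto simp: e_def subspace_scale dot_square_norm power2_eq_square)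
    have ue: "inner u e = 0" if "u \<in> U" for u using uv that by (simp add: e_def)
    have "e \<notin> U" using ue[of e] e by auto
    have "orthonormal (insert e U)"
      using U(2) e ue unfolding orthonormal_def by (auto simp: inner_commute)
    then have "P (Suc n)"
      unfolding P_def using U e \<open>e \<notin> U\<close> by (intro exI[of _ "insert e U"]) auto
    then show False using n(2) by fastforce
  qed
  define det where "det J \<longleftrightarrow> J \<subseteq> I \<and> (\<forall>x\<in>W. (\<forall>i\<in>J. entry x i = 0) \<longrightarrow> x = 0)" for J
  have "det I" unfolding det_def using I by (auto intro!: ell2_eqI)
  define J where "J = arg_min card det"
  have J: "det J" and min: "\<And>J'. det J' \<Longrightarrow> card J \<le> card J'"
    unfolding J_def using arg_min_nat_lemma[of det I card, OF \<open>det I\<close>] by blast+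
  have finJ: "finite J" using J I finite_subset unfolding det_def by blast
  have "\<exists>x\<in>W. entry x j \<noteq> 0 \<and> (\<forall>i\<in>J - {j}. entry x i = 0)" if j: "j \<in> J" for j
  proof -
    have "card (J - {j}) < card J" using j finJ by (intro psubset_card_mono) auto
    then have "\<not> det (J - {j})" using min[of "J - {j}"] by linarith
    then obtain x where "x \<in> W" "\<forall>i\<in>J - {j}. entry x i = 0" "x \<noteq> 0"
      using J unfolding det_def by blast
    then show ?thesis using J unfolding det_def by blast
  qed
  then obtain w where w: "\<And>j. j \<in> J \<Longrightarrow> w j \<in> W" "\<And>j. j \<in> J \<Longrightarrow> entry (w j) j \<noteq> 0"
    "\<And>j i. j \<in> J \<Longrightarrow> i \<in> J \<Longrightarrow> i \<noteq> j \<Longrightarrow> entry (w j) i = 0"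
    by (metis DiffI singletonD)
  have injw: "inj_on w J" using w by (metis inj_onI)
  have ind: "independent (w ` J)"
    unfolding independent_explicit_finite_subsets
  proof (intro allI impI ballI)
    fix A c a assume A: "A \<subseteq> w ` J" "finite A" "(\<Sum>v\<in>A. c v *\<^sub>R v) = 0" "a \<in> A"
    then obtain j where j: "j \<in> J" "a = w j" by blast
    have "0 = entry (\<Sum>v\<in>A. c v *\<^sub>R v) j" using A by simp
    also have "\<dots> = (\<Sum>v\<in>A. c v * entry v j)" by simp
    also have "\<dots> = (\<Sum>v\<in>A. if v = a then c a * entry a j else 0)"
      using A j w(3) by (intro sum.cong) auto
    also have "\<dots> = c a * entry a j" using A by simp
    finally show "c a = 0" using w(2)[OF j(1)] j by simp
  qed
  have "w ` J \<subseteq> span U"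
  proof
    fix x assume "x \<in> w ` J"
    then have "proj U x = x" using w full by blast
    moreover have "proj U x \<in> span U"
      unfolding proj_def by (intro span_sum span_scale span_base)
    ultimately show "x \<in> span U" by simp
  qed
  then have "card (w ` J) \<le> card U" using independent_span_bound[OF U(1) ind] by blast
  moreover have "k \<le> card J" using J by (intro k) (auto simp: det_def)
  ultimately have "k \<le> card U" using injw by (simp add: card_image)
  then show thesis using that U full by blast
qed

text \<open>An isometry that maps \<open>W\<close> onto itself respects orthogonality to
  \<open>W\<close>, so the difference of the two sides is a vector of \<open>W\<close> orthogonal to
  itself.\<close>

lemma proj_commute:
  fixes W :: "'v::real_inner set"
  assumes U: "finite U" "orthonormal U" "U \<subseteq> W" "\<And>x. x \<in> W \<Longrightarrow> proj U x = x" and W: "subspace W"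
    and T: "\<And>x y. T (x - y) = T x - T y" "\<And>x y. inner (T x) (T y) = inner x y"
    and TW: "\<And>x. x \<in> W \<Longrightarrow> T x \<in> W" "\<And>x. x \<in> W \<Longrightarrow> \<exists>y\<in>W. T y = x"
  shows "proj U (T x) = T (proj U x)"
proof -
  have projW: "proj U x \<in> W" for x
    unfolding proj_def using U W by (intro subspace_sum subspace_scale) auto
  have perp: "inner w (x - proj U x) = 0" if "w \<in> W" for w x
  proof -
    have "inner (proj U w) (x - proj U x) = (\<Sum>u\<in>U. inner u w * inner u (x - proj U x))"
      by (simp add: proj_def inner_sum_left)
    also have "\<dots> = 0" using inner_proj[OF U(1,2)] by (simp add: inner_diff_right)
    finally show ?thesis using U(4)[OF that] by simp
  qed
  define d where "d = proj U (T x) - T (proj U x)"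
  have d: "d \<in> W" unfolding d_def using W projW TW(1) by (intro subspace_diff) auto
  obtain y where y: "y \<in> W" "T y = d" using TW(2)[OF d] by blast
  have "inner d (T x - proj U (T x)) = 0" using perp d by blast
  moreover have "inner d (T x - T (proj U x)) = 0"
    using perp[OF y(1), of x] T by (metis y(2))
  ultimately have "inner d d = 0" by (simp add: d_def inner_diff_right)
  then show ?thesis by (simp add: d_def)
qed

section \<open>Real solution spaces over a finite quotient\<close>

lemma fox_add: "fox q Q (\<lambda>i. x i + x' i) u y = fox q Q x u y + fox q Q x' u y"
  by (induction u arbitrary: y) (auto simp: algebra_simps)

lemma fox_scale: "fox q Q (\<lambda>i. c * x i) u y = c * (fox q Q x u y :: real)"
  by (induction u arbitrary: y) (auto simp: algebra_simps)

lemma mem_fox_solutions: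
  "x \<in> fox_solutions Q q S E u0 \<longleftrightarrow> (\<forall>i. i \<notin> S \<times> carrier Q \<longrightarrow> x i = 0) \<and>
     (\<forall>u v y. (u, v) \<in> E \<longrightarrow> y \<in> carrier Q \<longrightarrow> fox q Q x u y = fox q Q x v y) \<and>
     (\<forall>y. y \<in> carrier Q \<longrightarrow> fox q Q x u0 y = 0)"
  unfolding fox_solutions_def by fast

lemma fox_solutions_add:
  assumes "x \<in> fox_solutions Q q S E u0" "x' \<in> fox_solutions Q q S E u0"
  shows "(\<lambda>i. x i + x' i) \<in> fox_solutions Q q S E u0"
  unfolding mem_fox_solutions fox_add
proof (intro conjI allI impI)
  fix u v y assume "(u, v) \<in> E" "y \<in> carrier Q"
  then have "fox q Q x u y = fox q Q x v y" "fox q Q x' u y = fox q Q x' v y"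
    using assms unfolding mem_fox_solutions by blast+
  then show "fox q Q x u y + fox q Q x' u y = fox q Q x v y + fox q Q x' v y" by simp
next
  fix i assume "i \<notin> S \<times> carrier Q"
  then have "x i = 0" "x' i = 0" using assms unfolding mem_fox_solutions by blast+
  then show "x i + x' i = 0" by simp
qed (use assms in \<open>simp_all add: fox_solutions_def\<close>)

lemma fox_solutions_scale:
  assumes "x \<in> fox_solutions Q q S E u0"
  shows "(\<lambda>i. c * x i) \<in> fox_solutions Q q S E u0"
  unfolding mem_fox_solutions fox_scale
proof (intro conjI allI impI)
  fix u v y assume "(u, v) \<in> E" "y \<in> carrier Q"
  then have "fox q Q x u y = fox q Q x v y"
    using assms unfolding mem_fox_solutions by blast
  then show "c * fox q Q x u y = c * fox q Q x v y" by simp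
next
  fix i assume "i \<notin> S \<times> carrier Q"
  then have "x i = 0" using assms unfolding mem_fox_solutions by blast
  then show "c * x i = 0" by simp
qed (use assms in \<open>simp_all add: fox_solutions_def\<close>)

lemma fox_solutions_support: "x \<in> fox_solutions Q q S E u0 \<Longrightarrow> i \<notin> S \<times> carrier Q \<Longrightarrow> x i = 0"
  unfolding mem_fox_solutions by blast

lemma fox_solutions_zero: "(\<lambda>_. 0) \<in> fox_solutions Q q S E u0"
proof -
  have "fox q Q (\<lambda>_. 0 :: real) u y = 0" for u y by (induction u arbitrary: y) auto
  then show ?thesis by (simp add: mem_fox_solutions)
qed

lemma proj_combination: "proj U (\<Sum>a\<in>A. c a *\<^sub>R x a) = (\<Sum>a\<in>A. c a *\<^sub>R proj U (x a))"
  unfolding proj_def inner_sum_right scaleR_sum_left scaleR_sum_right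
  by (subst sum.swap) simp

context
  fixes G :: "('a, 'm) monoid_scheme" and Q :: "('q, 'n) monoid_scheme" and q :: "'a \<Rightarrow> 'q"
  assumes G: "group G" and Q: "group Q" and q: "q \<in> hom G Q"
begin

interpretation G: group G by (rule G)
interpretation Q: group Q by (rule Q)

lemma fox_solutions_translate:
  assumes S: "S \<subseteq> carrier G" "\<And>u v. (u, v) \<in> E \<Longrightarrow> set u \<subseteq> S \<and> set v \<subseteq> S" "set u0 \<subseteq> S"
    and x: "x \<in> fox_solutions Q q S E u0" and c: "c \<in> carrier Q"
  shows "(\<lambda>(s, y). if y \<in> carrier Q then x (s, y \<otimes>\<^bsub>Q\<^esub> c) else x (s, y)) \<in> fox_solutions Q q S E u0"
proof -
  let ?x = "\<lambda>(s, y). if y \<in> carrier Q then x (s, y \<otimes>\<^bsub>Q\<^esub> c) else x (s, y)"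
  have fox: "fox q Q ?x u y = fox q Q x u (y \<otimes>\<^bsub>Q\<^esub> c)" if u: "set u \<subseteq> S" and y: "y \<in> carrier Q" for u y
  proof -
    have uG: "set u \<subseteq> carrier G" using u S by blast
    have "fox q Q ?x u y = fox q Q (\<lambda>(s, y). x (s, y \<otimes>\<^bsub>Q\<^esub> c)) u y"
      by (rule fox_cong[OF G Q q]) (use uG y in auto)
    then show ?thesis using fox_translate[OF G Q q uG y c, of x] by simp
  qed
  show ?thesis
    unfolding fox_solutions_def
  proof (intro CollectI conjI allI impI ballI)
    show "?x i = 0" if "i \<notin> S \<times> carrier Q" for i
      using that x c by (cases i) (auto simp: fox_solutions_def)
  next
    fix e assume e: "e \<in> E"
    obtain u v where uv: "e = (u, v)" by (cases e)
    have "fox q Q x u y = fox q Q x v y" if "y \<in> carrier Q" for y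
      using x e uv that unfolding fox_solutions_def by blast
    then show "case e of (u, v) \<Rightarrow> \<forall>y\<in>carrier Q. fox q Q ?x u y = fox q Q ?x v y"
      using S(2)[of u v] e uv c fox by simp
  next
    fix y assume y: "y \<in> carrier Q"
    have "fox q Q x u0 (y \<otimes>\<^bsub>Q\<^esub> c) = 0" using x y c unfolding fox_solutions_def by simp
    then show "fox q Q ?x u0 y = 0" using fox[OF S(3) y] by simp
  qed
qed

text \<open>
  The trace of the projection onto the solution space is its dimension, at least \<open>card Q\<close>, so some
  diagonal entry is at least \<open>1 / card S\<close>. Its column serves as \<open>w\<close>: right convolution by \<open>w\<close> is a
  restriction of the projection, hence a contraction.
\<close>

lemma finite_level_cocycle:
  fixes B :: "'x set"
  assumes S: "finite S" "S \<subseteq> carrier G" "\<And>g. g \<in> carrier G \<Longrightarrow> \<exists>u. set u \<subseteq> S \<and> word_val G u = g"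
    and finQ: "finite (carrier Q)" and B: "finite B" "2 \<le> card B"
    and \<Phi>: "\<And>j. \<exists>\<Phi>. (\<forall>f\<in>B \<rightarrow>\<^sub>E (carrier Q \<rightarrow>\<^sub>E {0..<2 ^ j :: int}). derivation_mod G Q q (2 ^ j) (\<Phi> f)) \<and>
      (\<forall>f\<in>B \<rightarrow>\<^sub>E (carrier Q \<rightarrow>\<^sub>E {0..<2 ^ j :: int}). \<forall>f'\<in>B \<rightarrow>\<^sub>E (carrier Q \<rightarrow>\<^sub>E {0..<2 ^ j :: int}).
         (\<forall>g\<in>carrier G. \<Phi> f g = \<Phi> f' g) \<longrightarrow> f = f')"
    and E: "finite E" "\<And>u v. (u, v) \<in> E \<Longrightarrow> set u \<subseteq> S \<and> set v \<subseteq> S \<and> word_val G u = word_val G v"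
    and u0: "set u0 \<subseteq> S"
  shows "\<exists>s\<in>S. \<exists>w\<in>fox_solutions Q q S E u0. 1 / card S \<le> w (s, \<one>\<^bsub>Q\<^esub>) \<and>
    (\<forall>c. (\<Sum>(t, y)\<in>S \<times> carrier Q. (\<Sum>g\<in>carrier Q. c g * w (t, y \<otimes>\<^bsub>Q\<^esub> inv\<^bsub>Q\<^esub> g))\<^sup>2)
      \<le> (\<Sum>g\<in>carrier Q. (c g)\<^sup>2))"
proof -
  define I where "I = S \<times> carrier Q"
  have finI: "finite I" using S finQ by (simp add: I_def)
  define W where "W = {f. entry f \<in> fox_solutions Q q S E u0}"
  have subW: "subspace W"
    unfolding subspace_def W_def
    using fox_solutions_zero fox_solutions_add fox_solutions_scale
    by (auto simp: zero_ell2.rep_eq plus_ell2.rep_eq scaleR_ell2.rep_eq)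
  have WI: "entry f i = 0" if "f \<in> W" "i \<notin> I" for f i
    using that fox_solutions_support[of "entry f"] by (simp add: W_def I_def)
  have lift: "\<exists>f. entry f = x" if x: "x \<in> fox_solutions Q q S E u0" for x
  proof -
    have x0: "x i = 0" if "i \<notin> I" for i using x that fox_solutions_support by (simp add: I_def)
    have "(\<Sum>i\<in>F. (x i)\<^sup>2) \<le> (\<Sum>i\<in>I. (x i)\<^sup>2)" if "finite F" for F
    proof -
      have "(\<Sum>i\<in>F. (x i)\<^sup>2) = (\<Sum>i\<in>F \<inter> I. (x i)\<^sup>2)"
        using that x0 by (intro sum.mono_neutral_right) auto
      also have "\<dots> \<le> (\<Sum>i\<in>I. (x i)\<^sup>2)" using finI by (intro sum_mono2) auto
      finally show ?thesis .
    qed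
    from ell2_of_bounded[OF this] show ?thesis by (auto simp: fun_eq_iff)
  qed
  obtain U where U: "finite U" "orthonormal U" "U \<subseteq> W" "card (carrier Q) \<le> card U" "\<forall>x\<in>W. proj U x = x"
  proof (rule orthonormal_basis_exists[OF subW finI WI, of "card (carrier Q)"])
    fix J assume J: "J \<subseteq> I" "\<And>x. x \<in> W \<Longrightarrow> (\<And>i. i \<in> J \<Longrightarrow> entry x i = 0) \<Longrightarrow> x = 0"
    have "(card B - 1) * card (carrier Q) \<le> card J"
    proof (rule fox_solutions_coordinates[OF G Q q S finQ B(1) _ \<Phi> E u0])
      show "B \<noteq> {}" using B by auto
      show "J \<subseteq> S \<times> carrier Q" using J by (simp add: I_def)
      fix x assume x: "x \<in> fox_solutions Q q S E u0" "\<And>i. i \<in> J \<Longrightarrow> x i = 0"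
      obtain f where f: "entry f = x" using lift[OF x(1)] by blast
      then have "f = 0" using x by (intro J(2)) (auto simp: W_def)
      then show "x = (\<lambda>_. 0)" using f by auto
    qed
    \<comment> \<open>This is where \<open>2 \<le> card B\<close> enters: one copy of
      \<open>card (carrier Q)\<close> remains after the condition at \<open>u0\<close>.\<close>
    moreover have "1 * card (carrier Q) \<le> (card B - 1) * card (carrier Q)"
      using B by (intro mult_right_mono) auto
    ultimately show "card (carrier Q) \<le> card J" by linarith
  qed blast
  define n where "n = card S"
  define \<kappa> where "\<kappa> = card (carrier Q)"
  have \<kappa>: "0 < \<kappa>" using finQ Q.one_closed by (auto simp: \<kappa>_def card_gt_0_iff)
  have "\<exists>i\<in>I. 1 / n \<le> (norm (proj U (ket i)))\<^sup>2"
  proof (rule ccontr)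
    assume "\<not> ?thesis"
    then have less: "(norm (proj U (ket i)))\<^sup>2 < 1 / n" if "i \<in> I" for i using that by force
    have "real (card U) = (\<Sum>i\<in>I. (norm (proj U (ket i)))\<^sup>2)"
      using U WI by (intro orthonormal_card_le[OF U(1,2) finI]) auto
    moreover have "0 < real (card U)" using U(4) \<kappa> by (simp add: \<kappa>_def)
    ultimately have "I \<noteq> {}" by auto
    then have "(\<Sum>i\<in>I. (norm (proj U (ket i)))\<^sup>2) < (\<Sum>i\<in>I. 1 / real n)"
      using less finI by (intro sum_strict_mono) auto
    also have "\<dots> = real (n * \<kappa>) / real n" by (simp add: I_def card_cartesian_product n_def \<kappa>_def)
    also have "\<dots> \<le> real \<kappa>" by (cases "n = 0") auto
    finally show False using \<open>real (card U) = _\<close> U(4) by (simp add: \<kappa>_def)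
  qed
  then obtain s y where sy: "s \<in> S" "y \<in> carrier Q" "1 / n \<le> (norm (proj U (ket (s, y))))\<^sup>2"
    by (auto simp: I_def)
  \<comment> \<open>Right translation, extended by the identity outside \<open>carrier Q\<close> so
    as to permute the whole index type.\<close>
  define \<pi> where "\<pi> c = (\<lambda>(t, z). if z \<in> carrier Q then (t :: 'a, z \<otimes>\<^bsub>Q\<^esub> c) else (t, z))" for c
  have \<pi>_inv: "\<pi> (inv\<^bsub>Q\<^esub> c) (\<pi> c i) = i" "\<pi> c (\<pi> (inv\<^bsub>Q\<^esub> c) i) = i" if "c \<in> carrier Q" for c i
    using that by (auto simp: \<pi>_def Q.m_assoc split: prod.splits)
  have bij: "bij (\<pi> c)" if "c \<in> carrier Q" for c
    by (rule o_bij[of "\<pi> (inv\<^bsub>Q\<^esub> c)"]) (use \<pi>_inv[OF that] in \<open>auto simp: fun_eq_iff\<close>)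
  let ?T = "\<lambda>c. ell2_permute (\<pi> c)"
  have TW: "?T c x \<in> W" if "c \<in> carrier Q" "x \<in> W" for c x
  proof -
    have "(\<lambda>(s, y). if y \<in> carrier Q then entry x (s, y \<otimes>\<^bsub>Q\<^esub> c) else entry x (s, y)) \<in> fox_solutions Q q S E u0"
      using that E(2) by (intro fox_solutions_translate[OF S(2) _ u0]) (auto simp: W_def)
    moreover have "entry (?T c x) = (\<lambda>(s, y). if y \<in> carrier Q then entry x (s, y \<otimes>\<^bsub>Q\<^esub> c) else entry x (s, y))"
      unfolding fun_eq_iff entry_permute[OF bij[OF that(1)]] by (auto simp: \<pi>_def)
    ultimately show ?thesis by (simp add: W_def)
  qed
  have comm: "proj U (?T c x) = ?T c (proj U x)" if c: "c \<in> carrier Q" for c x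
  proof (rule proj_commute[OF U(1-3) U(5)[rule_format] subW])
    show "\<exists>y\<in>W. ?T c y = x" if "x \<in> W" for x
    proof (intro bexI)
      show "?T c (?T (inv\<^bsub>Q\<^esub> c) x) = x"
        using \<pi>_inv[OF c] bij c by (intro ell2_eqI) (simp add: entry_permute)
    qed (use TW that c in auto)
  qed (use TW c permute_diff[OF bij[OF c]] inner_permute[OF bij[OF c]] in auto)
  \<comment> \<open>The large diagonal entry sits at \<open>(s, y)\<close>. The projection commutes
    with right translations, so the entry at \<open>(s, \<one>)\<close> is equally large.\<close>
  define w where "w = proj U (ket (s, \<one>\<^bsub>Q\<^esub>))"
  have \<pi>_s: "\<pi> c (s, z) = (s, z \<otimes>\<^bsub>Q\<^esub> c)" if "z \<in> carrier Q" for c z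
    using that by (simp add: \<pi>_def)
  have Tket: "?T c (ket (s, z \<otimes>\<^bsub>Q\<^esub> c)) = ket (s, z)" if "c \<in> carrier Q" "z \<in> carrier Q" for c z
    using permute_ket[OF bij[OF that(1)], of "(s, z)"] \<pi>_s[OF that(2)] by simp
  have Tw: "?T (inv\<^bsub>Q\<^esub> g) w = proj U (ket (s, g))" if g: "g \<in> carrier Q" for g
    using comm[of "inv\<^bsub>Q\<^esub> g" "ket (s, \<one>\<^bsub>Q\<^esub>)"] Tket[of "inv\<^bsub>Q\<^esub> g" g] g by (simp add: w_def)
  have wW: "w \<in> W"
    unfolding w_def proj_def using U subW by (intro subspace_sum subspace_scale) auto
  have "entry w (s, \<one>\<^bsub>Q\<^esub>) = inner (ket (s, \<one>\<^bsub>Q\<^esub>)) (proj U (ket (s, \<one>\<^bsub>Q\<^esub>)))"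
    by (simp add: inner_ket w_def)
  also have "\<dots> = (norm w)\<^sup>2" using inner_proj_square[OF U(1,2)] by (simp add: w_def)
  also have "\<dots> = (norm (?T (inv\<^bsub>Q\<^esub> y) w))\<^sup>2" using norm_permute[OF bij] sy by simp
  finally have w1: "1 / n \<le> entry w (s, \<one>\<^bsub>Q\<^esub>)" using Tw sy by simp
  have contr: "(\<Sum>(t, y)\<in>S \<times> carrier Q. (\<Sum>g\<in>carrier Q. c g * entry w (t, y \<otimes>\<^bsub>Q\<^esub> inv\<^bsub>Q\<^esub> g))\<^sup>2)
      \<le> (\<Sum>g\<in>carrier Q. (c g)\<^sup>2)" for c
  proof -
    let ?z = "\<Sum>g\<in>carrier Q. c g *\<^sub>R ?T (inv\<^bsub>Q\<^esub> g) w"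
    have "entry ?z (t, y) = (\<Sum>g\<in>carrier Q. c g * entry w (t, y \<otimes>\<^bsub>Q\<^esub> inv\<^bsub>Q\<^esub> g))" if "y \<in> carrier Q" for t y
      using that by (simp add: entry_permute[OF bij]) (simp add: \<pi>_def)
    then have "(\<Sum>(t, y)\<in>S \<times> carrier Q. (\<Sum>g\<in>carrier Q. c g * entry w (t, y \<otimes>\<^bsub>Q\<^esub> inv\<^bsub>Q\<^esub> g))\<^sup>2)
        = (\<Sum>i\<in>I. (entry ?z i)\<^sup>2)"
      unfolding I_def by (intro sum.cong) auto
    also have "\<dots> \<le> (norm ?z)\<^sup>2" by (rule sum_entry_le_norm[OF finI])
    also have "?z = proj U (\<Sum>g\<in>carrier Q. c g *\<^sub>R ket (s, g))"
      unfolding proj_combination by (intro sum.cong) (simp_all add: Tw)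
    also have "(norm \<dots>)\<^sup>2 \<le> (norm (\<Sum>g\<in>carrier Q. c g *\<^sub>R ket (s, g)))\<^sup>2"
      by (rule norm_proj_le[OF U(1,2)])
    also have "(\<Sum>g\<in>carrier Q. c g *\<^sub>R ket (s, g)) = (\<Sum>i\<in>Pair s ` carrier Q. c (snd i) *\<^sub>R ket i)"
      by (subst sum.reindex) (auto simp: inj_on_def)
    also have "(norm \<dots>)\<^sup>2 = (\<Sum>i\<in>Pair s ` carrier Q. (c (snd i))\<^sup>2)"
      using finQ by (intro norm_finite_combination) auto
    also have "\<dots> = (\<Sum>g\<in>carrier Q. (c g)\<^sup>2)" by (subst sum.reindex) (auto simp: inj_on_def)
    finally show ?thesis .
  qed
  show ?thesis
    using sy(1) wW w1 contr by (intro bexI[of _ s] bexI[of _ "entry w"]) (auto simp: W_def n_def)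
qed

end

section \<open>A square-summable cocycle as a limit of finite levels\<close>

text \<open>For homomorphisms to finite 2-groups this comes from \<open>many_derivations\<close>;
  the limit argument needs nothing else about the target.\<close>

definition has_many_derivations ::
    "('a, 'm) monoid_scheme \<Rightarrow> 'x set \<Rightarrow> ('q, 'n) monoid_scheme \<Rightarrow> ('a \<Rightarrow> 'q) \<Rightarrow> bool" where
  "has_many_derivations G B Q q \<longleftrightarrow> (\<forall>j. \<exists>\<Phi>.
     (\<forall>f\<in>B \<rightarrow>\<^sub>E (carrier Q \<rightarrow>\<^sub>E {0..<2 ^ j :: int}). derivation_mod G Q q (2 ^ j) (\<Phi> f)) \<and>
     (\<forall>f\<in>B \<rightarrow>\<^sub>E (carrier Q \<rightarrow>\<^sub>E {0..<2 ^ j :: int}). \<forall>f'\<in>B \<rightarrow>\<^sub>E (carrier Q \<rightarrow>\<^sub>E {0..<2 ^ j :: int}).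
        (\<forall>g\<in>carrier G. \<Phi> f g = \<Phi> f' g) \<longrightarrow> f = f'))"

definition valid_pairs :: "('a, 'm) monoid_scheme \<Rightarrow> 'a set \<Rightarrow> ('a list \<times> 'a list) set" where
  "valid_pairs G S = {(u, v). set u \<subseteq> S \<and> set v \<subseteq> S \<and> word_val G u = word_val G v}"

text \<open>
  The last condition says that right convolution by \<open>x\<close> is a contraction. It is stated through
  finite sums, so that for fixed parameters the conditions define a closed set in the product
  topology.
\<close>

definition cocycle_conditions ::
    "('a, 'm) monoid_scheme \<Rightarrow> 'a set \<Rightarrow> 'a list \<Rightarrow> 'a \<Rightarrow> ('a list \<times> 'a list) set \<Rightarrow> 'a set \<Rightarrow> ('a \<times> 'a \<Rightarrow> real) set" where
  "cocycle_conditions G S u0 s E T = {x.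
     (\<forall>u v y. (u, v) \<in> E \<longrightarrow> y \<in> carrier G \<longrightarrow> fox id G x u y = fox id G x v y) \<and>
     (\<forall>y. y \<in> carrier G \<longrightarrow> fox id G x u0 y = 0) \<and>
     1 / card S \<le> x (s, \<one>\<^bsub>G\<^esub>) \<and>
     (\<forall>A c F. finite A \<longrightarrow> A \<subseteq> T \<longrightarrow> finite F \<longrightarrow> F \<subseteq> S \<times> T \<longrightarrow>
        (\<Sum>i\<in>F. (\<Sum>g\<in>A. c g * x (fst i, snd i \<otimes>\<^bsub>G\<^esub> inv\<^bsub>G\<^esub> g))\<^sup>2) \<le> (\<Sum>g\<in>A. (c g)\<^sup>2))}"

lemma cocycle_conditionsD:
  assumes "x \<in> cocycle_conditions G S u0 s E T"
  shows "(u, v) \<in> E \<Longrightarrow> y \<in> carrier G \<Longrightarrow> fox id G x u y = fox id G x v y"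
    and "y \<in> carrier G \<Longrightarrow> fox id G x u0 y = 0"
    and "1 / card S \<le> x (s, \<one>\<^bsub>G\<^esub>)"
    and "finite A \<Longrightarrow> A \<subseteq> T \<Longrightarrow> finite F \<Longrightarrow> F \<subseteq> S \<times> T \<Longrightarrow>
      (\<Sum>i\<in>F. (\<Sum>g\<in>A. c g * x (fst i, snd i \<otimes>\<^bsub>G\<^esub> inv\<^bsub>G\<^esub> g))\<^sup>2) \<le> (\<Sum>g\<in>A. (c g)\<^sup>2)"
proof -
  note c = assms[unfolded cocycle_conditions_def mem_Collect_eq]
  show "(u, v) \<in> E \<Longrightarrow> y \<in> carrier G \<Longrightarrow> fox id G x u y = fox id G x v y"
    by (rule c[THEN conjunct1, rule_format])
  show "y \<in> carrier G \<Longrightarrow> fox id G x u0 y = 0"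
    by (rule c[THEN conjunct2, THEN conjunct1, rule_format])
  show "1 / card S \<le> x (s, \<one>\<^bsub>G\<^esub>)"
    by (rule c[THEN conjunct2, THEN conjunct2, THEN conjunct1])
  show "finite A \<Longrightarrow> A \<subseteq> T \<Longrightarrow> finite F \<Longrightarrow> F \<subseteq> S \<times> T \<Longrightarrow>
      (\<Sum>i\<in>F. (\<Sum>g\<in>A. c g * x (fst i, snd i \<otimes>\<^bsub>G\<^esub> inv\<^bsub>G\<^esub> g))\<^sup>2) \<le> (\<Sum>g\<in>A. (c g)\<^sup>2)"
    by (rule c[THEN conjunct2, THEN conjunct2, THEN conjunct2, rule_format])
qed

lemma continuous_on_coordinate: "continuous_on UNIV (\<lambda>x :: 'i \<Rightarrow> real. x i)"
  by (rule continuous_on_product_coordinates)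

lemma continuous_on_fox: "continuous_on UNIV (\<lambda>x :: 'a \<times> 'q \<Rightarrow> real. fox q Q x u y)"
  by (induction u arbitrary: y) (auto intro!: continuous_intros continuous_on_coordinate)

lemma closed_cocycle_conditions: "closed (cocycle_conditions G S u0 s E T)"
  unfolding cocycle_conditions_def
  by (intro closed_Collect_conj closed_Collect_all closed_Collect_imp open_Collect_const
      closed_Collect_eq closed_Collect_le continuous_on_fox continuous_intros continuous_on_coordinate)

text \<open>Tychonoff's theorem.\<close>

lemma compact_cube: "compact {x :: 'i \<Rightarrow> real. \<forall>i. x i \<in> {-1..1}}"
proof -
  have "compactin (product_topology (\<lambda>_. euclidean) UNIV) (PiE UNIV (\<lambda>_ :: 'i. {-1..1 :: real}))"
    by (simp add: compactin_PiE)
  then have "compact (PiE UNIV (\<lambda>_ :: 'i. {-1..1 :: real}))"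
    by (simp add: euclidean_product_topology)
  moreover have "PiE UNIV (\<lambda>_ :: 'i. {-1..1 :: real}) = {x. \<forall>i. x i \<in> {-1..1}}" by auto
  ultimately show ?thesis by simp
qed

lemma cocycle_conditions_antimono:
  assumes "E \<subseteq> E'" "T \<subseteq> T'"
  shows "cocycle_conditions G S u0 s E' T' \<subseteq> cocycle_conditions G S u0 s E T"
proof -
  have "S \<times> T \<subseteq> S \<times> T'" using assms by blast
  then show ?thesis
    unfolding cocycle_conditions_def using assms
    by (intro Collect_mono impI, elim conjE, intro conjI) (meson subsetD order.trans)+
qed

context
  fixes G :: "('a, 'm) monoid_scheme"
  assumes G: "group G"
begin

interpretation G: group G by (rule G)

text \<open>The solution \<open>w\<close> on \<open>Q\<close> is pulled back along \<open>q\<close>.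
  Since \<open>q\<close> is injective on \<open>T\<close>, finite sums over subsets of
  \<open>T\<close> become parts of sums over \<open>Q\<close>, to which the contraction bound
  applies.\<close>

lemma finite_cocycle_conditions:
  fixes B :: "'x set" and Q :: "('q, 'n) monoid_scheme"
  assumes S: "finite S" "S \<subseteq> carrier G" "\<And>g. g \<in> carrier G \<Longrightarrow> \<exists>u. set u \<subseteq> S \<and> word_val G u = g"
    and B: "finite B" "2 \<le> card B" and u0: "set u0 \<subseteq> S"
    and E: "finite E" "E \<subseteq> valid_pairs G S" and T: "finite T" "T \<subseteq> carrier G"
    and Q: "group Q" "finite (carrier Q)" and q: "q \<in> hom G Q"
    and sep: "\<And>g h. g \<in> T \<Longrightarrow> h \<in> T \<Longrightarrow> g \<noteq> h \<Longrightarrow> q (g \<otimes>\<^bsub>G\<^esub> inv\<^bsub>G\<^esub> h) \<noteq> \<one>\<^bsub>Q\<^esub>"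
    and der: "has_many_derivations G B Q q"
  shows "\<exists>s\<in>S. {x. \<forall>i. x i \<in> {-1..1}} \<inter> cocycle_conditions G S u0 s E T \<noteq> {}"
proof -
  interpret Q: group Q by fact
  interpret q: group_hom G Q q using q by unfold_locales
  obtain s w where s: "s \<in> S" and w: "w \<in> fox_solutions Q q S E u0" "1 / card S \<le> w (s, \<one>\<^bsub>Q\<^esub>)"
    and contr: "\<And>c. (\<Sum>(t, y)\<in>S \<times> carrier Q. (\<Sum>g\<in>carrier Q. c g * w (t, y \<otimes>\<^bsub>Q\<^esub> inv\<^bsub>Q\<^esub> g))\<^sup>2)
      \<le> (\<Sum>g\<in>carrier Q. (c g)\<^sup>2)"
    using finite_level_cocycle[OF G Q(1) q S Q(2) B der[unfolded has_many_derivations_def, rule_format] E(1) _ u0] E(2)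
    unfolding valid_pairs_def by blast
  have injq: "inj_on q T"
  proof (rule inj_onI, rule ccontr)
    fix g h assume gh: "g \<in> T" "h \<in> T" "q g = q h" "g \<noteq> h"
    then have "g \<in> carrier G" "h \<in> carrier G" using T by auto
    then have "q (g \<otimes>\<^bsub>G\<^esub> inv\<^bsub>G\<^esub> h) = \<one>\<^bsub>Q\<^esub>" using gh(3) by simp
    then show False using sep gh by blast
  qed
  define x where "x = (\<lambda>(t, y). if t \<in> S \<and> y \<in> carrier G then w (t, q y) else 0)"
  have fox: "fox id G x u y = fox q Q w u (q y)" if "set u \<subseteq> S" "y \<in> carrier G" for u y
    using that
  proof (induction u arbitrary: y)
    case (Cons t u)
    then have "t \<in> carrier G" using S by auto
    then show ?case using Cons by (simp add: x_def)
  qed simp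
  \<comment> \<open>Testing the contraction on the point mass at the unit bounds all entries, which
    places \<open>x\<close> in the compact cube.\<close>
  have w_le: "\<bar>w (t, y)\<bar> \<le> 1" if "t \<in> S" "y \<in> carrier Q" for t y
  proof -
    let ?c = "\<lambda>g. if g = \<one>\<^bsub>Q\<^esub> then 1 else 0 :: real"
    have "(\<Sum>g\<in>carrier Q. ?c g * w (t, y \<otimes>\<^bsub>Q\<^esub> inv\<^bsub>Q\<^esub> g)) = w (t, y)" if "y \<in> carrier Q" for t y
      using that Q(2) by (simp add: if_distrib[of "\<lambda>x. x * _"] cong: if_cong)
    then have "(\<Sum>(t, y)\<in>S \<times> carrier Q. (w (t, y))\<^sup>2) = (\<Sum>(t, y)\<in>S \<times> carrier Q. (\<Sum>g\<in>carrier Q. ?c g * w (t, y \<otimes>\<^bsub>Q\<^esub> inv\<^bsub>Q\<^esub> g))\<^sup>2)"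
      by (intro sum.cong) auto
    also have "\<dots> \<le> (\<Sum>g\<in>carrier Q. (?c g)\<^sup>2)" by (rule contr)
    also have "\<dots> = 1" using Q(2) by (simp add: if_distrib[of "\<lambda>x. x\<^sup>2"] cong: if_cong)
    finally have "(\<Sum>i\<in>S \<times> carrier Q. (w i)\<^sup>2) \<le> 1" by (simp add: split_beta)
    moreover have "(w (t, y))\<^sup>2 \<le> (\<Sum>i\<in>S \<times> carrier Q. (w i)\<^sup>2)"
      using that S Q(2) by (intro member_le_sum) auto
    ultimately have "(w (t, y))\<^sup>2 \<le> 1" by linarith
    then show ?thesis by (simp only: abs_square_le_1)
  qed
  have cube: "x i \<in> {-1..1}" for i
    using w_le[of "fst i" "q (snd i)"] by (cases i) (auto simp: x_def abs_le_iff)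
  have "x \<in> cocycle_conditions G S u0 s E T"
    unfolding cocycle_conditions_def
  proof (intro CollectI conjI allI impI)
    fix u v y assume uv: "(u, v) \<in> E" and y: "y \<in> carrier G"
    then have "set u \<subseteq> S" "set v \<subseteq> S" using E by (auto simp: valid_pairs_def)
    then show "fox id G x u y = fox id G x v y"
      using fox y w(1) uv unfolding mem_fox_solutions by simp
  next
    fix y assume "y \<in> carrier G"
    then show "fox id G x u0 y = 0" using fox[OF u0] w(1) unfolding mem_fox_solutions by simp
  next
    show "1 / card S \<le> x (s, \<one>\<^bsub>G\<^esub>)" using s w by (simp add: x_def)
  next
    fix A :: "'a set" and c :: "'a \<Rightarrow> real" and F assume A: "finite A" "A \<subseteq> T" and F: "finite F" "F \<subseteq> S \<times> T"
    have injA: "inj_on q A" using injq A inj_on_subset by blast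
    have AG: "A \<subseteq> carrier G" using A T by blast
    \<comment> \<open>Push-forward of \<open>c\<close> along \<open>q\<close>, extended by
      0.\<close>
    define c' where "c' h = (if h \<in> q ` A then c (inv_into A q h) else 0)" for h
    have c': "c' (q g) = c g" if "g \<in> A" for g using that injA by (simp add: c'_def)
    have sumA: "(\<Sum>h\<in>carrier Q. c' h * z h) = (\<Sum>g\<in>A. c g * z (q g))" for z
    proof -
      have "(\<Sum>h\<in>carrier Q. c' h * z h) = (\<Sum>h\<in>q ` A. c' h * z h)"
        using Q(2) AG by (intro sum.mono_neutral_right) (auto simp: c'_def)
      also have "\<dots> = (\<Sum>g\<in>A. c' (q g) * z (q g))" using sum.reindex[OF injA] by simp
      finally show ?thesis using c' by simp
    qed
    have sumA2: "(\<Sum>h\<in>carrier Q. (c' h)\<^sup>2) = (\<Sum>g\<in>A. (c g)\<^sup>2)"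
      using sumA[of c'] c' by (simp add: power2_eq_square)
    define \<phi> where "\<phi> = (\<lambda>(t, y). (\<Sum>g\<in>carrier Q. c' g * w (t, y \<otimes>\<^bsub>Q\<^esub> inv\<^bsub>Q\<^esub> g))\<^sup>2)"
    define \<rho> where "\<rho> i = (fst i, q (snd i))" for i :: "'a \<times> 'a"
    have inj\<rho>: "inj_on \<rho> F"
    proof (rule inj_onI)
      fix i j assume ij: "i \<in> F" "j \<in> F" "\<rho> i = \<rho> j"
      then have "snd i \<in> T" "snd j \<in> T" using F by auto
      then have "snd i = snd j" using injq ij by (auto simp: \<rho>_def dest: inj_onD)
      then show "i = j" using ij by (simp add: \<rho>_def prod_eq_iff)
    qed
    have "(\<Sum>g\<in>A. c g * x (fst i, snd i \<otimes>\<^bsub>G\<^esub> inv\<^bsub>G\<^esub> g))\<^sup>2 = \<phi> (\<rho> i)" if i: "i \<in> F" for i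
    proof -
      obtain t y where ty: "i = (t, y)" by (cases i)
      have t: "t \<in> S" "y \<in> carrier G" using i F T ty by auto
      have "x (t, y \<otimes>\<^bsub>G\<^esub> inv\<^bsub>G\<^esub> g) = w (t, q y \<otimes>\<^bsub>Q\<^esub> inv\<^bsub>Q\<^esub> (q g))" if "g \<in> A" for g
        using that t AG by (auto simp: x_def)
      then show ?thesis by (simp add: \<phi>_def \<rho>_def ty sumA)
    qed
    then have "(\<Sum>i\<in>F. (\<Sum>g\<in>A. c g * x (fst i, snd i \<otimes>\<^bsub>G\<^esub> inv\<^bsub>G\<^esub> g))\<^sup>2) = (\<Sum>i\<in>\<rho> ` F. \<phi> i)"
      using sum.reindex[OF inj\<rho>, of \<phi>] by simp
    also have "\<dots> \<le> (\<Sum>i\<in>S \<times> carrier Q. \<phi> i)"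
    proof (rule sum_mono2)
      show "\<rho> ` F \<subseteq> S \<times> carrier Q" using F T by (auto simp: \<rho>_def)
    qed (use S Q(2) in \<open>auto simp: \<phi>_def\<close>)
    also have "\<dots> \<le> (\<Sum>g\<in>carrier Q. (c' g)\<^sup>2)" unfolding \<phi>_def by (rule contr)
    finally show "(\<Sum>i\<in>F. (\<Sum>g\<in>A. c g * x (fst i, snd i \<otimes>\<^bsub>G\<^esub> inv\<^bsub>G\<^esub> g))\<^sup>2) \<le> (\<Sum>g\<in>A. (c g)\<^sup>2)"
      unfolding sumA2 .
  qed
  then show ?thesis using cube s by blast
qed

text \<open>The conditions for finite \<open>E\<close> and \<open>T\<close> cut out a directed
  family of closed sets, nonempty in a compact cube. A common point satisfies all the equations,
  since each single condition involves only a finite part of \<open>G\<close>.\<close>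

lemma limit_cocycle:
  fixes B :: "'x set" and \<Q> :: "(('q, 'n) monoid_scheme \<times> ('a \<Rightarrow> 'q)) set"
  assumes S: "finite S" "S \<subseteq> carrier G" "\<And>g. g \<in> carrier G \<Longrightarrow> \<exists>u. set u \<subseteq> S \<and> word_val G u = g"
    and B: "finite B" "2 \<le> card B" and u0: "set u0 \<subseteq> S"
    and \<Q>: "\<And>Q q. (Q, q) \<in> \<Q> \<Longrightarrow> group Q \<and> finite (carrier Q) \<and> q \<in> hom G Q \<and> has_many_derivations G B Q q"
    and sep: "\<And>T. finite T \<Longrightarrow> T \<subseteq> carrier G - {\<one>\<^bsub>G\<^esub>} \<Longrightarrow> \<exists>(Q, q)\<in>\<Q>. \<forall>z\<in>T. q z \<noteq> \<one>\<^bsub>Q\<^esub>"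
  shows "\<exists>s\<in>S. \<exists>x. x \<in> cocycle_conditions G S u0 s (valid_pairs G S) (carrier G)"
proof -
  define \<P> where "\<P> = {(E, T). finite E \<and> E \<subseteq> valid_pairs G S \<and> finite T \<and> T \<subseteq> carrier G}"
  let ?K = "{x :: 'a \<times> 'a \<Rightarrow> real. \<forall>i. x i \<in> {-1..1}}"
  define M where "M s p = cocycle_conditions G S u0 s (fst p) (snd p)" for s p
  have level: "\<exists>s\<in>S. ?K \<inter> M s p \<noteq> {}" if p: "p \<in> \<P>" for p
  proof -
    obtain E T where ET: "p = (E, T)" by (cases p)
    have E: "finite E" "E \<subseteq> valid_pairs G S" and T: "finite T" "T \<subseteq> carrier G"
      using p ET by (auto simp: \<P>_def)
    define T' where "T' = (\<lambda>(g, h). g \<otimes>\<^bsub>G\<^esub> inv\<^bsub>G\<^esub> h) ` {(g, h). g \<in> T \<and> h \<in> T \<and> g \<noteq> h}"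
    have "finite T'" unfolding T'_def
      by (intro finite_imageI finite_subset[OF _ finite_cartesian_product[OF T(1) T(1)]]) auto
    moreover have "T' \<subseteq> carrier G - {\<one>\<^bsub>G\<^esub>}"
    proof -
      have "g = h" if "g \<in> carrier G" "h \<in> carrier G" "g \<otimes>\<^bsub>G\<^esub> inv\<^bsub>G\<^esub> h = \<one>\<^bsub>G\<^esub>" for g h
        using that by (metis G.inv_closed G.inv_equality G.inv_inv)
      then show ?thesis using T unfolding T'_def by (auto intro!: G.m_closed G.inv_closed)
    qed
    ultimately obtain Q q where Qq: "(Q, q) \<in> \<Q>" "\<forall>z\<in>T'. q z \<noteq> \<one>\<^bsub>Q\<^esub>" using sep[of T'] by blast
    have "\<exists>s\<in>S. ?K \<inter> cocycle_conditions G S u0 s E T \<noteq> {}"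
    proof (rule finite_cocycle_conditions[OF S B u0 E T, of Q q])
      show "q (g \<otimes>\<^bsub>G\<^esub> inv\<^bsub>G\<^esub> h) \<noteq> \<one>\<^bsub>Q\<^esub>" if "g \<in> T" "h \<in> T" "g \<noteq> h" for g h
      proof -
        have "(\<lambda>(g, h). g \<otimes>\<^bsub>G\<^esub> inv\<^bsub>G\<^esub> h) (g, h) \<in> T'" unfolding T'_def using that by (intro imageI) simp
        then show ?thesis using Qq(2) by simp
      qed
    qed (use \<Q>[OF Qq(1)] in auto)
    then show ?thesis by (simp add: ET M_def)
  qed
  \<comment> \<open>The letter \<open>s\<close> has to be fixed before passing to the limit: if each
    \<open>s\<close> failed at some level, all would fail at the union of these finitely many
    levels.\<close>
  have "\<exists>s\<in>S. \<forall>p\<in>\<P>. ?K \<inter> M s p \<noteq> {}"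
  proof (rule ccontr)
    assume "\<not> ?thesis"
    then have "\<forall>s\<in>S. \<exists>p. p \<in> \<P> \<and> ?K \<inter> M s p = {}" by blast
    then obtain p where p: "\<And>s. s \<in> S \<Longrightarrow> p s \<in> \<P>" "\<And>s. s \<in> S \<Longrightarrow> ?K \<inter> M s (p s) = {}" by metis
    define p' where "p' = (\<Union>s\<in>S. fst (p s), \<Union>s\<in>S. snd (p s))"
    have "p' \<in> \<P>" using p(1) S(1) unfolding p'_def \<P>_def by fastforce
    then obtain s where s: "s \<in> S" "?K \<inter> M s p' \<noteq> {}" using level by blast
    have "M s p' \<subseteq> M s (p s)"
      unfolding p'_def M_def fst_conv snd_conv by (rule cocycle_conditions_antimono) (use s in auto)
    then show False using p(2)[OF s(1)] s(2) by blast
  qed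
  then obtain s where s: "s \<in> S" "\<And>p. p \<in> \<P> \<Longrightarrow> ?K \<inter> M s p \<noteq> {}" by blast
  have "?K \<inter> \<Inter> (M s ` \<P>) \<noteq> {}"
  proof (rule compact_imp_fip[OF compact_cube])
    show "closed C" if "C \<in> M s ` \<P>" for C using that closed_cocycle_conditions by (auto simp: M_def)
  next
    fix \<F> assume "finite \<F>" "\<F> \<subseteq> M s ` \<P>"
    then obtain D where D: "D \<subseteq> \<P>" "finite D" "\<F> = M s ` D" by (metis finite_subset_image)
    define p' where "p' = (\<Union>p\<in>D. fst p, \<Union>p\<in>D. snd p)"
    have "p' \<in> \<P>" using D unfolding p'_def \<P>_def by fastforce
    moreover have "M s p' \<subseteq> M s p" if "p \<in> D" for p
      unfolding p'_def M_def fst_conv snd_conv by (rule cocycle_conditions_antimono) (use that in auto)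
    ultimately show "?K \<inter> \<Inter> \<F> \<noteq> {}" using s(2)[of p'] D(3) by blast
  qed
  then obtain x where "\<forall>p\<in>\<P>. x \<in> M s p" by blast
  then have x: "x \<in> cocycle_conditions G S u0 s E T" if "(E, T) \<in> \<P>" for E T
    using that by (auto simp: M_def)
  have "({}, {}) \<in> \<P>" by (simp add: \<P>_def)
  note m = x[OF this]
  have "x \<in> cocycle_conditions G S u0 s (valid_pairs G S) (carrier G)"
    unfolding cocycle_conditions_def
  proof (intro CollectI conjI allI impI)
    show "1 / card S \<le> x (s, \<one>\<^bsub>G\<^esub>)" by (rule cocycle_conditionsD(3)[OF m])
    show "fox id G x u0 y = 0" if "y \<in> carrier G" for y by (rule cocycle_conditionsD(2)[OF m that])
  next
    fix u v y assume uv: "(u, v) \<in> valid_pairs G S" and y: "y \<in> carrier G"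
    then have "({(u, v)}, {}) \<in> \<P>" by (simp add: \<P>_def)
    from cocycle_conditionsD(1)[OF x[OF this] _ y] show "fox id G x u y = fox id G x v y" by simp
  next
    fix A :: "'a set" and c :: "'a \<Rightarrow> real" and F assume A: "finite A" "A \<subseteq> carrier G" and F: "finite F" "F \<subseteq> S \<times> carrier G"
    then have P: "({}, A \<union> snd ` F) \<in> \<P>" by (auto simp: \<P>_def)
    have "F \<subseteq> S \<times> (A \<union> snd ` F)" using F by (auto simp: image_iff) (metis snd_conv)
    then show "(\<Sum>i\<in>F. (\<Sum>g\<in>A. c g * x (fst i, snd i \<otimes>\<^bsub>G\<^esub> inv\<^bsub>G\<^esub> g))\<^sup>2) \<le> (\<Sum>g\<in>A. (c g)\<^sup>2)"
      using A F by (intro cocycle_conditionsD(4)[OF x[OF P]]) auto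
  qed
  then show ?thesis using s(1) by blast
qed

end

section \<open>Rigidity of square-summable cocycles\<close>

text \<open>Invariance makes \<open>f\<close> constant along the points
  \<open>inv m [^] k \<otimes> y\<close>, which are pairwise different as \<open>m\<close> has
  infinite order; a nonzero constant would violate the bound.\<close>

lemma (in group) square_summable_invariant_zero:
  fixes f :: "'a \<Rightarrow> real"
  assumes m: "m \<in> carrier G" "\<And>k :: nat. 0 < k \<Longrightarrow> m [^] k \<noteq> \<one>"
    and X: "X \<subseteq> carrier G" "\<And>y. y \<in> X \<Longrightarrow> inv m \<otimes> y \<in> X" "\<And>y. y \<in> X \<Longrightarrow> f (inv m \<otimes> y) = f y"
    and C: "\<And>F. finite F \<Longrightarrow> F \<subseteq> carrier G \<Longrightarrow> (\<Sum>y\<in>F. (f y)\<^sup>2) \<le> C" and y: "y \<in> X"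
  shows "f y = 0"
proof (rule ccontr)
  assume "f y \<noteq> 0"
  define z where "z k = inv m [^] (k :: nat) \<otimes> y" for k
  have yc: "y \<in> carrier G" using X y by blast
  have z_Suc: "z (Suc k) = inv m \<otimes> z k" for k
  proof -
    have "inv m [^] (Suc k) = inv m \<otimes> inv m [^] k" using nat_pow_Suc2[of "inv m" k] m by simp
    then show ?thesis using m yc by (simp add: z_def m_assoc)
  qed
  have z: "z k \<in> X \<and> f (z k) = f y" for k
  proof (induction k)
    case 0
    then show ?case using y yc by (simp add: z_def)
  next
    case (Suc k)
    then show ?case using X by (simp add: z_Suc)
  qed
  have inj: "inj z"
  proof (rule linorder_injI)
    fix j k :: nat assume jk: "j < k"
    show "z j \<noteq> z k"
    proof
      assume "z j = z k"
      then have "inv m [^] j = inv m [^] k" using m yc by (simp add: z_def)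
      moreover have "inv m [^] k = inv m [^] j \<otimes> inv m [^] (k - j)"
        using nat_pow_mult[of "inv m" j "k - j"] m jk by simp
      ultimately have "inv m [^] (k - j) = \<one>"
        using m by (metis inv_closed nat_pow_closed l_cancel_one')
      then have "m [^] (k - j) = \<one>" using m(1) by (simp add: nat_pow_inv inv_eq_1_iff)
      then show False using m(2)[of "k - j"] jk by simp
    qed
  qed
  have "real n * (f y)\<^sup>2 \<le> C" for n
  proof -
    have "(\<Sum>x\<in>z ` {..<n}. (f x)\<^sup>2) = (\<Sum>k<n. (f (z k))\<^sup>2)"
      using inj by (subst sum.reindex) (auto intro: inj_on_subset)
    also have "\<dots> = real n * (f y)\<^sup>2" using z by simp
    finally show ?thesis using C[of "z ` {..<n}"] z X by force
  qed
  moreover obtain n :: nat where "C / (f y)\<^sup>2 < real n" using reals_Archimedean2 by blast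
  ultimately show False using \<open>f y \<noteq> 0\<close>
    by (metis divide_less_eq linorder_not_less zero_less_power2)
qed

text \<open>
  A cocycle vanishing at \<open>n\<^sub>0\<close> is, on the coset \<open>N\<close>, invariant under the conjugates of \<open>n\<^sub>0\<close> as soon
  as its restriction to \<open>N\<close> vanishes on \<open>N\<close>. Square-summability turns invariance into vanishing.
\<close>

lemma (in group) cocycle_vanishes:
  fixes D :: "'a \<Rightarrow> 'a \<Rightarrow> real"
  assumes N: "N \<lhd> G"
    and D: "\<And>g h y. g \<in> carrier G \<Longrightarrow> h \<in> carrier G \<Longrightarrow> y \<in> carrier G \<Longrightarrow> D (g \<otimes> h) y = D g y + D h (inv g \<otimes> y)"
    and C: "\<And>g. g \<in> carrier G \<Longrightarrow> \<exists>C. \<forall>F. finite F \<longrightarrow> F \<subseteq> carrier G \<longrightarrow> (\<Sum>y\<in>F. (D g y)\<^sup>2) \<le> C"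
    and n0: "n0 \<in> N" "\<And>k :: nat. 0 < k \<Longrightarrow> n0 [^] k \<noteq> \<one>" "\<And>y. y \<in> carrier G \<Longrightarrow> D n0 y = 0"
    and L: "L \<subseteq> N" "N \<subseteq> generate G L" "\<And>l n. l \<in> L \<Longrightarrow> n \<in> N \<Longrightarrow> D l n = 0"
    and g: "g \<in> carrier G" and y: "y \<in> carrier G"
  shows "D g y = 0"
proof -
  interpret N: normal N G by fact
  have n0c: "n0 \<in> carrier G" using n0 N.subset by blast
  have D1: "D \<one> y = 0" if "y \<in> carrier G" for y using D[of \<one> \<one> y] that by simp
  have Dinv: "D (inv h) y = - D h (h \<otimes> y)" if "h \<in> carrier G" "y \<in> carrier G" for h y
    using D[of "inv h" h y] D1[of y] that by simp
  let ?K = "{n \<in> N. \<forall>y\<in>N. D n y = 0}"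
  have K: "subgroup ?K G"
  proof
    show "?K \<subseteq> carrier G" using N.subset by blast
    show "\<one> \<in> ?K" using D1 N.subset by auto
  next
    fix a b assume "a \<in> ?K" "b \<in> ?K"
    moreover from this have "inv a \<otimes> y \<in> N" if "y \<in> N" for y using that by simp
    ultimately show "a \<otimes> b \<in> ?K" using D N.subset by (auto simp: subset_iff)
  next
    fix a assume "a \<in> ?K"
    then show "inv a \<in> ?K" using Dinv N.subset by (auto simp: subset_iff)
  qed
  have "L \<subseteq> ?K" using L by blast
  then have "generate G L \<subseteq> ?K" using K by (rule generate_subgroup_incl)
  then have DN: "D n y = 0" if "n \<in> N" "y \<in> N" for n y using that L(2) by blast
  define c where "c g = g \<otimes> n0 \<otimes> inv g" for g
  have cN: "c g \<in> N" "c g \<in> carrier G" if "g \<in> carrier G" for g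
    using that n0 N.inv_op_closed2 n0c by (auto simp: c_def)
  have c_pow: "c g [^] k \<noteq> \<one>" if g: "g \<in> carrier G" and "0 < k" for g and k :: nat
  proof
    assume *: "c g [^] k = \<one>"
    have "c g [^] k = g \<otimes> n0 [^] k \<otimes> inv g" for k :: nat
    proof (induction k)
      case (Suc k)
      then show ?case using g n0c by (simp add: c_def group_word_simps)
    qed (use g in simp)
    then have "g \<otimes> n0 [^] k \<otimes> inv g = \<one>" using * by simp
    then have "n0 [^] k = inv g \<otimes> inv (inv g)" using g n0c by (intro solve_middle) auto
    then show False using n0(2)[OF \<open>0 < k\<close>] g by simp
  qed
  \<comment> \<open>Two expansions of the cocycle at
    \<open>c g \<otimes> g = g \<otimes> n0\<close>; the term of \<open>n0\<close> vanishes.\<close>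
  have cg: "D g (inv (c g) \<otimes> y) = D g y - D (c g) y" if g: "g \<in> carrier G" and y: "y \<in> carrier G" for g y
  proof -
    have "c g \<otimes> g = g \<otimes> n0" using g n0c by (simp add: c_def group_word_simps)
    then have "D (c g) y + D g (inv (c g) \<otimes> y) = D g y + D n0 (inv g \<otimes> y)"
      using D[of "c g" g y] D[of g n0 y] g y cN(2)[OF g] n0c by simp
    then show ?thesis using n0(3)[of "inv g \<otimes> y"] g y by simp
  qed
  have DgN: "D g y = 0" if g: "g \<in> carrier G" and y: "y \<in> N" for g y
  proof -
    obtain C' where C': "\<And>F. finite F \<Longrightarrow> F \<subseteq> carrier G \<Longrightarrow> (\<Sum>y\<in>F. (D g y)\<^sup>2) \<le> C'" using C[OF g] by blast
    show ?thesis
    proof (rule square_summable_invariant_zero[OF cN(2)[OF g] c_pow[OF g] _ _ _ C' y])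
      show "inv (c g) \<otimes> y \<in> N" if "y \<in> N" for y using that cN(1)[OF g] by simp
      show "D g (inv (c g) \<otimes> y) = D g y" if "y \<in> N" for y
        using cg[OF g, of y] DN[OF cN(1)[OF g] that] that N.subset by auto
    qed (use N.subset in auto)
  qed
  have DNG: "D n z = 0" if n: "n \<in> N" and z: "z \<in> carrier G" for n z
  proof -
    have nc: "n \<in> carrier G" using n N.subset by blast
    \<comment> \<open>Conjugation by \<open>inv z\<close> moves the point \<open>z\<close> to the
      unit, which lies in \<open>N\<close>, where the vanishing is already known.\<close>
    let ?g = "inv z"
    let ?n = "?g \<otimes> n \<otimes> inv ?g"
    have nN: "?n \<in> N" using N.inv_op_closed2[of ?g n] n z by simp
    have "?n \<otimes> ?g = ?g \<otimes> n" using nc z by (simp add: group_word_simps)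
    then have "D ?n \<one> + D ?g (inv ?n \<otimes> \<one>) = D ?g \<one> + D n (inv ?g \<otimes> \<one>)"
      using D[of ?n ?g \<one>] D[of ?g n \<one>] z nc nN N.subset by auto
    moreover have "D ?n \<one> = 0" "D ?g (inv ?n \<otimes> \<one>) = 0" "D ?g \<one> = 0"
      using DN[OF nN] DgN[of ?g] z nN by auto
    ultimately show ?thesis using z by simp
  qed
  obtain C' where C': "\<And>F. finite F \<Longrightarrow> F \<subseteq> carrier G \<Longrightarrow> (\<Sum>y\<in>F. (D g y)\<^sup>2) \<le> C'" using C[OF g] by blast
  show ?thesis
  proof (rule square_summable_invariant_zero[OF cN(2)[OF g] c_pow[OF g] _ _ _ C' y])
    show "D g (inv (c g) \<otimes> y) = D g y" if "y \<in> carrier G" for y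
      using cg[OF g that] DNG[OF cN(1)[OF g] that] by simp
  qed (use cN[OF g] in auto)
qed

section \<open>The orbit counting inequality\<close>

text \<open>The square expands to \<open>(norm c)\<^sup>2 - 2 * (norm (X c))\<^sup>2 + (norm (X' (X
  c)))\<^sup>2\<close>, and the last term lies between 0 and
  \<open>(norm (X c))\<^sup>2\<close>.\<close>

lemma norm_minus_adjoint:
  fixes X :: "'u::real_inner \<Rightarrow> 'v::real_inner" and X' :: "'v \<Rightarrow> 'u"
  assumes adj: "\<And>x y. inner (X x) y = inner x (X' y)" and le: "\<And>y. norm (X' y) \<le> norm y"
  shows "(norm (c - X' (X c)))\<^sup>2 \<le> (norm c)\<^sup>2 - (norm (X c))\<^sup>2"
    and "(norm c)\<^sup>2 - 2 * (norm (X c))\<^sup>2 \<le> (norm (c - X' (X c)))\<^sup>2"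
proof -
  have adj1: "inner x (X' y) = inner (X x) y" and adj2: "inner (X' y) x = inner y (X x)" for x y
    using adj[of x y] by (simp_all add: inner_commute)
  have eq: "(norm (c - X' (X c)))\<^sup>2 = (norm c)\<^sup>2 - 2 * (norm (X c))\<^sup>2 + (norm (X' (X c)))\<^sup>2"
  proof -
    have "inner (X' (X c)) c = inner (X c) (X c)" "inner c (X' (X c)) = inner (X c) (X c)"
      by (simp_all only: adj1 adj2)
    then show ?thesis
      unfolding power2_norm_eq_inner inner_diff_left inner_diff_right by simp
  qed
  have "(norm (X' (X c)))\<^sup>2 \<le> (norm (X c))\<^sup>2" using le by (intro power_mono) auto
  then show "(norm (c - X' (X c)))\<^sup>2 \<le> (norm c)\<^sup>2 - (norm (X c))\<^sup>2" using eq by simp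
  show "(norm c)\<^sup>2 - 2 * (norm (X c))\<^sup>2 \<le> (norm (c - X' (X c)))\<^sup>2" using eq by simp
qed

text \<open>Each application of \<open>1 - X' X\<close> lowers the squared norm by at least the
  corresponding summand; the losses telescope.\<close>

lemma sum_iterates_le:
  fixes X :: "'u::real_inner \<Rightarrow> 'v::real_inner" and X' :: "'v \<Rightarrow> 'u"
  assumes adj: "\<And>x y. inner (X x) y = inner x (X' y)" and le: "\<And>y. norm (X' y) \<le> norm y"
  shows "(\<Sum>i<k. (norm (X (((\<lambda>c. c - X' (X c)) ^^ i) e)))\<^sup>2) + (norm (((\<lambda>c. c - X' (X c)) ^^ k) e))\<^sup>2 \<le> (norm e)\<^sup>2"
proof (induction k)
  case (Suc k)
  then show ?case
    using norm_minus_adjoint(1)[OF assms, of "((\<lambda>c. c - X' (X c)) ^^ k) e"] by simp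
qed simp

text \<open>Even iterates of \<open>1 - X' X\<close> on \<open>e\<close> converge to a vector
  \<open>w\<close> in the kernel of \<open>X\<close>, the projection of \<open>e\<close>. As
  \<open>P\<close> is a contraction and vanishes at \<open>w\<close>,
  \<open>(norm (P e))\<^sup>2\<close> is at most the total loss of squared norm, and every step
  loses at most twice the corresponding summand. The slack \<open>\<eta>\<close> allows stopping
  after finitely many steps.\<close>

lemma sum_iterates_ge:
  fixes X :: "'u::{real_inner, complete_space} \<Rightarrow> 'v::real_inner" and X' :: "'v \<Rightarrow> 'u" and P :: "'u \<Rightarrow> 'w::real_normed_vector"
  assumes X: "bounded_linear X" and adj: "\<And>x y. inner (X x) y = inner x (X' y)" and le: "\<And>y. norm (X' y) \<le> norm y"
    and P: "bounded_linear P" "\<And>c. norm (P c) \<le> norm c" "\<And>c. X c = 0 \<Longrightarrow> P c = 0"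
    and \<eta>: "0 < \<eta>"
  shows "\<exists>k. (norm (P e))\<^sup>2 - \<eta> \<le> 2 * (\<Sum>i<k. (norm (X (((\<lambda>c. c - X' (X c)) ^^ i) e)))\<^sup>2)"
proof -
  define A where "A c = c - X' (X c)" for c
  define y where "y k = (A ^^ k) e" for k
  define a where "a k = (norm (y k))\<^sup>2" for k
  have A_adj: "inner (A c) d = inner c (A d)" for c d
  proof -
    have "inner (X' (X c)) d = inner (X d) (X c)" "inner c (X' (X d)) = inner (X c) (X d)"
      using adj[of d "X c"] adj[of c "X d"] by (simp_all add: inner_commute)
    then show ?thesis
      unfolding A_def inner_diff_left inner_diff_right by (simp add: inner_commute)
  qed
  have y_inner: "inner (y m) (y n) = inner e (y (m + n))" for m n
  proof (induction m arbitrary: n)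
    case (Suc m)
    have "inner (y (Suc m)) (y n) = inner (y m) (y (Suc n))" by (simp add: y_def A_adj)
    then show ?case using Suc[of "Suc n"] by simp
  qed (simp add: y_def)
  have a_double: "inner e (y (2 * k)) = a k" for k
    using y_inner[of k k] by (simp add: a_def power2_norm_eq_inner mult_2)
  have step: "a (Suc k) \<le> a k - (norm (X (y k)))\<^sup>2" "a k - 2 * (norm (X (y k)))\<^sup>2 \<le> a (Suc k)" for k
    using norm_minus_adjoint[OF adj le, of "y k"] by (simp_all add: a_def y_def A_def)
  have dec: "decseq a" using step(1) by (intro decseq_SucI) (smt (verit) zero_le_power2)
  obtain l where l: "a \<longlonglongrightarrow> l"
    using decseq_convergent[OF dec, of 0] by (auto simp: a_def)
  have l_le: "l \<le> a k" for k using decseq_ge[OF dec l] .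
  have partial: "a 0 - a k \<le> 2 * (\<Sum>i<k. (norm (X (y i)))\<^sup>2)" for k
  proof (induction k)
    case (Suc k)
    then show ?case using step(2)[of k] by simp
  qed simp
  have Xy: "(\<lambda>k. norm (X (y k))) \<longlonglongrightarrow> 0"
  proof -
    have "(\<lambda>k. a k - a (Suc k)) \<longlonglongrightarrow> l - l" using l by (intro tendsto_diff LIMSEQ_Suc)
    then have lim: "(\<lambda>k. a k - a (Suc k)) \<longlonglongrightarrow> 0" by simp
    have "(norm (X (y k)))\<^sup>2 \<le> a k - a (Suc k)" for k using step(1)[of k] by linarith
    then have "(\<lambda>k. (norm (X (y k)))\<^sup>2) \<longlonglongrightarrow> 0"
      by (intro real_tendsto_sandwich[OF _ _ tendsto_const lim] always_eventually allI) simp_all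
    then have "(\<lambda>k. sqrt ((norm (X (y k)))\<^sup>2)) \<longlonglongrightarrow> sqrt 0" by (rule tendsto_real_sqrt)
    then show ?thesis by simp
  qed
  \<comment> \<open>Inner products of even iterates are values of the convergent sequence
    \<open>a\<close>, which makes the even iterates a Cauchy sequence.\<close>
  define z where "z k = y (2 * k)" for k
  have dist_z: "(norm (z j - z k))\<^sup>2 = a (2 * j) + a (2 * k) - 2 * a (j + k)" for j k
  proof -
    have "inner (z j) (z k) = a (j + k)"
      using y_inner[of "2 * j" "2 * k"] a_double[of "j + k"] by (simp add: z_def distrib_left)
    then show ?thesis
      unfolding power2_norm_eq_inner inner_diff_left inner_diff_right
      by (simp add: a_def z_def power2_norm_eq_inner inner_commute)
  qed
  have "Cauchy z"
  proof (rule CauchyI)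
    fix \<epsilon> :: real assume \<epsilon>: "0 < \<epsilon>"
    have "\<forall>\<^sub>F k in sequentially. dist (a k) l < \<epsilon>\<^sup>2 / 2" using l \<epsilon> by (intro tendstoD) auto
    then obtain M where M: "\<And>k. k \<ge> M \<Longrightarrow> dist (a k) l < \<epsilon>\<^sup>2 / 2" by (auto simp: eventually_sequentially)
    have "norm (z j - z k) < \<epsilon>" if jk: "j \<ge> M" "k \<ge> M" for j k
    proof -
      have "a (2 * j) < l + \<epsilon>\<^sup>2 / 2" "a (2 * k) < l + \<epsilon>\<^sup>2 / 2"
        using M[of "2 * j"] M[of "2 * k"] jk unfolding dist_real_def by linarith+
      then have "(norm (z j - z k))\<^sup>2 < \<epsilon>\<^sup>2"
        using dist_z[of j k] l_le[of "j + k"] by simp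
      then show ?thesis using \<epsilon> by (simp add: power_less_imp_less_base)
    qed
    then show "\<exists>M. \<forall>j\<ge>M. \<forall>k\<ge>M. norm (z j - z k) < \<epsilon>" by blast
  qed
  then obtain w where w: "z \<longlonglongrightarrow> w" using Cauchy_convergent_iff convergent_def by blast
  have sub: "filterlim (\<lambda>k. 2 * k) sequentially (sequentially :: nat filter)"
    by (rule filterlim_subseq) (auto simp: strict_mono_def)
  have "(\<lambda>k. norm (X (z k))) \<longlonglongrightarrow> 0" unfolding z_def using Xy sub by (rule filterlim_compose)
  moreover have "(\<lambda>k. norm (X (z k))) \<longlonglongrightarrow> norm (X w)"
    using w by (intro tendsto_norm bounded_linear.tendsto[OF X])
  ultimately have "X w = 0" using LIMSEQ_unique by fastforce
  then have Pw: "P w = 0" by (rule P(3))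
  have "(\<lambda>k. inner e (z k)) \<longlonglongrightarrow> inner e w" using w by (intro tendsto_intros)
  then have "a \<longlonglongrightarrow> inner e w" by (simp add: z_def a_double)
  then have ew: "inner e w = l" using l LIMSEQ_unique by blast
  have "(\<lambda>k. (norm (z k))\<^sup>2) \<longlonglongrightarrow> (norm w)\<^sup>2" using w by (intro tendsto_intros)
  moreover have "(\<lambda>k. (norm (z k))\<^sup>2) \<longlonglongrightarrow> l"
    using filterlim_compose[OF l sub] by (simp add: z_def a_def)
  ultimately have ww: "(norm w)\<^sup>2 = l" using LIMSEQ_unique by blast
  interpret P: bounded_linear P by (rule P(1))
  have "(norm (P e))\<^sup>2 = (norm (P (e - w)))\<^sup>2" by (simp add: P.diff Pw)
  also have "\<dots> \<le> (norm (e - w))\<^sup>2" using P(2) by (intro power_mono) auto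
  also have "\<dots> = a 0 - l"
    using ew ww unfolding power2_norm_eq_inner inner_diff_left inner_diff_right
    by (simp add: a_def y_def power2_norm_eq_inner inner_commute)
  finally have main: "(norm (P e))\<^sup>2 \<le> a 0 - l" .
  have "\<forall>\<^sub>F k in sequentially. dist (a k) l < \<eta>" using l \<eta> by (intro tendstoD) auto
  then obtain k where k: "dist (a k) l < \<eta>" by (auto simp: eventually_sequentially)
  have "(norm (P e))\<^sup>2 - \<eta> \<le> 2 * (\<Sum>i<k. (norm (X (y i)))\<^sup>2)"
    using main partial[of k] k by (simp add: dist_real_def)
  then show ?thesis unfolding y_def A_def by blast
qed

text \<open>Rests on \<open>(1 - X' X) X' = X' (1 - X X')\<close>: iteration on the source is traded
  for iteration on the target.\<close>

lemma iterates_adjoint: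
  fixes X :: "'u::real_inner \<Rightarrow> 'v::real_inner" and X' :: "'v \<Rightarrow> 'u"
  assumes X: "bounded_linear X" and X': "bounded_linear X'" and adj: "\<And>x y. inner (X x) y = inner x (X' y)"
  shows "inner (X (((\<lambda>c. c - X' (X c)) ^^ i) e)) f = inner e (X' (((\<lambda>d. d - X (X' d)) ^^ i) f))"
proof -
  interpret X: bounded_linear X by (rule X)
  interpret X': bounded_linear X' by (rule X')
  have "inner (((\<lambda>c. c - X' (X c)) ^^ i) e) (X' f) = inner e (X' (((\<lambda>d. d - X (X' d)) ^^ i) f))"
  proof (induction i arbitrary: f)
    case (Suc i)
    let ?a = "((\<lambda>c. c - X' (X c)) ^^ i) e"
    have "inner (?a - X' (X ?a)) (X' f) = inner ?a (X' (f - X (X' f)))"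
    proof -
      have "inner (X' (X ?a)) (X' f) = inner ?a (X' (X (X' f)))"
        using adj[of ?a "X (X' f)"] adj[of "X' f" "X ?a"] by (simp add: inner_commute)
      then show ?thesis by (simp add: inner_diff_left inner_diff_right X'.diff)
    qed
    moreover have "((\<lambda>d. d - X (X' d)) ^^ Suc i) f = ((\<lambda>d. d - X (X' d)) ^^ i) (f - X (X' f))"
      by (subst funpow_Suc_right) simp
    ultimately show ?case using Suc[of "f - X (X' f)"] by (simp del: funpow.simps add: funpow.simps(2)[of i "\<lambda>c. c - X' (X c)"])
  qed simp
  then show ?thesis by (simp add: adj)
qed

section \<open>The trace count over the cosets of N\<close>

lemma infsum_finite_sum:
  fixes f :: "'t \<Rightarrow> 'j \<Rightarrow> real"
  assumes "finite T" "\<And>t. t \<in> T \<Longrightarrow> f t summable_on A"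
  shows "(\<lambda>j. \<Sum>t\<in>T. f t j) summable_on A" "infsum (\<lambda>j. \<Sum>t\<in>T. f t j) A = (\<Sum>t\<in>T. infsum (f t) A)"
  using assms by (induction T rule: finite_induct) (auto simp: summable_on_add infsum_add)

lemma sum_norm_ell2_le:
  assumes "finite T" "\<And>F. finite F \<Longrightarrow> (\<Sum>j\<in>F. \<Sum>t\<in>T. (entry (f t) j)\<^sup>2) \<le> C"
  shows "(\<Sum>t\<in>T. (norm (f t))\<^sup>2) \<le> C"
proof -
  have "(\<Sum>t\<in>T. (norm (f t))\<^sup>2) = infsum (\<lambda>j. \<Sum>t\<in>T. (entry (f t) j)\<^sup>2) UNIV"
    using infsum_finite_sum(2)[OF assms(1) entry_square_summable[of "f _"]] by (simp add: norm_ell2_square)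
  also have "\<dots> \<le> C"
    using assms by (intro infsum_le_finite_sums infsum_finite_sum(1) entry_square_summable) auto
  finally show ?thesis .
qed

text \<open>The identity outside the carrier makes right translation a permutation of the whole
  type, as \<open>ell2_permute\<close> requires.\<close>

definition translate_fst :: "('a, 'm) monoid_scheme \<Rightarrow> 'a \<Rightarrow> 'a \<Rightarrow> 'a" where
  "translate_fst G n y = (if y \<in> carrier G then y \<otimes>\<^bsub>G\<^esub> n else y)"

definition translate_snd :: "('a, 'm) monoid_scheme \<Rightarrow> 'a \<Rightarrow> 'a \<times> 'a \<Rightarrow> 'a \<times> 'a" where
  "translate_snd G n i = (fst i, translate_fst G n (snd i))"

lemma bij_translate:
  assumes "group G" "n \<in> carrier G"
  shows "bij (translate_fst G n)" "bij (translate_snd G n)"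
proof -
  interpret group G by fact
  have inv: "translate_fst G (inv\<^bsub>G\<^esub> n) (translate_fst G n y) = y" "translate_fst G n (translate_fst G (inv\<^bsub>G\<^esub> n) y) = y" for y
    using assms(2) by (auto simp: translate_fst_def m_assoc)
  show "bij (translate_fst G n)"
    by (rule o_bij[of "translate_fst G (inv\<^bsub>G\<^esub> n)"]) (auto simp: fun_eq_iff inv)
  show "bij (translate_snd G n)"
    by (rule o_bij[of "translate_snd G (inv\<^bsub>G\<^esub> n)"]) (auto simp: fun_eq_iff inv translate_snd_def)
qed

text \<open>
  A counting form of \<open>tr (X\<^sup>* X) = tr (X X\<^sup>*)\<close>: an \<open>N\<close>-equivariant map to \<open>card L\<close> copies of the
  square-summable functions on \<open>N\<close> has trace at most \<open>card L\<close>.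
\<close>

lemma sum_iterates_over_cosets_le:
  fixes X :: "'a ell2 \<Rightarrow> ('a \<times> 'a) ell2"
  assumes G: "group G" and N: "subgroup N G" and L: "finite L"
    and X: "bounded_linear X" and X': "bounded_linear X'" and adj: "\<And>x y. inner (X x) y = inner x (X' y)"
    and le: "\<And>y. norm (X y) \<le> norm y" "\<And>y. norm (X' y) \<le> norm y"
    and supp: "\<And>c l n. \<not> (l \<in> L \<and> n \<in> N) \<Longrightarrow> entry (X c) (l, n) = 0"
    and equi: "\<And>n c. n \<in> N \<Longrightarrow> X (ell2_permute (translate_fst G n) c) = ell2_permute (translate_snd G n) (X c)"
    and T: "finite T" "T \<subseteq> carrier G"
      "\<And>t t' n n'. t \<in> T \<Longrightarrow> t' \<in> T \<Longrightarrow> n \<in> N \<Longrightarrow> n' \<in> N \<Longrightarrow> t \<otimes>\<^bsub>G\<^esub> inv\<^bsub>G\<^esub> n = t' \<otimes>\<^bsub>G\<^esub> inv\<^bsub>G\<^esub> n' \<Longrightarrow> t = t'"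
  shows "(\<Sum>t\<in>T. \<Sum>i<k. (norm (X (((\<lambda>c. c - X' (X c)) ^^ i) (ket t))))\<^sup>2) \<le> card L"
proof -
  interpret G: group G by fact
  interpret N: subgroup N G by fact
  interpret X: bounded_linear X by fact
  interpret X': bounded_linear X' by fact
  let ?U = "\<lambda>n. ell2_permute (translate_fst G n)" and ?V = "\<lambda>n. ell2_permute (translate_snd G n)"
  have bij: "bij (translate_fst G n)" "bij (translate_snd G n)" if "n \<in> N" for n
    using bij_translate[OF G] that N.subset by auto
  \<comment> \<open>The adjoint inherits equivariance, because permutations of coordinates preserve
    inner products.\<close>
  have equi': "X' (?V n d) = ?U n (X' d)" if n: "n \<in> N" for n d
  proof -
    have "inner (?U n c) (X' (?V n d)) = inner (?U n c) (?U n (X' d))" for c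
    proof -
      have "inner (?U n c) (X' (?V n d)) = inner (?V n (X c)) (?V n d)" by (simp add: equi n flip: adj)
      also have "\<dots> = inner (?U n c) (?U n (X' d))"
        by (simp only: inner_permute[OF bij(1)[OF n]] inner_permute[OF bij(2)[OF n]] adj)
      finally show ?thesis .
    qed
    moreover have "?U n (ket (translate_fst G n i)) = ket i" for i by (rule permute_ket[OF bij(1)[OF n]])
    ultimately have "entry (X' (?V n d)) i = entry (?U n (X' d)) i" for i by (metis inner_ket)
    then show ?thesis by (rule ell2_eqI)
  qed
  define B where "B d = d - X (X' d)" for d
  have BV: "B (?V n d) = ?V n (B d)" if n: "n \<in> N" for n d
    unfolding B_def permute_diff[OF bij(2)[OF n]] equi'[OF n] equi[OF n] ..
  have BiV: "(B ^^ i) (?V n d) = ?V n ((B ^^ i) d)" if n: "n \<in> N" for n d i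
    by (induction i) (auto simp: BV[OF n])
  define v where "v i l = X' ((B ^^ i) (ket (l, \<one>\<^bsub>G\<^esub>)))" for i l
  have ket_V: "?V n (ket (l, n)) = ket (l, \<one>\<^bsub>G\<^esub>)" if n: "n \<in> N" for n l
  proof -
    have "translate_snd G n (l, \<one>\<^bsub>G\<^esub>) = (l, n)"
      using n N.subset by (auto simp: translate_snd_def translate_fst_def)
    then show ?thesis using permute_ket[OF bij(2)[OF n], of "(l, \<one>\<^bsub>G\<^esub>)"] by simp
  qed
  \<comment> \<open>By equivariance, the entries at \<open>(l, n)\<close> for all \<open>n\<close>
    and all \<open>t\<close> are entries of the single vector \<open>v i l\<close> at translated
    positions.\<close>
  have entry_X: "entry (X (((\<lambda>c. c - X' (X c)) ^^ i) (ket t))) (l, n) = entry (v i l) (t \<otimes>\<^bsub>G\<^esub> inv\<^bsub>G\<^esub> n)"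
    if n: "n \<in> N" and t: "t \<in> T" for i l n t
  proof -
    have tc: "t \<in> carrier G" "n \<in> carrier G" using t T n N.subset by auto
    have "entry (X (((\<lambda>c. c - X' (X c)) ^^ i) (ket t))) (l, n)
        = inner (X (((\<lambda>c. c - X' (X c)) ^^ i) (ket t))) (ket (l, n))"
      by (simp add: inner_ket inner_commute)
    also have "\<dots> = inner (ket t) (X' ((B ^^ i) (ket (l, n))))"
      unfolding B_def by (rule iterates_adjoint[OF X X' adj])
    also have "\<dots> = entry (X' ((B ^^ i) (ket (l, n)))) t" by (rule inner_ket)
    also have "\<dots> = entry (?U n (X' ((B ^^ i) (ket (l, n))))) (t \<otimes>\<^bsub>G\<^esub> inv\<^bsub>G\<^esub> n)"
      using tc by (simp add: entry_permute[OF bij(1)[OF n]] translate_fst_def G.m_assoc)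
    also have "?U n (X' ((B ^^ i) (ket (l, n)))) = v i l"
      unfolding v_def by (simp only: equi'[OF n, symmetric] BiV[OF n, symmetric] ket_V[OF n])
    finally show ?thesis .
  qed
  have per_i: "(\<Sum>t\<in>T. (norm (X (((\<lambda>c. c - X' (X c)) ^^ i) (ket t))))\<^sup>2) \<le> (\<Sum>l\<in>L. (norm (v i l))\<^sup>2)" for i
  proof (rule sum_norm_ell2_le[OF T(1)])
    fix F :: "('a \<times> 'a) set" assume F: "finite F"
    let ?e = "\<lambda>t j. (entry (X (((\<lambda>c. c - X' (X c)) ^^ i) (ket t))) j)\<^sup>2"
    define N' where "N' = snd ` F \<inter> N"
    have N': "finite N'" "N' \<subseteq> N" using F by (auto simp: N'_def)
    have "(\<Sum>j\<in>F. \<Sum>t\<in>T. ?e t j) = (\<Sum>j\<in>F \<inter> L \<times> N. \<Sum>t\<in>T. ?e t j)"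
    proof (rule sum.mono_neutral_right[OF F])
      show "\<forall>j\<in>F - F \<inter> L \<times> N. (\<Sum>t\<in>T. ?e t j) = 0"
      proof
        fix j assume "j \<in> F - F \<inter> L \<times> N"
        then have "entry (X c) j = 0" for c using supp by (cases j) auto
        then show "(\<Sum>t\<in>T. ?e t j) = 0" by simp
      qed
    qed auto
    also have "\<dots> \<le> (\<Sum>j\<in>L \<times> N'. \<Sum>t\<in>T. ?e t j)"
    proof (rule sum_mono2)
      show "F \<inter> L \<times> N \<subseteq> L \<times> N'" unfolding N'_def by (auto intro: rev_image_eqI)
    qed (use L N' in \<open>auto intro: sum_nonneg\<close>)
    also have "\<dots> = (\<Sum>l\<in>L. \<Sum>n\<in>N'. \<Sum>t\<in>T. ?e t (l, n))"
      using sum.cartesian_product[of "\<lambda>l n. \<Sum>t\<in>T. ?e t (l, n)" N' L] by (simp add: split_beta)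
    also have "\<dots> = (\<Sum>l\<in>L. \<Sum>n\<in>N'. \<Sum>t\<in>T. (entry (v i l) (t \<otimes>\<^bsub>G\<^esub> inv\<^bsub>G\<^esub> n))\<^sup>2)"
      using N' entry_X by (intro sum.cong refl) auto
    also have "\<dots> \<le> (\<Sum>l\<in>L. (norm (v i l))\<^sup>2)"
    proof (rule sum_mono)
      fix l
      \<comment> \<open>Distinct representatives lie in distinct cosets, so no position of
        \<open>v i l\<close> is counted twice.\<close>
      have inj: "inj_on (\<lambda>(n, t). t \<otimes>\<^bsub>G\<^esub> inv\<^bsub>G\<^esub> n) (N' \<times> T)"
      proof (rule inj_onI)
        fix a b assume ab: "a \<in> N' \<times> T" "b \<in> N' \<times> T" "(\<lambda>(n, t). t \<otimes>\<^bsub>G\<^esub> inv\<^bsub>G\<^esub> n) a = (\<lambda>(n, t). t \<otimes>\<^bsub>G\<^esub> inv\<^bsub>G\<^esub> n) b"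
        obtain n t n' t' where e: "a = (n, t)" "b = (n', t')" by (cases a, cases b)
        have m: "n \<in> N" "n' \<in> N" "t \<in> T" "t' \<in> T" using ab e N' by auto
        then have "t = t'" using T(3) ab(3) e by auto
        moreover have c: "n \<in> carrier G" "n' \<in> carrier G" "t \<in> carrier G" using m N.subset T by auto
        ultimately have "inv\<^bsub>G\<^esub> n = inv\<^bsub>G\<^esub> n'" using ab(3) e by simp
        then have "n = n'" using c G.inv_inj by (auto dest: inj_onD)
        then show "a = b" using e \<open>t = t'\<close> by simp
      qed
      have "(\<Sum>n\<in>N'. \<Sum>t\<in>T. (entry (v i l) (t \<otimes>\<^bsub>G\<^esub> inv\<^bsub>G\<^esub> n))\<^sup>2)
          = (\<Sum>p\<in>N' \<times> T. (entry (v i l) ((\<lambda>(n, t). t \<otimes>\<^bsub>G\<^esub> inv\<^bsub>G\<^esub> n) p))\<^sup>2)"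
        by (simp add: sum.cartesian_product split_beta)
      also have "\<dots> = (\<Sum>y\<in>(\<lambda>(n, t). t \<otimes>\<^bsub>G\<^esub> inv\<^bsub>G\<^esub> n) ` (N' \<times> T). (entry (v i l) y)\<^sup>2)"
        by (subst sum.reindex[OF inj]) (simp add: o_def)
      also have "\<dots> \<le> (norm (v i l))\<^sup>2" using N' T by (intro sum_entry_le_norm) auto
      finally show "(\<Sum>n\<in>N'. \<Sum>t\<in>T. (entry (v i l) (t \<otimes>\<^bsub>G\<^esub> inv\<^bsub>G\<^esub> n))\<^sup>2) \<le> (norm (v i l))\<^sup>2" .
    qed
    finally show "(\<Sum>j\<in>F. \<Sum>t\<in>T. ?e t j) \<le> (\<Sum>l\<in>L. (norm (v i l))\<^sup>2)" .
  qed
  \<comment> \<open>\<open>sum_iterates_le\<close> with \<open>X\<close> and \<open>X'\<close>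
    exchanged, started at a unit vector.\<close>
  have per_l: "(\<Sum>i<k. (norm (v i l))\<^sup>2) \<le> 1" for l
  proof -
    have "inner (X' x) y = inner x (X y)" for x y using adj[of y x] by (simp add: inner_commute)
    from sum_iterates_le[of X' X, OF this le(1), of "ket (l, \<one>\<^bsub>G\<^esub>)" k]
    have "(\<Sum>i<k. (norm (v i l))\<^sup>2) + (norm ((B ^^ k) (ket (l, \<one>\<^bsub>G\<^esub>))))\<^sup>2 \<le> 1"
      unfolding v_def B_def by simp
    then show ?thesis by (smt (verit) zero_le_power2)
  qed
  have "(\<Sum>t\<in>T. \<Sum>i<k. (norm (X (((\<lambda>c. c - X' (X c)) ^^ i) (ket t))))\<^sup>2)
      = (\<Sum>i<k. \<Sum>t\<in>T. (norm (X (((\<lambda>c. c - X' (X c)) ^^ i) (ket t))))\<^sup>2)" by (rule sum.swap)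
  also have "\<dots> \<le> (\<Sum>i<k. \<Sum>l\<in>L. (norm (v i l))\<^sup>2)" by (intro sum_mono per_i)
  also have "\<dots> = (\<Sum>l\<in>L. \<Sum>i<k. (norm (v i l))\<^sup>2)" by (rule sum.swap)
  also have "\<dots> \<le> (\<Sum>l\<in>L. 1)" by (intro sum_mono per_l)
  finally show ?thesis by simp
qed

text \<open>The value at a word is a sum of as many translated rows of \<open>x\<close> as the word
  has letters; Minkowski's inequality does the rest.\<close>

lemma (in group) fox_square_bound:
  fixes x :: "'a \<times> 'a \<Rightarrow> real"
  assumes x: "\<And>t F. t \<in> S \<Longrightarrow> finite F \<Longrightarrow> F \<subseteq> carrier G \<Longrightarrow> (\<Sum>y\<in>F. (x (t, y))\<^sup>2) \<le> M\<^sup>2"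
    and M: "0 \<le> M" and S: "S \<subseteq> carrier G" and u: "set u \<subseteq> S" and F: "finite F" "F \<subseteq> carrier G"
  shows "(\<Sum>y\<in>F. (fox id G x u y)\<^sup>2) \<le> (real (length u) * M)\<^sup>2"
proof -
  have "L2_set (fox id G x u) F \<le> real (length u) * M" using u F
  proof (induction u arbitrary: F)
    case Nil
    then show ?case by (simp add: L2_set_def)
  next
    case (Cons t u)
    then have t: "t \<in> S" "t \<in> carrier G" using S by auto
    have "fox id G x (t # u) = (\<lambda>y. x (t, y) + fox id G x u (inv t \<otimes> y))" by auto
    then have "L2_set (fox id G x (t # u)) F \<le> L2_set (\<lambda>y. x (t, y)) F + L2_set (\<lambda>y. fox id G x u (inv t \<otimes> y)) F"
      using L2_set_triangle_ineq by metis
    also have "L2_set (\<lambda>y. x (t, y)) F \<le> M"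
      unfolding L2_set_def using x[OF t(1) Cons.prems(2,3)] M by (simp add: real_le_lsqrt sum_nonneg)
    also have "L2_set (\<lambda>y. fox id G x u (inv t \<otimes> y)) F = L2_set (fox id G x u) ((\<lambda>y. inv t \<otimes> y) ` F)"
    proof -
      have "inj_on (\<lambda>y. inv t \<otimes> y) F" using t Cons.prems by (auto simp: inj_on_def subset_iff)
      then show ?thesis unfolding L2_set_def by (subst sum.reindex) (auto simp: o_def)
    qed
    also have "\<dots> \<le> real (length u) * M"
      using Cons.prems t by (intro Cons.IH) auto
    finally show ?case by (simp add: algebra_simps)
  qed
  moreover have "0 \<le> L2_set (fox id G x u) F" by simp
  ultimately have "(L2_set (fox id G x u) F)\<^sup>2 \<le> (real (length u) * M)\<^sup>2" by (intro power_mono)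
  then show ?thesis by (simp add: L2_set_def sum_nonneg)
qed

lemma (in group) fox_sum_translate:
  fixes x :: "'a \<times> 'a \<Rightarrow> real"
  assumes "A \<subseteq> carrier G" "set u \<subseteq> carrier G" "y \<in> carrier G"
  shows "fox id G (\<lambda>i. \<Sum>g\<in>A. c g * x (fst i, snd i \<otimes> inv g)) u y = (\<Sum>g\<in>A. c g * fox id G x u (y \<otimes> inv g))"
  using assms(2,3)
proof (induction u arbitrary: y)
  case (Cons t u)
  then have "t \<in> carrier G" by simp
  then have "inv t \<otimes> y \<otimes> inv g = inv t \<otimes> (y \<otimes> inv g)" if "g \<in> A" for g
    using that Cons.prems assms(1) by (auto simp: m_assoc subset_iff)
  then show ?case using Cons by (simp add: sum.distrib distrib_left)
qed simp

text \<open>The reflected function is a row of the matrix of right convolution by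
  \<open>\<phi>\<close>.\<close>

lemma (in group) reflect_ell2:
  fixes \<phi> :: "'a \<Rightarrow> real"
  assumes \<phi>: "\<And>F. finite F \<Longrightarrow> F \<subseteq> carrier G \<Longrightarrow> (\<Sum>z\<in>F. (\<phi> z)\<^sup>2) \<le> M" and y: "y \<in> carrier G"
  shows "\<exists>f. \<forall>h. entry f h = (if h \<in> carrier G then \<phi> (y \<otimes> inv h) else 0)"
proof -
  have "(\<Sum>h\<in>F. (if h \<in> carrier G then \<phi> (y \<otimes> inv h) else 0)\<^sup>2) \<le> M" if F: "finite F" for F
  proof -
    have "(\<Sum>h\<in>F. (if h \<in> carrier G then \<phi> (y \<otimes> inv h) else 0)\<^sup>2) = (\<Sum>h\<in>F \<inter> carrier G. (\<phi> (y \<otimes> inv h))\<^sup>2)"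
      using F by (simp add: sum.inter_restrict if_distrib[of "\<lambda>x. x\<^sup>2"] cong: if_cong)
    also have "\<dots> = (\<Sum>z\<in>(\<lambda>h. y \<otimes> inv h) ` (F \<inter> carrier G). (\<phi> z)\<^sup>2)"
    proof -
      have "inj_on (\<lambda>h. y \<otimes> inv h) (F \<inter> carrier G)"
        using y inv_inj by (auto simp: inj_on_def)
      then show ?thesis by (subst sum.reindex) auto
    qed
    also have "\<dots> \<le> M" using F y by (intro \<phi>) auto
    finally show ?thesis .
  qed
  from ell2_of_bounded[OF this] show ?thesis by blast
qed

text \<open>In terms of dimensions: the cocycles arising from \<open>x\<close> by right convolution
  have positive dimension over \<open>G\<close>, hence infinite dimension over \<open>N\<close>, yet
  restriction embeds them into \<open>card L\<close> copies of the regular representation of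
  \<open>N\<close>.\<close>

theorem infinite_index_absurd:
  fixes G :: "('a, 'm) monoid_scheme"
  assumes G: "group G" and N: "N \<lhd> G" and inf: "infinite (rcosets\<^bsub>G\<^esub> N)"
    and S: "finite S" "S \<subseteq> carrier G" "\<And>g. g \<in> carrier G \<Longrightarrow> \<exists>u. set u \<subseteq> S \<and> word_val G u = g"
    and L: "finite L" "L \<subseteq> N" "N \<subseteq> generate G L"
    and u0: "set u0 \<subseteq> S" "word_val G u0 \<in> N" "\<And>k :: nat. 0 < k \<Longrightarrow> word_val G u0 [^]\<^bsub>G\<^esub> k \<noteq> \<one>\<^bsub>G\<^esub>"
    and s: "s \<in> S" and x: "x \<in> cocycle_conditions G S u0 s (valid_pairs G S) (carrier G)"
  shows False
proof -
  interpret G: group G by fact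
  interpret N: normal N G by fact
  obtain wd where wd: "\<And>g. g \<in> carrier G \<Longrightarrow> set (wd g) \<subseteq> S" "\<And>g. g \<in> carrier G \<Longrightarrow> word_val G (wd g) = g"
    using S(3) by metis
  have LG: "L \<subseteq> carrier G" using L N.subset by blast
  note foxD = cocycle_conditionsD(1)[OF x] and fox0 = cocycle_conditionsD(2)[OF x]
    and x1 = cocycle_conditionsD(3)[OF x]
  have contr: "(\<Sum>i\<in>F. (\<Sum>g\<in>A. c g * x (fst i, snd i \<otimes>\<^bsub>G\<^esub> inv\<^bsub>G\<^esub> g))\<^sup>2) \<le> (\<Sum>g\<in>A. (c g)\<^sup>2)"
    if "finite A" "A \<subseteq> carrier G" "finite F" "F \<subseteq> S \<times> carrier G" for A c F
    using cocycle_conditionsD(4)[OF x that] .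
  have contr_row: "(\<Sum>y\<in>F. (\<Sum>g\<in>A. c g * x (t, y \<otimes>\<^bsub>G\<^esub> inv\<^bsub>G\<^esub> g))\<^sup>2) \<le> (\<Sum>g\<in>A. (c g)\<^sup>2)"
    if A: "finite A" "A \<subseteq> carrier G" and F: "finite F" "F \<subseteq> carrier G" and t: "t \<in> S" for A c F t
  proof -
    have "(\<Sum>i\<in>Pair t ` F. (\<Sum>g\<in>A. c g * x (fst i, snd i \<otimes>\<^bsub>G\<^esub> inv\<^bsub>G\<^esub> g))\<^sup>2) \<le> (\<Sum>g\<in>A. (c g)\<^sup>2)"
      using A F t by (intro contr) auto
    then show ?thesis by (subst (asm) sum.reindex) (auto simp: inj_on_def)
  qed
  have x_row: "(\<Sum>y\<in>F. (x (t, y))\<^sup>2) \<le> 1\<^sup>2" if "t \<in> S" "finite F" "F \<subseteq> carrier G" for t F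
  proof -
    have "(\<Sum>y\<in>F. (\<Sum>g\<in>{\<one>\<^bsub>G\<^esub>}. 1 * x (t, y \<otimes>\<^bsub>G\<^esub> inv\<^bsub>G\<^esub> g))\<^sup>2) = (\<Sum>y\<in>F. (x (t, y))\<^sup>2)"
      using that by (intro sum.cong) auto
    then show ?thesis using contr_row[of "{\<one>\<^bsub>G\<^esub>}" F t "\<lambda>_. 1"] that by simp
  qed
  have "\<exists>f. \<forall>h. entry f h = (if h \<in> carrier G then fox id G x u (y \<otimes>\<^bsub>G\<^esub> inv\<^bsub>G\<^esub> h) else 0)"
    if "set u \<subseteq> S" "y \<in> carrier G" for u y
    by (rule G.reflect_ell2[OF G.fox_square_bound[OF x_row _ S(2) that(1)] that(2)]) auto
  \<comment> \<open>\<open>K u y\<close> is a row vector: its inner product with \<open>c\<close> is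
    the value, at the word \<open>u\<close> and the point \<open>y\<close>, of the cocycle that
    convolution makes from \<open>c\<close>.\<close>
  then obtain K where K: "\<And>u y h. set u \<subseteq> S \<Longrightarrow> y \<in> carrier G \<Longrightarrow>
      entry (K u y) h = (if h \<in> carrier G then fox id G x u (y \<otimes>\<^bsub>G\<^esub> inv\<^bsub>G\<^esub> h) else 0)" by metis
  have K_pair: "K u y = K v y" if "set u \<subseteq> S" "set v \<subseteq> S" "word_val G u = word_val G v" "y \<in> carrier G" for u v y
  proof (rule ell2_eqI)
    fix h
    have "fox id G x u (y \<otimes>\<^bsub>G\<^esub> inv\<^bsub>G\<^esub> h) = fox id G x v (y \<otimes>\<^bsub>G\<^esub> inv\<^bsub>G\<^esub> h)" if "h \<in> carrier G"
      using that \<open>y \<in> carrier G\<close> \<open>set u \<subseteq> S\<close> \<open>set v \<subseteq> S\<close> \<open>word_val G u = _\<close>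
      by (intro foxD) (auto simp: valid_pairs_def)
    then show "entry (K u y) h = entry (K v y) h" using K that by simp
  qed
  \<comment> \<open>Right convolution by \<open>x\<close>.\<close>
  define kP where "kP i = (if fst i \<in> S \<and> snd i \<in> carrier G then K [fst i] (snd i) else 0)" for i
  obtain P where P: "bounded_linear P" "\<And>c j. entry (P c) j = inner (kP j) c" "\<And>c. norm (P c) \<le> 1 * norm c"
  proof (rule matrix_operator[of 1 kP])
    fix F :: "('a \<times> 'a) set" and A :: "'a set" and c :: "'a \<Rightarrow> real" assume FA: "finite F" "finite A"
    let ?F = "F \<inter> S \<times> carrier G" and ?A = "A \<inter> carrier G"
    have e: "(\<Sum>i\<in>A. c i * entry (kP j) i) = (\<Sum>g\<in>?A. c g * x (fst j, snd j \<otimes>\<^bsub>G\<^esub> inv\<^bsub>G\<^esub> g))" if "j \<in> ?F" for j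
    proof -
      have "(\<Sum>i\<in>A. c i * entry (kP j) i) = (\<Sum>i\<in>A. if i \<in> carrier G then c i * x (fst j, snd j \<otimes>\<^bsub>G\<^esub> inv\<^bsub>G\<^esub> i) else 0)"
        using that K[of "[fst j]" "snd j"] by (intro sum.cong) (auto simp: kP_def)
      then show ?thesis using FA by (simp add: sum.inter_restrict)
    qed
    have "(\<Sum>j\<in>F. (\<Sum>i\<in>A. c i * entry (kP j) i)\<^sup>2) = (\<Sum>j\<in>?F. (\<Sum>i\<in>A. c i * entry (kP j) i)\<^sup>2)"
      using FA by (intro sum.mono_neutral_right) (auto simp: kP_def)
    also have "\<dots> = (\<Sum>j\<in>?F. (\<Sum>g\<in>?A. c g * x (fst j, snd j \<otimes>\<^bsub>G\<^esub> inv\<^bsub>G\<^esub> g))\<^sup>2)"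
      using e by (intro sum.cong) auto
    also have "\<dots> \<le> (\<Sum>g\<in>?A. (c g)\<^sup>2)" using FA by (intro contr) auto
    also have "\<dots> \<le> (\<Sum>g\<in>A. (c g)\<^sup>2)" using FA by (intro sum_mono2) auto
    finally show "(\<Sum>j\<in>F. (\<Sum>i\<in>A. c i * entry (kP j) i)\<^sup>2) \<le> 1\<^sup>2 * (\<Sum>i\<in>A. (c i)\<^sup>2)" by simp
  qed auto
  have fox_P: "fox id G (entry (P c)) u y = inner (K u y) c" if "set u \<subseteq> S" "y \<in> carrier G" for c u y
    using that
  proof (induction u arbitrary: y)
    case Nil
    then have "K [] y = 0" using K[of "[]" y] by (intro ell2_eqI) simp
    then show ?case by simp
  next
    case (Cons t u)
    then have t: "t \<in> S" "t \<in> carrier G" using S by auto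
    have "K (t # u) y = K [t] y + K u (inv\<^bsub>G\<^esub> t \<otimes>\<^bsub>G\<^esub> y)"
      using Cons.prems t K[of "t # u" y] K[of "[t]" y] K[of u "inv\<^bsub>G\<^esub> t \<otimes>\<^bsub>G\<^esub> y"]
      by (intro ell2_eqI) (simp add: G.m_assoc)
    then show ?case using Cons t by (simp add: P(2) kP_def inner_add_left)
  qed
  \<comment> \<open>Scales \<open>X\<close> to a contraction: the part of a generator
    \<open>l\<close> has norm at most the length of its word \<open>wd l\<close>. The added 1 keeps
    \<open>C\<close> positive.\<close>
  define C where "C = sqrt ((\<Sum>l\<in>L. (real (length (wd l)))\<^sup>2) + 1)"
  have C2: "C\<^sup>2 = (\<Sum>l\<in>L. (real (length (wd l)))\<^sup>2) + 1" and C0: "0 < C"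
    by (auto simp: C_def add_nonneg_pos sum_nonneg)
  \<comment> \<open>The cocycles obtained from \<open>x\<close>, restricted to \<open>N\<close> and evaluated at the generators of \<open>N\<close>.\<close>
  define kX where "kX i = (if fst i \<in> L \<and> snd i \<in> N then (1 / C) *\<^sub>R K (wd (fst i)) (snd i) else 0)" for i
  have kX_entry: "entry (kX (l, n)) h = (if h \<in> carrier G then fox id G x (wd l) (n \<otimes>\<^bsub>G\<^esub> inv\<^bsub>G\<^esub> h) / C else 0)"
    if "l \<in> L" "n \<in> N" for l n h
    using that K[of "wd l" n h] wd(1)[of l] LG N.subset by (auto simp: kX_def subset_iff)
  obtain X where X: "bounded_linear X" "\<And>c j. entry (X c) j = inner (kX j) c" "\<And>c. norm (X c) \<le> 1 * norm c"
  proof (rule matrix_operator[of 1 kX])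
    fix F :: "('a \<times> 'a) set" and A :: "'a set" and c :: "'a \<Rightarrow> real" assume FA: "finite F" "finite A"
    define A' where "A' = A \<inter> carrier G"
    define N' where "N' = snd ` F \<inter> N"
    have A': "finite A'" "A' \<subseteq> carrier G" and N': "finite N'" "N' \<subseteq> N" "N' \<subseteq> carrier G"
      using FA N.subset by (auto simp: A'_def N'_def)
    define M where "M = sqrt (\<Sum>g\<in>A'. (c g)\<^sup>2)"
    have M2: "M\<^sup>2 = (\<Sum>g\<in>A'. (c g)\<^sup>2)" "0 \<le> M" by (auto simp: M_def sum_nonneg)
    let ?x = "\<lambda>i. \<Sum>g\<in>A'. c g * x (fst i, snd i \<otimes>\<^bsub>G\<^esub> inv\<^bsub>G\<^esub> g)"
    have e: "(\<Sum>i\<in>A. c i * entry (kX (l, n)) i) = fox id G ?x (wd l) n / C" if "l \<in> L" "n \<in> N" for l n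
    proof -
      have "(\<Sum>i\<in>A. c i * entry (kX (l, n)) i)
          = (\<Sum>i\<in>A. if i \<in> carrier G then c i * (fox id G x (wd l) (n \<otimes>\<^bsub>G\<^esub> inv\<^bsub>G\<^esub> i) / C) else 0)"
        using kX_entry[OF that] by (intro sum.cong) auto
      also have "\<dots> = (\<Sum>g\<in>A'. c g * fox id G x (wd l) (n \<otimes>\<^bsub>G\<^esub> inv\<^bsub>G\<^esub> g)) / C"
        using FA by (simp add: A'_def sum.inter_restrict sum_divide_distrib if_distrib[of "\<lambda>x. x / C"] cong: if_cong)
      also have "\<dots> = fox id G ?x (wd l) n / C"
        using G.fox_sum_translate[OF A'(2), of "wd l" n] wd(1)[of l] S(2) that LG N.subset by auto
      finally show ?thesis .
    qed
    have "(\<Sum>j\<in>F. (\<Sum>i\<in>A. c i * entry (kX j) i)\<^sup>2) = (\<Sum>j\<in>F \<inter> L \<times> N. (\<Sum>i\<in>A. c i * entry (kX j) i)\<^sup>2)"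
      using FA by (intro sum.mono_neutral_right) (auto simp: kX_def)
    also have "\<dots> \<le> (\<Sum>j\<in>L \<times> N'. (\<Sum>i\<in>A. c i * entry (kX j) i)\<^sup>2)"
    proof (rule sum_mono2)
      show "F \<inter> L \<times> N \<subseteq> L \<times> N'" unfolding N'_def by (auto intro: rev_image_eqI)
    qed (use L N' in auto)
    also have "\<dots> = (\<Sum>l\<in>L. \<Sum>n\<in>N'. (\<Sum>i\<in>A. c i * entry (kX (l, n)) i)\<^sup>2)"
      using sum.cartesian_product[of "\<lambda>l n. (\<Sum>i\<in>A. c i * entry (kX (l, n)) i)\<^sup>2" N' L] by (simp add: split_beta)
    also have "\<dots> = (\<Sum>l\<in>L. \<Sum>n\<in>N'. (fox id G ?x (wd l) n)\<^sup>2) / C\<^sup>2"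
      unfolding sum_divide_distrib using N' by (intro sum.cong refl) (auto simp: e power_divide)
    also have "\<dots> \<le> (\<Sum>l\<in>L. (real (length (wd l)) * M)\<^sup>2) / C\<^sup>2"
    proof (intro divide_right_mono sum_mono)
      fix l assume l: "l \<in> L"
      show "(\<Sum>n\<in>N'. (fox id G ?x (wd l) n)\<^sup>2) \<le> (real (length (wd l)) * M)\<^sup>2"
      proof (rule G.fox_square_bound[OF _ M2(2) S(2)])
        show "(\<Sum>y\<in>F. (?x (t, y))\<^sup>2) \<le> M\<^sup>2" if "t \<in> S" "finite F" "F \<subseteq> carrier G" for t F
          using contr_row[OF A' that(2,3,1)] M2(1) by simp
      qed (use wd(1)[of l] l LG N' in auto)
    qed auto
    also have "\<dots> = (\<Sum>l\<in>L. (real (length (wd l)))\<^sup>2) * M\<^sup>2 / C\<^sup>2"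
      by (simp add: power_mult_distrib sum_distrib_right)
    also have "\<dots> \<le> C\<^sup>2 * M\<^sup>2 / C\<^sup>2" unfolding C2 by (intro divide_right_mono mult_right_mono) (auto simp: sum_nonneg)
    also have "\<dots> = (\<Sum>g\<in>A'. (c g)\<^sup>2)" using C0 M2 by simp
    also have "\<dots> \<le> (\<Sum>g\<in>A. (c g)\<^sup>2)" using FA by (intro sum_mono2) (auto simp: A'_def)
    finally show "(\<Sum>j\<in>F. (\<Sum>i\<in>A. c i * entry (kX j) i)\<^sup>2) \<le> 1\<^sup>2 * (\<Sum>i\<in>A. (c i)\<^sup>2)" by simp
  qed auto
  have X_le: "norm (X c) \<le> norm c" and P_le: "norm (P c) \<le> norm c" for c
    using X(3)[of c] P(3)[of c] by simp_all
  obtain X' where X': "bounded_linear X'" "\<And>x y. inner (X x) y = inner x (X' y)" "\<And>y. norm (X' y) \<le> 1 * norm y"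
    using adjoint_exists[OF X(1) zero_le_one X(3)] by blast
  have X'_le: "norm (X' c) \<le> norm c" for c using X'(3)[of c] by simp
  have supp: "entry (X c) (l, n) = 0" if "\<not> (l \<in> L \<and> n \<in> N)" for c l n
    using that by (auto simp: X(2) kX_def)
  have equi: "X (ell2_permute (translate_fst G n) c) = ell2_permute (translate_snd G n) (X c)" if n: "n \<in> N" for n c
  proof (rule ell2_eqI)
    fix j :: "'a \<times> 'a"
    obtain l n' where j: "j = (l, n')" by (cases j)
    have nc: "n \<in> carrier G" using n N.subset by blast
    note bij = bij_translate[OF G nc]
    have rhs: "entry (ell2_permute (translate_snd G n) (X c)) j = entry (X c) (l, translate_fst G n n')"
      by (simp add: entry_permute[OF bij(2)] j translate_snd_def)
    show "entry (X (ell2_permute (translate_fst G n) c)) j = entry (ell2_permute (translate_snd G n) (X c)) j"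
    proof (cases "l \<in> L \<and> n' \<in> N")
      case True
      then have n': "n' \<in> carrier G" using N.subset by blast
      have "ell2_permute (translate_fst G n) (kX (l, n' \<otimes>\<^bsub>G\<^esub> n)) = kX (l, n')"
      proof (rule ell2_eqI)
        fix h
        have "n' \<otimes>\<^bsub>G\<^esub> n \<otimes>\<^bsub>G\<^esub> inv\<^bsub>G\<^esub> (h \<otimes>\<^bsub>G\<^esub> n) = n' \<otimes>\<^bsub>G\<^esub> inv\<^bsub>G\<^esub> h" if "h \<in> carrier G"
          using that nc n' by (simp add: G.group_word_simps)
        then show "entry (ell2_permute (translate_fst G n) (kX (l, n' \<otimes>\<^bsub>G\<^esub> n))) h = entry (kX (l, n')) h"
          using True n nc by (simp add: entry_permute[OF bij(1)] kX_entry translate_fst_def)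
      qed
      then have "inner (kX (l, n')) (ell2_permute (translate_fst G n) c) = inner (kX (l, n' \<otimes>\<^bsub>G\<^esub> n)) c"
        using inner_permute[OF bij(1), of "kX (l, n' \<otimes>\<^bsub>G\<^esub> n)" c] by simp
      then show ?thesis unfolding rhs using n' by (simp add: X(2) j translate_fst_def)
    next
      case False
      have "\<not> (l \<in> L \<and> translate_fst G n n' \<in> N)"
      proof
        assume l: "l \<in> L \<and> translate_fst G n n' \<in> N"
        have n': "n' \<in> carrier G"
          using l N.subset nc by (cases "n' \<in> carrier G") (auto simp: translate_fst_def)
        have "(n' \<otimes>\<^bsub>G\<^esub> n) \<otimes>\<^bsub>G\<^esub> inv\<^bsub>G\<^esub> n \<in> N"
          using l n n' using N.m_closed[OF _ N.m_inv_closed[OF n]] by (simp add: translate_fst_def)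
        moreover have "(n' \<otimes>\<^bsub>G\<^esub> n) \<otimes>\<^bsub>G\<^esub> inv\<^bsub>G\<^esub> n = n'" using n' nc by (simp add: G.m_assoc)
        ultimately show False using False l by simp
      qed
      then show ?thesis unfolding rhs using False by (simp add: supp j)
    qed
  qed
  \<comment> \<open>\<open>X c = 0\<close> says that the cocycle of \<open>c\<close> vanishes on
    \<open>N\<close> at each generator of \<open>N\<close>, which is the input of the rigidity
    lemma.\<close>
  have kernel: "P c = 0" if Xc: "X c = 0" for c
  proof -
    define D where "D g y = fox id G (entry (P c)) (wd g) y" for g y
    have D_inner: "D g y = inner (K (wd g) y) c" if "g \<in> carrier G" "y \<in> carrier G" for g y
      unfolding D_def using wd(1) that by (intro fox_P) auto
    have D0: "D g y = 0" if "g \<in> carrier G" "y \<in> carrier G" for g y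
    proof (rule G.cocycle_vanishes[OF N _ _ u0(2,3) _ L(2,3) _ that])
      fix g h y assume gh: "g \<in> carrier G" "h \<in> carrier G" and y: "y \<in> carrier G"
      have w: "set (wd g) \<subseteq> S" "set (wd h) \<subseteq> S" "set (wd (g \<otimes>\<^bsub>G\<^esub> h)) \<subseteq> S" using wd gh by auto
      then have wG: "set (wd g) \<subseteq> carrier G" "set (wd h) \<subseteq> carrier G" using S by auto
      have "D (g \<otimes>\<^bsub>G\<^esub> h) y = inner (K (wd g @ wd h) y) c"
        unfolding D_inner[OF G.m_closed[OF gh] y]
        using K_pair[OF w(3), of "wd g @ wd h" y] w wG y gh by (simp add: wd G.word_val_append)
      also have "\<dots> = fox id G (entry (P c)) (wd g @ wd h) y" using w y by (intro fox_P[symmetric]) auto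
      also have "\<dots> = D g y + D h (inv\<^bsub>G\<^esub> g \<otimes>\<^bsub>G\<^esub> y)"
        unfolding D_def using fox_append[OF G G _ wG y, of id] gh by (simp add: wd hom_def)
      finally show "D (g \<otimes>\<^bsub>G\<^esub> h) y = D g y + D h (inv\<^bsub>G\<^esub> g \<otimes>\<^bsub>G\<^esub> y)" .
    next
      fix g assume g: "g \<in> carrier G"
      have row: "(\<Sum>y\<in>F. (entry (P c) (t, y))\<^sup>2) \<le> (norm (P c))\<^sup>2" if "finite F" for t F
      proof -
        have "(\<Sum>i\<in>Pair t ` F. (entry (P c) i)\<^sup>2) \<le> (norm (P c))\<^sup>2"
          using that by (intro sum_entry_le_norm) auto
        then show ?thesis by (subst (asm) sum.reindex) (auto simp: inj_on_def)
      qed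
      show "\<exists>C. \<forall>F. finite F \<longrightarrow> F \<subseteq> carrier G \<longrightarrow> (\<Sum>y\<in>F. (D g y)\<^sup>2) \<le> C"
        unfolding D_def using G.fox_square_bound[OF row norm_ge_zero S(2) wd(1)[OF g]] by blast
    next
      fix y assume y: "y \<in> carrier G"
      have n0: "word_val G u0 \<in> carrier G" using u0 N.subset by blast
      have "K (wd (word_val G u0)) y = K u0 y"
        using wd[OF n0] u0 y by (intro K_pair) auto
      also have "K u0 y = 0"
        using K[OF u0(1) y] fox0 y by (intro ell2_eqI) auto
      finally show "D (word_val G u0) y = 0" using D_inner[OF n0 y] by simp
    next
      fix l n assume l: "l \<in> L" and n: "n \<in> N"
      have "inner (kX (l, n)) c = 0" using X(2)[of c "(l, n)"] Xc by simp
      then show "D l n = 0" using l n LG N.subset C0 D_inner[of l n] by (auto simp: kX_def)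
    qed
    show "P c = 0"
    proof (rule ell2_eqI)
      fix i :: "'a \<times> 'a"
      obtain t y where i: "i = (t, y)" by (cases i)
      show "entry (P c) i = entry 0 i"
      proof (cases "t \<in> S \<and> y \<in> carrier G")
        case True
        then have t: "t \<in> carrier G" using S by blast
        have "K [t] y = K (wd t) y" using True t wd[OF t] by (intro K_pair) auto
        then show ?thesis using True D_inner[OF t, of y] D0[OF t, of y] by (simp add: P(2) kP_def i)
      next
        case False
        then show ?thesis by (auto simp: P(2) kP_def i)
      qed
    qed
  qed
  define \<epsilon> :: real where "\<epsilon> = 1 / card S"
  have \<epsilon>: "0 < \<epsilon>" using s S by (auto simp: \<epsilon>_def card_gt_0_iff)
  have P_ket: "\<epsilon>\<^sup>2 \<le> (norm (P (ket t)))\<^sup>2" if t: "t \<in> carrier G" for t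
  proof -
    have "entry (P (ket t)) (s, t) = entry (K [s] t) t"
      using t s by (simp add: P(2) kP_def inner_commute[of _ "ket t"] inner_ket)
    also have "\<dots> = x (s, \<one>\<^bsub>G\<^esub>)" using K[of "[s]" t t] t s by simp
    finally have "\<epsilon> \<le> norm (P (ket t))"
      using entry_le_norm[of "P (ket t)" "(s, t)"] x1 by (simp add: \<epsilon>_def)
    then show ?thesis using \<epsilon> by (intro power_mono) auto
  qed
  let ?a = "\<lambda>i t. (norm (X (((\<lambda>c. c - X' (X c)) ^^ i) (ket t))))\<^sup>2"
  have "\<exists>k. \<epsilon>\<^sup>2 / 4 \<le> (\<Sum>i<k. ?a i t)" if t: "t \<in> carrier G" for t
  proof -
    \<comment> \<open>Half of the lower bound is spent as slack, and the factor 2 in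
      \<open>sum_iterates_ge\<close> halves the rest; hence the 4.\<close>
    obtain k where "(norm (P (ket t)))\<^sup>2 - \<epsilon>\<^sup>2 / 2 \<le> 2 * (\<Sum>i<k. ?a i t)"
      using sum_iterates_ge[OF X(1) X'(2) X'_le P(1) P_le kernel, of "\<epsilon>\<^sup>2 / 2" "ket t"] \<epsilon> by auto
    then show ?thesis using P_ket[OF t] by (intro exI[of _ k]) simp
  qed
  then obtain k where k: "\<And>t. t \<in> carrier G \<Longrightarrow> \<epsilon>\<^sup>2 / 4 \<le> (\<Sum>i<k t. ?a i t)" by metis
  \<comment> \<open>More cosets than \<open>card L\<close> allows if each contributes
    \<open>\<epsilon>\<^sup>2 / 4\<close>.\<close>
  obtain m :: nat where m: "real (card L) / (\<epsilon>\<^sup>2 / 4) < real m" using reals_Archimedean2 by blast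
  obtain R where R: "R \<subseteq> rcosets\<^bsub>G\<^esub> N" "finite R" "card R = m"
    using infinite_arbitrarily_large[OF inf] by blast
  have "\<exists>t\<in>carrier G. Y = N #>\<^bsub>G\<^esub> t" if "Y \<in> R" for Y
    using that R(1) by (auto simp: RCOSETS_def)
  then obtain rep where rep: "\<And>Y. Y \<in> R \<Longrightarrow> rep Y \<in> carrier G" "\<And>Y. Y \<in> R \<Longrightarrow> Y = N #>\<^bsub>G\<^esub> rep Y" by metis
  define T where "T = rep ` R"
  have inj_rep: "inj_on rep R" using rep(2) by (metis inj_onI)
  have T: "finite T" "T \<subseteq> carrier G" "card T = m"
    using R rep inj_rep by (auto simp: T_def card_image)
  have distinct: "t = t'" if t: "t \<in> T" "t' \<in> T" and n: "n \<in> N" "n' \<in> N"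
      and eq: "t \<otimes>\<^bsub>G\<^esub> inv\<^bsub>G\<^esub> n = t' \<otimes>\<^bsub>G\<^esub> inv\<^bsub>G\<^esub> n'" for t t' n n'
  proof -
    have c: "t \<in> carrier G" "t' \<in> carrier G" "n \<in> carrier G" "n' \<in> carrier G"
      using t n T N.subset by auto
    have "t = t \<otimes>\<^bsub>G\<^esub> inv\<^bsub>G\<^esub> n \<otimes>\<^bsub>G\<^esub> n" using c by (simp add: G.m_assoc)
    also have "\<dots> = (t' \<otimes>\<^bsub>G\<^esub> (inv\<^bsub>G\<^esub> n' \<otimes>\<^bsub>G\<^esub> n) \<otimes>\<^bsub>G\<^esub> inv\<^bsub>G\<^esub> t') \<otimes>\<^bsub>G\<^esub> t'"
      unfolding eq using c by (simp add: G.m_assoc)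
    finally have tt: "t = (t' \<otimes>\<^bsub>G\<^esub> (inv\<^bsub>G\<^esub> n' \<otimes>\<^bsub>G\<^esub> n) \<otimes>\<^bsub>G\<^esub> inv\<^bsub>G\<^esub> t') \<otimes>\<^bsub>G\<^esub> t'" .
    have "t' \<otimes>\<^bsub>G\<^esub> (inv\<^bsub>G\<^esub> n' \<otimes>\<^bsub>G\<^esub> n) \<otimes>\<^bsub>G\<^esub> inv\<^bsub>G\<^esub> t' \<in> N"
      using N.inv_op_closed2[OF c(2)] n by simp
    then have "t \<in> N #>\<^bsub>G\<^esub> t'" using tt by (auto simp: r_coset_def)
    then have "N #>\<^bsub>G\<^esub> t' = N #>\<^bsub>G\<^esub> t" by (rule G.repr_independence[OF _ c(2) N.subgroup_axioms])
    then show ?thesis using t rep unfolding T_def by (metis imageE)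
  qed
  \<comment> \<open>There are finitely many representatives, so one number of iterations serves them
    all.\<close>
  define k' where "k' = Max (k ` T)"
  have "real m * (\<epsilon>\<^sup>2 / 4) = (\<Sum>t\<in>T. \<epsilon>\<^sup>2 / 4)" using T by simp
  also have "\<dots> \<le> (\<Sum>t\<in>T. \<Sum>i<k'. ?a i t)"
  proof (rule sum_mono)
    fix t assume t: "t \<in> T"
    have "k t \<le> k'" unfolding k'_def using t T by (intro Max_ge) auto
    then have "(\<Sum>i<k t. ?a i t) \<le> (\<Sum>i<k'. ?a i t)" by (intro sum_mono2) auto
    then show "\<epsilon>\<^sup>2 / 4 \<le> (\<Sum>i<k'. ?a i t)" using k[of t] t T by auto
  qed
  also have "\<dots> \<le> card L"
    using sum_iterates_over_cosets_le[OF G N.subgroup_axioms L(1) X(1) X'(1,2) X_le X'_le supp equi T(1,2) distinct] .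
  finally show False using m \<epsilon> by (simp add: field_simps)
qed

section \<open>Finitely generated parafree groups\<close>

lemma (in group) generate_word_val:
  assumes S: "S \<subseteq> carrier G" and g: "g \<in> generate G S"
  shows "\<exists>u. set u \<subseteq> S \<union> (\<lambda>s. inv s) ` S \<and> word_val G u = g"
  using g
proof (induction rule: generate.induct)
  case one
  show ?case by (rule exI[of _ "[]"]) simp
next
  case (incl h)
  then show ?case using S by (intro exI[of _ "[h]"]) auto
next
  case (inv h)
  then show ?case using S by (intro exI[of _ "[inv h]"]) auto
next
  case (eng h1 h2)
  then obtain u1 u2 where u: "set u1 \<subseteq> S \<union> (\<lambda>s. inv s) ` S" "word_val G u1 = h1"
    "set u2 \<subseteq> S \<union> (\<lambda>s. inv s) ` S" "word_val G u2 = h2" by blast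
  have "S \<union> (\<lambda>s. inv s) ` S \<subseteq> carrier G" using S by auto
  then have "word_val G (u1 @ u2) = h1 \<otimes> h2" using u by (subst word_val_append) auto
  then show ?case using u by (intro exI[of _ "u1 @ u2"]) auto
qed

lemma (in group) rcos_lower_central_eq_iff:
  "g \<in> carrier G \<Longrightarrow> lower_central G c #> g = lower_central G c \<longleftrightarrow> g \<in> lower_central G c"
  using coset_join1[OF _ _ subgroup_lower_central] coset_join2[OF _ subgroup_lower_central] by metis

lemma (in group) rcos_lower_central_hom: "(\<lambda>g. lower_central G c #> g) \<in> hom G (G Mod lower_central G c)"
  using normal.r_coset_hom_Mod[OF lower_central_normal] .

text \<open>Unfolds the isomorphism of quotients into a surjective homomorphism on \<open>G\<close>
  with kernel \<open>lower_central G c\<close>.\<close>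

lemma nilpotent_quotient_map:
  assumes G: "group G" and F: "group F" and \<psi>: "\<psi> \<in> iso (G Mod lower_central G c) (F Mod lower_central F c)"
    and p_def: "p = (\<lambda>g. \<psi> (lower_central G c #>\<^bsub>G\<^esub> g))"
  shows "p \<in> hom G (F Mod lower_central F c)"
    and "\<And>g. g \<in> carrier G \<Longrightarrow> p g = lower_central F c \<longleftrightarrow> g \<in> lower_central G c"
    and "\<And>g. g \<in> carrier G \<Longrightarrow> \<exists>f\<in>carrier F. p g = lower_central F c #>\<^bsub>F\<^esub> f"
    and "\<And>f. f \<in> carrier F \<Longrightarrow> \<exists>g\<in>carrier G. p g = lower_central F c #>\<^bsub>F\<^esub> f"
proof -
  interpret G: group G by fact
  interpret F: group F by fact
  have \<psi>_hom: "\<psi> \<in> hom (G Mod lower_central G c) (F Mod lower_central F c)"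
    and \<psi>_bij: "bij_betw \<psi> (carrier (G Mod lower_central G c)) (carrier (F Mod lower_central F c))"
    using \<psi> by (auto simp: iso_def)
  show p: "p \<in> hom G (F Mod lower_central F c)"
    using hom_compose[OF G.rcos_lower_central_hom \<psi>_hom] by (simp add: p_def comp_def)
  have cG: "lower_central G c #>\<^bsub>G\<^esub> g \<in> carrier (G Mod lower_central G c)" if "g \<in> carrier G" for g
    using that by (auto simp: carrier_FactGroup)
  have "\<psi> \<one>\<^bsub>G Mod lower_central G c\<^esub> = \<one>\<^bsub>F Mod lower_central F c\<^esub>"
    by (rule hom_one[OF \<psi>_hom normal.factorgroup_is_group normal.factorgroup_is_group])
      (rule G.lower_central_normal F.lower_central_normal)+
  then have one: "\<psi> (lower_central G c) = lower_central F c" by (simp add: FactGroup_def)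
  show "p g = lower_central F c \<longleftrightarrow> g \<in> lower_central G c" if g: "g \<in> carrier G" for g
  proof -
    have "lower_central G c \<in> carrier (G Mod lower_central G c)"
      using cG[OF G.one_closed] G.lower_central_subset by (simp add: G.coset_mult_one)
    then have "\<psi> (lower_central G c #>\<^bsub>G\<^esub> g) = \<psi> (lower_central G c) \<longleftrightarrow>
        lower_central G c #>\<^bsub>G\<^esub> g = lower_central G c"
      using inj_on_eq_iff[OF bij_betw_imp_inj_on[OF \<psi>_bij] cG[OF g]] by simp
    then show ?thesis using G.rcos_lower_central_eq_iff[OF g] one by (simp add: p_def)
  qed
  show "\<exists>f\<in>carrier F. p g = lower_central F c #>\<^bsub>F\<^esub> f" if g: "g \<in> carrier G" for g
    using hom_in_carrier[OF p g] by (auto simp: carrier_FactGroup)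
  show "\<exists>g\<in>carrier G. p g = lower_central F c #>\<^bsub>F\<^esub> f" if f: "f \<in> carrier F" for f
  proof -
    have "lower_central F c #>\<^bsub>F\<^esub> f \<in> carrier (F Mod lower_central F c)"
      using f by (auto simp: carrier_FactGroup)
    then obtain X where "X \<in> carrier (G Mod lower_central G c)" "\<psi> X = lower_central F c #>\<^bsub>F\<^esub> f"
      using \<psi>_bij by (metis bij_betw_imp_surj_on imageE)
    then show ?thesis by (auto simp: carrier_FactGroup p_def)
  qed
qed

lemma same_nilpotent_genus_iso:
  assumes "same_nilpotent_genus G F" "1 \<le> c"
  obtains \<psi> where "\<psi> \<in> iso (G Mod lower_central G c) (F Mod lower_central F c)"
  using assms unfolding same_nilpotent_genus_def is_iso_def by blast

lemma residually_nilpotent_separates: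
  assumes "residually_nilpotent G" "z \<noteq> \<one>\<^bsub>G\<^esub>"
  obtains c where "1 \<le> c" "z \<notin> lower_central G c"
  using assms unfolding residually_nilpotent_def by blast

text \<open>A nontrivial torsion element would survive in some quotient of the series. There it
  corresponds to a torsion element of the quotient of the free group, excluded by
  \<open>lower_central_torsion_free\<close>.\<close>

lemma parafree_torsion_free:
  assumes G: "group G" and res: "residually_nilpotent G"
    and genus: "same_nilpotent_genus G (free_group B)" and B: "finite B"
    and z: "z \<in> carrier G" "z [^]\<^bsub>G\<^esub> (k :: nat) = \<one>\<^bsub>G\<^esub>" "0 < k"
  shows "z = \<one>\<^bsub>G\<^esub>"
proof (rule ccontr)
  let ?F = "free_group B"
  interpret G: group G by fact
  interpret F: group ?F by (rule group_free_group)
  assume "z \<noteq> \<one>\<^bsub>G\<^esub>"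
  then obtain c where c: "1 \<le> c" "z \<notin> lower_central G c" by (rule residually_nilpotent_separates[OF res])
  obtain \<psi> where \<psi>: "\<psi> \<in> iso (G Mod lower_central G c) (?F Mod lower_central ?F c)"
    by (rule same_nilpotent_genus_iso[OF genus c(1)])
  define p where "p = (\<lambda>g. \<psi> (lower_central G c #>\<^bsub>G\<^esub> g))"
  note p = nilpotent_quotient_map[OF G F.is_group \<psi> p_def]
  have Mod: "group (?F Mod lower_central ?F c)" by (rule normal.factorgroup_is_group[OF F.lower_central_normal])
  obtain f where f: "f \<in> carrier ?F" "p z = lower_central ?F c #>\<^bsub>?F\<^esub> f" by (rule bexE[OF p(3)[OF z(1)]])
  obtain e \<mu> where "magnus_hom ?F (card B) e \<mu>" by (rule magnus_hom_free_group[OF B])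
  then interpret magnus_hom ?F "card B" e \<mu> .
  interpret p: group_hom G "?F Mod lower_central ?F c" p
    using p(1) G Mod by (simp add: group_hom_def group_hom_axioms_def)
  interpret \<pi>: group_hom ?F "?F Mod lower_central ?F c" "\<lambda>f. lower_central ?F c #>\<^bsub>?F\<^esub> f"
    using F.rcos_lower_central_hom Mod F.is_group by (simp add: group_hom_def group_hom_axioms_def)
  have "lower_central ?F c #>\<^bsub>?F\<^esub> (f [^]\<^bsub>?F\<^esub> k) = (p z) [^]\<^bsub>?F Mod lower_central ?F c\<^esub> k"
    using \<pi>.hom_nat_pow[OF f(1)] f(2) by simp
  also have "\<dots> = p (z [^]\<^bsub>G\<^esub> k)" using p.hom_nat_pow[OF z(1)] by simp
  also have "\<dots> = lower_central ?F c" using z(2) p(2)[OF G.one_closed] subgroup.one_closed[OF G.subgroup_lower_central] by simp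
  finally have "f [^]\<^bsub>?F\<^esub> k \<in> lower_central ?F c" using F.rcos_lower_central_eq_iff f(1) by blast
  then have "f \<in> lower_central ?F c" using lower_central_torsion_free f(1) z(3) by blast
  then show False using p(2)[OF z(1)] F.rcos_lower_central_eq_iff[OF f(1)] f(2) c(2) by simp
qed

text \<open>One \<open>c\<close> keeps all of \<open>T\<close> outside the \<open>c\<close>-th term.
  The corresponding elements of the free group are separated in a 2-group whose \<open>c\<close>-th
  term is trivial, so the homomorphism transfers back to \<open>G\<close>.\<close>

lemma parafree_residually_two_group:
  assumes G: "group G" and res: "residually_nilpotent G"
    and genus: "same_nilpotent_genus G (free_group B)" and B: "finite B"
    and T: "finite T" "T \<subseteq> carrier G - {\<one>\<^bsub>G\<^esub>}"
  obtains Q :: "ncps monoid" and q k where "group Q" "Coset.order Q = 2 ^ k" "q \<in> hom G Q" "\<forall>z\<in>T. q z \<noteq> \<one>\<^bsub>Q\<^esub>"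
proof -
  let ?F = "free_group B"
  interpret G: group G by fact
  interpret F: group ?F by (rule group_free_group)
  have "\<exists>c. 1 \<le> c \<and> z \<notin> lower_central G c" if "z \<in> T" for z
    using residually_nilpotent_separates[OF res, of z] that T(2) by blast
  then obtain cz where cz: "\<And>z. z \<in> T \<Longrightarrow> 1 \<le> cz z \<and> z \<notin> lower_central G (cz z)" by metis
  define c where "c = Max (insert 1 (cz ` T))"
  have c1: "1 \<le> c" unfolding c_def using T(1) by (intro Max_ge) auto
  have zc: "z \<notin> lower_central G c" if z: "z \<in> T" for z
  proof -
    have "cz z \<le> c" unfolding c_def using T(1) z by (intro Max_ge) auto
    then show ?thesis using cz[OF z] G.lower_central_antimono by blast
  qed
  obtain \<psi> where \<psi>: "\<psi> \<in> iso (G Mod lower_central G c) (?F Mod lower_central ?F c)"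
    by (rule same_nilpotent_genus_iso[OF genus c1])
  note p = nilpotent_quotient_map[OF G F.is_group \<psi> refl]
  have "\<exists>f. f \<in> carrier ?F \<and> \<psi> (lower_central G c #>\<^bsub>G\<^esub> z) = lower_central ?F c #>\<^bsub>?F\<^esub> f" if "z \<in> T" for z
    using p(3)[of z] that T(2) by auto
  then obtain f where f: "\<And>z. z \<in> T \<Longrightarrow> f z \<in> carrier ?F"
    "\<And>z. z \<in> T \<Longrightarrow> \<psi> (lower_central G c #>\<^bsub>G\<^esub> z) = lower_central ?F c #>\<^bsub>?F\<^esub> f z" by metis
  have f_notin: "f z \<notin> lower_central ?F c" if "z \<in> T" for z
    using p(2)[of z] f[OF that] zc[OF that] that T(2) F.rcos_lower_central_eq_iff[OF f(1)[OF that]] by auto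
  obtain e \<mu> where "magnus_hom ?F (card B) e \<mu>" by (rule magnus_hom_free_group[OF B])
  then interpret magnus_hom ?F "card B" e \<mu> .
  obtain Q :: "ncps monoid" and q k where Q: "group Q" "Coset.order Q = 2 ^ k" "lower_central Q c = {\<one>\<^bsub>Q\<^esub>}"
    "q \<in> hom ?F Q" "\<And>z. z \<in> f ` T \<Longrightarrow> q z \<noteq> \<one>\<^bsub>Q\<^esub>"
    by (rule separating_quotient[of "f ` T" c]) (use T(1) f(1) f_notin c1 in auto)
  obtain q' where q': "q' \<in> hom G Q"
    "\<And>g f. g \<in> carrier G \<Longrightarrow> f \<in> carrier ?F \<Longrightarrow>
      \<psi> (lower_central G c #>\<^bsub>G\<^esub> g) = lower_central ?F c #>\<^bsub>?F\<^esub> f \<Longrightarrow> q' g = q f"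
    by (rule transfer_hom[OF G F.is_group Q(1) \<psi> Q(4) Q(3)]) blast
  have "\<forall>z\<in>T. q' z \<noteq> \<one>\<^bsub>Q\<^esub>"
  proof
    fix z assume z: "z \<in> T"
    have "q' z = q (f z)" using q'(2)[of z "f z"] f[OF z] z T(2) by blast
    then show "q' z \<noteq> \<one>\<^bsub>Q\<^esub>" using Q(5)[of "f z"] z by simp
  qed
  then show thesis by (rule that[OF Q(1,2) q'(1)])
qed

text \<open>Derivations over the trivial group modulo 2 are homomorphisms to
  \<open>\<int>/2\<close>. They are determined on \<open>S\<close>, so there are finitely many,
  while different functions on \<open>B\<close> yield different ones.\<close>

lemma parafree_basis_finite:
  fixes B :: "'x set"
  assumes G: "group G" and genus: "same_nilpotent_genus G (free_group B)"
    and S: "finite S" "S \<subseteq> carrier G" "\<And>g. g \<in> carrier G \<Longrightarrow> \<exists>u. set u \<subseteq> S \<and> word_val G u = g"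
  shows "finite B"
proof -
  define Q :: "unit monoid" where "Q = \<lparr>carrier = {()}, monoid.mult = (\<lambda>x y. ()), one = ()\<rparr>"
  have Q: "group Q" by (rule groupI) (auto simp: Q_def)
  have q: "(\<lambda>g. ()) \<in> hom G Q" by (auto simp: hom_def Q_def)
  have ord: "Coset.order Q = 2 ^ 0" by (simp add: Q_def Coset.order_def)
  let ?D = "B \<rightarrow>\<^sub>E (carrier Q \<rightarrow>\<^sub>E {0..<2 ^ 1 :: int})"
  obtain \<Phi> where \<Phi>: "\<And>f. f \<in> ?D \<Longrightarrow> derivation_mod G Q (\<lambda>g. ()) (2 ^ 1) (\<Phi> f)"
    "\<And>f f'. f \<in> ?D \<Longrightarrow> f' \<in> ?D \<Longrightarrow> (\<And>g. g \<in> carrier G \<Longrightarrow> \<Phi> f g = \<Phi> f' g) \<Longrightarrow> f = f'"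
    by (rule many_derivations[OF G Q genus ord q, of 1]) blast
  have inj: "inj_on (\<lambda>f. restrict (\<Phi> f) S) ?D"
  proof (rule inj_onI)
    fix f f' assume f: "f \<in> ?D" "f' \<in> ?D" and eq: "restrict (\<Phi> f) S = restrict (\<Phi> f') S"
    have eqS: "\<Phi> f s = \<Phi> f' s" if "s \<in> S" for s using fun_cong[OF eq, of s] that by simp
    show "f = f'"
    proof (rule \<Phi>(2)[OF f])
      fix g assume g: "g \<in> carrier G"
      obtain u where u: "set u \<subseteq> S" "word_val G u = g" using S(3)[OF g] by blast
      have uG: "set u \<subseteq> carrier G" using u S by auto
      have ext: "\<Phi> f g \<in> carrier Q \<rightarrow>\<^sub>E {0..<2 ^ 1 :: int}" "\<Phi> f' g \<in> carrier Q \<rightarrow>\<^sub>E {0..<2 ^ 1 :: int}"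
        using \<Phi>(1) f g unfolding derivation_mod_def by blast+
      show "\<Phi> f g = \<Phi> f' g"
      proof (rule PiE_ext[OF ext])
        fix y assume y: "y \<in> carrier Q"
        have "fox (\<lambda>g. ()) Q (\<lambda>(s, y). \<Phi> f s y) u y = fox (\<lambda>g. ()) Q (\<lambda>(s, y). \<Phi> f' s y) u y"
          using eqS u uG y by (intro fox_cong[OF G Q q]) auto
        then show "\<Phi> f g y = \<Phi> f' g y"
          using derivation_mod_fox[OF G Q q \<Phi>(1)[OF f(1)] uG y] derivation_mod_fox[OF G Q q \<Phi>(1)[OF f(2)] uG y] u(2)
          by simp
      qed
    qed
  qed
  have "(\<lambda>f. restrict (\<Phi> f) S) ` ?D \<subseteq> S \<rightarrow>\<^sub>E (carrier Q \<rightarrow>\<^sub>E {0..<2 ^ 1 :: int})"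
  proof (rule image_subsetI)
    fix f assume f: "f \<in> ?D"
    have "\<Phi> f s \<in> carrier Q \<rightarrow>\<^sub>E {0..<2 ^ 1 :: int}" if "s \<in> S" for s
      using \<Phi>(1)[OF f] S(2) that unfolding derivation_mod_def by blast
    then show "restrict (\<Phi> f) S \<in> S \<rightarrow>\<^sub>E (carrier Q \<rightarrow>\<^sub>E {0..<2 ^ 1 :: int})" by simp
  qed
  moreover have "finite (S \<rightarrow>\<^sub>E (carrier Q \<rightarrow>\<^sub>E {0..<2 ^ 1 :: int}))"
    using S(1) by (intro finite_PiE) (auto simp: Q_def)
  ultimately have fin: "finite ?D" using inj by (meson finite_imageD finite_subset)
  define F where "F = (\<lambda>b. \<lambda>x\<in>B. \<lambda>y\<in>carrier Q. if x = b then 1 else 0 :: int)"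
  have "F ` B \<subseteq> ?D" by (auto simp: F_def)
  moreover have "inj_on F B"
  proof (rule inj_onI)
    fix b b' assume b: "b \<in> B" "b' \<in> B" "F b = F b'"
    have "F b b () = F b' b ()" using b(3) by simp
    then show "b = b'" using b(1) by (simp add: F_def Q_def split: if_splits)
  qed
  ultimately show "finite B" using fin by (meson finite_imageD finite_subset)
qed

text \<open>All quotients by terms of the series are cyclic, so every commutator lies in every term
  and is 1. Then the second term is trivial and \<open>G\<close> is isomorphic to its cyclic
  quotient by it.\<close>

lemma parafree_cyclic:
  assumes G: "group G" and res: "residually_nilpotent G"
    and genus: "same_nilpotent_genus G (free_group B)" and B: "finite B" "card B \<le> 1"
  obtains g0 where "g0 \<in> carrier G" "\<And>g. g \<in> carrier G \<Longrightarrow> \<exists>k :: int. g = g0 [^]\<^bsub>G\<^esub> k"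
proof -
  let ?F = "free_group B"
  interpret G: group G by fact
  interpret F: group ?F by (rule group_free_group)
  obtain x where x: "x \<in> carrier ?F" "carrier ?F = generate ?F {x}"
  proof (cases "B = {}")
    case True
    then have "carrier ?F = generate ?F {\<one>\<^bsub>?F\<^esub>}"
      using generate_free_group[of B] F.generate_empty F.generate_one by simp
    then show thesis by (rule that[OF F.one_closed])
  next
    case False
    then have "card B = 1" using B by (metis card_0_eq le_antisym less_one not_le)
    then obtain b where "B = {b}" by (rule card_1_singletonE)
    then have "generate ?F {[(b, True)]} = carrier ?F" using generate_free_group[of B] by simp
    moreover have "[(b, True)] \<in> generate ?F {[(b, True)]}" by (rule generate.incl) simp
    ultimately show thesis by (intro that[of "[(b, True)]"]) (simp_all only:)
  qed
  have cyc: "\<exists>g0\<in>carrier G. \<forall>g\<in>carrier G. \<exists>k :: int.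
      lower_central G c #>\<^bsub>G\<^esub> g = (lower_central G c #>\<^bsub>G\<^esub> g0) [^]\<^bsub>G Mod lower_central G c\<^esub> k" if c: "1 \<le> c" for c
  proof -
    obtain \<psi> where \<psi>: "\<psi> \<in> iso (G Mod lower_central G c) (?F Mod lower_central ?F c)"
      by (rule same_nilpotent_genus_iso[OF genus c])
    note p = nilpotent_quotient_map[OF G F.is_group \<psi> refl]
    obtain g0 where g0: "g0 \<in> carrier G" "\<psi> (lower_central G c #>\<^bsub>G\<^esub> g0) = lower_central ?F c #>\<^bsub>?F\<^esub> x"
      by (rule bexE[OF p(4)[OF x(1)]])
    have Mod: "group (?F Mod lower_central ?F c)" "group (G Mod lower_central G c)"
      by (rule normal.factorgroup_is_group F.lower_central_normal G.lower_central_normal)+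
    interpret M: group_hom "G Mod lower_central G c" "?F Mod lower_central ?F c" \<psi>
      using \<psi> Mod by (auto simp: iso_def group_hom_def group_hom_axioms_def)
    interpret \<pi>: group_hom ?F "?F Mod lower_central ?F c" "\<lambda>f. lower_central ?F c #>\<^bsub>?F\<^esub> f"
      using F.rcos_lower_central_hom Mod F.is_group by (simp add: group_hom_def group_hom_axioms_def)
    have cG: "lower_central G c #>\<^bsub>G\<^esub> g \<in> carrier (G Mod lower_central G c)" if "g \<in> carrier G" for g
      using that by (auto simp: carrier_FactGroup)
    have "\<exists>k :: int. lower_central G c #>\<^bsub>G\<^esub> g = (lower_central G c #>\<^bsub>G\<^esub> g0) [^]\<^bsub>G Mod lower_central G c\<^esub> k"
      if g: "g \<in> carrier G" for g
    proof -
      obtain f where f: "f \<in> carrier ?F" "\<psi> (lower_central G c #>\<^bsub>G\<^esub> g) = lower_central ?F c #>\<^bsub>?F\<^esub> f"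
        by (rule bexE[OF p(3)[OF g]])
      obtain k :: int where k: "f = x [^]\<^bsub>?F\<^esub> k" using f(1) F.generate_pow[OF x(1)] x(2) by blast
      have "\<psi> (lower_central G c #>\<^bsub>G\<^esub> g) = (\<psi> (lower_central G c #>\<^bsub>G\<^esub> g0)) [^]\<^bsub>?F Mod lower_central ?F c\<^esub> k"
        using f(2) k g0(2) \<pi>.hom_int_pow[OF x(1)] by simp
      also have "\<dots> = \<psi> ((lower_central G c #>\<^bsub>G\<^esub> g0) [^]\<^bsub>G Mod lower_central G c\<^esub> k)"
        using M.hom_int_pow[OF cG[OF g0(1)]] by simp
      finally have eq: "\<psi> (lower_central G c #>\<^bsub>G\<^esub> g) = \<psi> ((lower_central G c #>\<^bsub>G\<^esub> g0) [^]\<^bsub>G Mod lower_central G c\<^esub> k)" .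
      have "inj_on \<psi> (carrier (G Mod lower_central G c))" using \<psi> by (auto simp: iso_def bij_betw_def)
      from inj_onD[OF this eq cG[OF g] M.G.int_pow_closed[OF cG[OF g0(1)]]] show ?thesis by blast
    qed
    then show ?thesis using g0(1) by blast
  qed
  have comm: "commutator G g h = \<one>\<^bsub>G\<^esub>" if gh: "g \<in> carrier G" "h \<in> carrier G" for g h
  proof (rule ccontr)
    assume "commutator G g h \<noteq> \<one>\<^bsub>G\<^esub>"
    then obtain c where c: "1 \<le> c" "commutator G g h \<notin> lower_central G c"
      by (rule residually_nilpotent_separates[OF res])
    let ?M = "G Mod lower_central G c" and ?p = "\<lambda>g. lower_central G c #>\<^bsub>G\<^esub> g"
    interpret M: group ?M by (rule normal.factorgroup_is_group[OF G.lower_central_normal])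
    have p: "?p \<in> hom G ?M" by (rule G.rcos_lower_central_hom)
    obtain g0 where g0: "g0 \<in> carrier G" "\<And>g. g \<in> carrier G \<Longrightarrow> \<exists>k :: int. ?p g = (?p g0) [^]\<^bsub>?M\<^esub> k"
      using cyc[OF c(1)] by blast
    have pc: "?p g \<in> carrier ?M" if "g \<in> carrier G" for g using hom_in_carrier[OF p that] .
    obtain k l :: int where "?p g = (?p g0) [^]\<^bsub>?M\<^esub> k" "?p h = (?p g0) [^]\<^bsub>?M\<^esub> l" using g0(2) gh by blast
    then have "?p g \<otimes>\<^bsub>?M\<^esub> ?p h = ?p h \<otimes>\<^bsub>?M\<^esub> ?p g"
      using M.int_pow_mult[OF pc[OF g0(1)], of k l] M.int_pow_mult[OF pc[OF g0(1)], of l k] by (simp add: add.commute)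
    then have "commutator ?M (?p g) (?p h) = \<one>\<^bsub>?M\<^esub>" using M.commutator_eq_one_iff pc gh by blast
    then have "?p (commutator G g h) = lower_central G c"
      using hom_commutator[OF G M.is_group p gh] by (simp add: FactGroup_def)
    then show False using c(2) G.rcos_lower_central_eq_iff gh by simp
  qed
  have triv: "lower_central G 2 = {\<one>\<^bsub>G\<^esub>}"
  proof -
    have "{commutator G x y | x y. x \<in> lower_central G (Suc 0) \<and> y \<in> carrier G} = {\<one>\<^bsub>G\<^esub>}"
      using comm by (auto intro!: exI[of _ "\<one>\<^bsub>G\<^esub>"])
    then show ?thesis using G.lower_central_Suc_Suc[of 0] G.generate_one by (simp add: numeral_2_eq_2)
  qed
  obtain g0 where g0: "g0 \<in> carrier G" "\<forall>g\<in>carrier G. \<exists>k :: int.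
      lower_central G 2 #>\<^bsub>G\<^esub> g = (lower_central G 2 #>\<^bsub>G\<^esub> g0) [^]\<^bsub>G Mod lower_central G 2\<^esub> k"
    using cyc[of 2] by auto
  interpret \<pi>: group_hom G "G Mod lower_central G 2" "\<lambda>g. lower_central G 2 #>\<^bsub>G\<^esub> g"
    using G.rcos_lower_central_hom normal.factorgroup_is_group[OF G.lower_central_normal] G
    by (simp add: group_hom_def group_hom_axioms_def)
  show thesis
  proof (rule that[OF g0(1)])
    fix g assume g: "g \<in> carrier G"
    obtain k :: int where "lower_central G 2 #>\<^bsub>G\<^esub> g = (lower_central G 2 #>\<^bsub>G\<^esub> g0) [^]\<^bsub>G Mod lower_central G 2\<^esub> k"
      using g0(2) g by blast
    then have "lower_central G 2 #>\<^bsub>G\<^esub> g = lower_central G 2 #>\<^bsub>G\<^esub> (g0 [^]\<^bsub>G\<^esub> k)"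
      using \<pi>.hom_int_pow[OF g0(1)] by simp
    then have "{g} = {g0 [^]\<^bsub>G\<^esub> k}" using triv g g0(1) by (simp add: r_coset_def)
    then show "\<exists>k :: int. g = g0 [^]\<^bsub>G\<^esub> k" by blast
  qed
qed

text \<open>If \<open>g0 [^] k\<close> lies in \<open>N\<close> with \<open>k\<close> nonzero,
  remainders modulo \<open>k\<close> represent all cosets. The interval is symmetric because
  \<open>k\<close>, and with it the remainder, may be negative.\<close>

lemma (in group) finite_rcosets_cyclic:
  assumes N: "subgroup N G" "N \<noteq> {\<one>}" and g0: "g0 \<in> carrier G" "\<And>g. g \<in> carrier G \<Longrightarrow> \<exists>k :: int. g = g0 [^] k"
  shows "finite (rcosets N)"
proof -
  interpret N: subgroup N G by fact
  obtain n where n: "n \<in> N" "n \<noteq> \<one>" using N(2) N.one_closed by blast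
  obtain k :: int where k: "n = g0 [^] k" using g0(2) n(1) N.subset by blast
  have k0: "k \<noteq> 0" using n(2) k by (metis int_pow_0)
  have "rcosets N \<subseteq> (\<lambda>i. N #> (g0 [^] i)) ` {-\<bar>k\<bar>..\<bar>k\<bar>}"
  proof
    fix Y assume "Y \<in> rcosets N"
    then obtain g where g: "g \<in> carrier G" "Y = N #> g" by (auto simp: RCOSETS_def)
    obtain j :: int where j: "g = g0 [^] j" using g0(2)[OF g(1)] by blast
    have "g = n [^] (j div k) \<otimes> g0 [^] (j mod k)"
      unfolding j k using g0(1) by (simp add: int_pow_pow flip: int_pow_mult)
    moreover have "n [^] (j div k) \<in> N" using subgroup_int_pow_closed[OF N(1) n(1)] .
    ultimately have "Y = N #> (g0 [^] (j mod k))"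
      using g(2) g0(1) N.subset coset_mult_assoc[of N "n [^] (j div k)" "g0 [^] (j mod k)"]
        coset_join2[of "n [^] (j div k)" N] N(1) by (metis int_pow_closed subsetD)
    moreover have "j mod k \<in> {-\<bar>k\<bar>..\<bar>k\<bar>}"
      using abs_mod_less[OF k0, of j] by auto
    ultimately show "Y \<in> (\<lambda>i. N #> (g0 [^] i)) ` {-\<bar>k\<bar>..\<bar>k\<bar>}" by blast
  qed
  then show ?thesis by (rule finite_subset) simp
qed

theorem theoremC:
  fixes G :: "('a, 'm) monoid_scheme" and N :: "'a set"
  assumes "finitely_generated_group G"
    and "parafree TYPE('x) G"
    and "N \<lhd> G"
    and "N \<noteq> {\<one>\<^bsub>G\<^esub>}"
    and "finitely_generated_group (G\<lparr>carrier := N\<rparr>)"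
  shows "finite (carrier (G Mod N))"
proof -
  have G: "group G" and res: "residually_nilpotent G" using assms(2) by (auto simp: parafree_def)
  obtain B :: "'x set" where genus: "same_nilpotent_genus G (free_group B)"
    using assms(2) by (auto simp: parafree_def)
  interpret G: group G by fact
  interpret N: normal N G by fact
  obtain S0 where S0: "finite S0" "S0 \<subseteq> carrier G" "generate G S0 = carrier G"
    using assms(1) by (auto simp: finitely_generated_group_def)
  \<comment> \<open>Closed under inverses, so that every element is the value of a positive
    word.\<close>
  define S where "S = S0 \<union> (\<lambda>s. inv\<^bsub>G\<^esub> s) ` S0"
  have S: "finite S" "S \<subseteq> carrier G" using S0 by (auto simp: S_def)
  have words: "\<exists>u. set u \<subseteq> S \<and> word_val G u = g" if "g \<in> carrier G" for g
    using G.generate_word_val[OF S0(2), of g] that S0(3) by (simp add: S_def)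
  obtain L where L: "finite L" "L \<subseteq> N" "generate (G\<lparr>carrier := N\<rparr>) L = N"
    using assms(5) by (auto simp: finitely_generated_group_def)
  have LN: "N \<subseteq> generate G L" using G.generate_consistent[OF L(2) N.subgroup_axioms] L(3) by simp
  have B: "finite B" by (rule parafree_basis_finite[OF G genus S words])
  have "finite (rcosets\<^bsub>G\<^esub> N)"
  proof (cases "card B \<le> 1")
    case True
    obtain g0 where "g0 \<in> carrier G" "\<And>g. g \<in> carrier G \<Longrightarrow> \<exists>k :: int. g = g0 [^]\<^bsub>G\<^esub> k"
      by (rule parafree_cyclic[OF G res genus B True]) blast
    then show ?thesis by (rule G.finite_rcosets_cyclic[OF N.subgroup_axioms assms(4)])
  next
    case False
    show ?thesis
    proof (rule ccontr)
      assume inf: "infinite (rcosets\<^bsub>G\<^esub> N)"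
      obtain n0 where n0: "n0 \<in> N" "n0 \<noteq> \<one>\<^bsub>G\<^esub>" using assms(4) N.one_closed by blast
      then have n0G: "n0 \<in> carrier G" using N.subset by blast
      obtain u0 where u0: "set u0 \<subseteq> S" "word_val G u0 = n0" using words[OF n0G] by blast
      \<comment> \<open>One set of admissible targets for all separation problems, possible because
        the separating 2-groups share the type \<open>ncps monoid\<close>.\<close>
      define \<Q> :: "(ncps monoid \<times> ('a \<Rightarrow> ncps)) set"
        where "\<Q> = {(Q, q). group Q \<and> finite (carrier Q) \<and> q \<in> hom G Q \<and> has_many_derivations G B Q q}"
      have sep: "\<exists>(Q, q)\<in>\<Q>. \<forall>z\<in>T. q z \<noteq> \<one>\<^bsub>Q\<^esub>" if T: "finite T" "T \<subseteq> carrier G - {\<one>\<^bsub>G\<^esub>}" for T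
      proof -
        obtain Q :: "ncps monoid" and q k where Q: "group Q" "Coset.order Q = 2 ^ k" "q \<in> hom G Q"
          "\<forall>z\<in>T. q z \<noteq> \<one>\<^bsub>Q\<^esub>"
          by (rule parafree_residually_two_group[OF G res genus B T])
        have "has_many_derivations G B Q q"
          unfolding has_many_derivations_def
        proof
          fix j :: nat
          let ?D = "B \<rightarrow>\<^sub>E (carrier Q \<rightarrow>\<^sub>E {0..<2 ^ j :: int})"
          obtain \<Phi> where \<Phi>: "\<And>f. f \<in> ?D \<Longrightarrow> derivation_mod G Q q (2 ^ j) (\<Phi> f)"
            "\<And>f f'. f \<in> ?D \<Longrightarrow> f' \<in> ?D \<Longrightarrow> (\<And>g. g \<in> carrier G \<Longrightarrow> \<Phi> f g = \<Phi> f' g) \<Longrightarrow> f = f'"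
            by (rule many_derivations[OF G Q(1) genus Q(2,3), of j]) blast
          show "\<exists>\<Phi>. (\<forall>f\<in>?D. derivation_mod G Q q (2 ^ j) (\<Phi> f)) \<and>
             (\<forall>f\<in>?D. \<forall>f'\<in>?D. (\<forall>g\<in>carrier G. \<Phi> f g = \<Phi> f' g) \<longrightarrow> f = f')"
            by (intro exI[of _ \<Phi>] conjI ballI impI \<Phi>(1) \<Phi>(2)) simp_all
        qed
        moreover have "finite (carrier Q)" using Q(2) by (intro card_ge_0_finite) (simp add: Coset.order_def)
        ultimately have "(Q, q) \<in> \<Q>" using Q by (simp add: \<Q>_def)
        then show ?thesis using Q(4) by blast
      qed
      have \<Q>: "group Q \<and> finite (carrier Q) \<and> q \<in> hom G Q \<and> has_many_derivations G B Q q" if "(Q, q) \<in> \<Q>" for Q q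
        using that by (simp add: \<Q>_def)
      obtain s x where sx: "s \<in> S" "x \<in> cocycle_conditions G S u0 s (valid_pairs G S) (carrier G)"
        using limit_cocycle[OF G S words B _ u0(1) \<Q> sep] False by auto
      have "word_val G u0 [^]\<^bsub>G\<^esub> k \<noteq> \<one>\<^bsub>G\<^esub>" if "0 < k" for k :: nat
        using parafree_torsion_free[OF G res genus B n0G] that n0(2) u0(2) by blast
      then show False
        using infinite_index_absurd[OF G assms(3) inf S words L(1,2) LN u0(1)] n0(1) u0(2) sx by blast
    qed
  qed
  then show ?thesis by (simp add: FactGroup_def)
qed

end
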